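(* Consider the CTMDP $\{S,A,q,c\}$ described in the context, assume $\bar c(x):=\sup_{a\in A}c(x,a)<\infty$ for every $x\in S$, and call a $[1,\infty]$-valued function $V$ on $S$ a solution to the optimality equation if $$0=\inf_{a\in A}\left\{c(x,a)V(x)+\int_S q(dy|x,a)V(y)\right\}$$ for each $x\in S$ with $V(x)<\infty$. (a) Suppose there is a continuous $[1,\infty)$-valued Borel function $w$ on $S$ with $w(x)\ge1+\bar c(x)+\bar q_x$ for all $x\in S$; for each bounded continuous $f$ on $S$, $(x,a)\mapsto\int_S f(y)\tilde q(dy|x,a)$ is continuous on $S\times A$; $c$ is lower semicontinuous on $S\times A$; and $A$ is compact. Then $V^\ast$ is the minimal $[1,\infty]$-valued lower semicontinuous solution to the optimality equation. (b) Suppose for each bounded measurable $f$ on $S$ and each $x\in S$, $a\mapsto\int_S f(y)\tilde q(dy|x,a)$ is continuous on $A$; for each $x\in S$, $a\mapsto c(x,a)$ is lower semicontinuous; and $A$ is compact. Then $V^\ast$ is the minimal $[1,\infty]$-valued measurable solution to the optimality equation.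
   Context: $S$, $A$ are nonempty Borel spaces. The transition rate $q(dy|x,a)$ is a signed kernel on $\mathcal B(S)$ given $(x,a)\in S\times A$ with $\tilde q(\Gamma|x,a):=q(\Gamma\setminus\{x\}|x,a)\ge0$ for all $\Gamma\in\mathcal B(S)$, $q(S|x,a)=0$, and $\bar q_x:=\sup_{a\in A}q_x(a)<\infty$, where $q_x(a):=-q(\{x\}|x,a)$. The cost rate $c:S\times A\to[0,\infty)$ is measurable. Adjoin an isolated point $x_\infty\notin S$ and put $c(x_\infty,\cdot)=0$, $q_{x_\infty}(\cdot)=0$, $\tilde q(\cdot|x_\infty,\cdot)=0$. For a probability measure $\mu$ on $A$ write $q_x(\mu)=\int_A q_x(a)\mu(da)$, $\tilde q(dy|x,\mu)=\int_A\tilde q(dy|x,a)\mu(da)$. A policy $\pi=(\pi_n)_{n\ge0}$ is a sequence of stochastic kernels $\pi_n(da|x_0,\theta_1,x_1,\dots,\theta_n,x_n,s)$ on $A$ given $(x_0,\theta_1,\dots,\theta_n,x_n)\in S\times((0,\infty)\times S)^n$ and $s\in(0,\infty)$. For $x\in S$, $P_x^\pi$ is the probability measure on sequences $\omega=(x_0,\theta_1,x_1,\dots)$ ($\theta_n\in(0,\infty]$, $x_n\in S\cup\{x_\infty\}$, entries $(\infty,x_\infty)$ after the first infinite $\theta$) with $x_0=x$ and, on $\{x_n\in S\}$, writing $\pi_n(\cdot|s)=\pi_n(\cdot|x_0,\dots,x_n,s)$: $P_x^\pi(\theta_{n+1}\in\Gamma_1,x_{n+1}\in\Gamma_2|x_0,\dots,x_n)=\int_{\Gamma_1}e^{-\int_0^t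 q_{x_n}(\pi_n(\cdot|s))ds}\tilde q(\Gamma_2|x_n,\pi_n(\cdot|t))dt$, $P_x^\pi(\theta_{n+1}=\infty,x_{n+1}=x_\infty|x_0,\dots,x_n)=e^{-\int_0^\infty q_{x_n}(\pi_n(\cdot|s))ds}$; on $\{x_n=x_\infty\}$, $(\theta_{n+1},x_{n+1})=(\infty,x_\infty)$ a.s. The criterion is $V(x,\pi)=E_x^\pi\big[\exp\big(\sum_{n\ge0}\int_0^{\theta_{n+1}}\int_A c(x_n,a)\pi_n(da|x_0,\dots,x_n,s)ds\big)\big]$ and $V^\ast(x)=\inf_\pi V(x,\pi)$. Conventions: $0/0=0$, $0\cdot\infty=0$, $1/0=+\infty$, $\infty-\infty=\infty$. *)

theory Defs
  imports "HOL-Probability.Probability"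
begin

text \<open>State space S and action space A are Borel subsets of Polish spaces (standard Borel
spaces), carrying the subspace topology and the trace Borel sigma-algebra.
The transition rate q is encoded through its off-diagonal part qt = q-tilde:
qt x a is a finite measure on S with no mass at x; the jump intensity is
q_x(a) = qt(S|x,a) (since q(S|x,a) = 0), and q(Gamma|x,a) = qt(Gamma|x,a) - q_x(a)
if x is in Gamma, qt(Gamma|x,a) otherwise.  The cemetery x_infinity is encoded as None.\<close>

definition qrate :: "'s set \<Rightarrow> ('s \<Rightarrow> 'b \<Rightarrow> 's measure) \<Rightarrow> 's \<Rightarrow> 'b \<Rightarrow> real" where
  "qrate S qt x a = measure (qt x a) S"

definition ctmdp ::
  "'s::polish_space set \<Rightarrow> 'b::polish_space set \<Rightarrow> ('s \<Rightarrow> 'b \<Rightarrow> 's measure) \<Rightarrow> ('s \<Rightarrow> 'b \<Rightarrow> real) \<Rightarrow> bool"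
where
  "ctmdp S A qt c \<longleftrightarrow>
     S \<in> sets borel \<and> S \<noteq> {} \<and> A \<in> sets borel \<and> A \<noteq> {} \<and>
     (\<forall>x\<in>S. \<forall>a\<in>A. sets (qt x a) = sets (restrict_space borel S) \<and> emeasure (qt x a) {x} = 0) \<and>
     (\<forall>x\<in>S. (SUP a\<in>A. emeasure (qt x a) S) < \<top>) \<and>
     (\<forall>\<Gamma>\<in>sets (restrict_space borel S).
        (\<lambda>(x, a). emeasure (qt x a) \<Gamma>) \<in> borel_measurable (restrict_space borel S \<Otimes>\<^sub>M restrict_space borel A)) \<and>
     (\<forall>x\<in>S. \<forall>a\<in>A. 0 \<le> c x a) \<and>
     (\<lambda>(x, a). c x a) \<in> borel_measurable (restrict_space borel S \<Otimes>\<^sub>M restrict_space borel A)"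

definition Sinf :: "'s::topological_space set \<Rightarrow> 's option measure" where
  "Sinf S = sigma (insert None (Some ` S))
              (insert {None} ((\<lambda>B. Some ` B) ` sets (restrict_space borel S)))"

text \<open>Coordinate space of the trajectory: coordinate n is (theta_n, x_n), theta_n in [0,infinity]
(theta_0 is a dummy 0).\<close>
definition Mst :: "'s::topological_space set \<Rightarrow> (ennreal \<times> 's option) measure" where
  "Mst S = (borel :: ennreal measure) \<Otimes>\<^sub>M Sinf S"

type_synonym ('s, 'b) policy = "nat \<Rightarrow> (nat \<Rightarrow> ennreal \<times> 's option) \<Rightarrow> real \<Rightarrow> 'b measure"

definition is_policy :: "'s::topological_space set \<Rightarrow> 'b::topological_space set \<Rightarrow> ('s, 'b) policy \<Rightarrow> bool" where
  "is_policy S A pol \<longleftrightarrow>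
     (\<forall>n. (\<lambda>(h, s). pol n h s) \<in>
        measurable (PiM {0..<Suc n} (\<lambda>_. Mst S) \<Otimes>\<^sub>M (borel :: real measure)) (prob_algebra (restrict_space borel A)))"

definition ennexp_neg :: "ennreal \<Rightarrow> ennreal" where
  "ennexp_neg L = (if L = \<top> then 0 else ennreal (exp (- enn2real L)))"

definition ennexp :: "ennreal \<Rightarrow> ennreal" where
  "ennexp L = (if L = \<top> then \<top> else ennreal (exp (enn2real L)))"

definition qmix :: "'s::topological_space set \<Rightarrow> ('s \<Rightarrow> 'b \<Rightarrow> 's measure) \<Rightarrow> 's \<Rightarrow> 'b measure \<Rightarrow> 's measure" where
  "qmix S qt z \<mu> = measure_of S (sets (restrict_space borel S)) (\<lambda>\<Gamma>. \<integral>\<^sup>+ a. emeasure (qt z a) \<Gamma> \<partial>\<mu>)"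

definition Lam :: "'s set \<Rightarrow> ('s \<Rightarrow> 'b \<Rightarrow> 's measure) \<Rightarrow> ('s, 'b) policy \<Rightarrow> nat
    \<Rightarrow> (nat \<Rightarrow> ennreal \<times> 's option) \<Rightarrow> 's \<Rightarrow> ennreal \<Rightarrow> ennreal" where
  "Lam S qt pol n h z t =
     (\<integral>\<^sup>+ s. indicator {s. 0 < s \<and> ennreal s < t} s * (\<integral>\<^sup>+ a. ennreal (qrate S qt z a) \<partial>pol n h s) \<partial>lborel)"

text \<open>Conditional law of (theta_{n+1}, x_{n+1}) given the history h on {0..n} with x_n = z in S.\<close>
definition jump :: "'s::topological_space set \<Rightarrow> ('s \<Rightarrow> 'b \<Rightarrow> 's measure) \<Rightarrow> ('s, 'b) policy \<Rightarrow> nat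
    \<Rightarrow> (nat \<Rightarrow> ennreal \<times> 's option) \<Rightarrow> 's \<Rightarrow> (ennreal \<times> 's option) measure" where
  "jump S qt pol n h z = measure_of (space (Mst S)) (sets (Mst S))
     (\<lambda>B. (\<integral>\<^sup>+ t. indicator {0<..} t * ennexp_neg (Lam S qt pol n h z (ennreal t))
              * emeasure (qmix S qt z (pol n h t)) {y\<in>S. (ennreal t, Some y) \<in> B} \<partial>lborel)
          + ennexp_neg (Lam S qt pol n h z \<top>) * indicator B (\<top>, None))"

definition trans :: "'s::topological_space set \<Rightarrow> ('s \<Rightarrow> 'b \<Rightarrow> 's measure) \<Rightarrow> ('s, 'b) policy \<Rightarrow> 's
    \<Rightarrow> nat \<Rightarrow> (nat \<Rightarrow> ennreal \<times> 's option) \<Rightarrow> (ennreal \<times> 's option) measure" where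
  "trans S qt pol x n h = (case n of
       0 \<Rightarrow> return (Mst S) (0, Some x)
     | Suc m \<Rightarrow> (case snd (h m) of
           Some z \<Rightarrow> jump S qt pol m (restrict h {0..<Suc m}) z
         | None \<Rightarrow> return (Mst S) (\<top>, None)))"

definition Pth :: "'s::topological_space set \<Rightarrow> ('s \<Rightarrow> 'b \<Rightarrow> 's measure) \<Rightarrow> ('s, 'b) policy \<Rightarrow> 's
    \<Rightarrow> (nat \<Rightarrow> ennreal \<times> 's option) measure" where
  "Pth S qt pol x = projective_family.lim UNIV
      (Ionescu_Tulcea.CI (trans S qt pol x) (\<lambda>_. Mst S)) (\<lambda>_. Mst S)"

definition pathcost :: "('s \<Rightarrow> 'b \<Rightarrow> real) \<Rightarrow> ('s, 'b) policy \<Rightarrow> (nat \<Rightarrow> ennreal \<times> 's option) \<Rightarrow> ennreal" where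
  "pathcost c pol \<omega> = (\<Sum>n. (case snd (\<omega> n) of
        None \<Rightarrow> 0
      | Some z \<Rightarrow> \<integral>\<^sup>+ s. indicator {s. 0 < s \<and> ennreal s < fst (\<omega> (Suc n))} s
                      * (\<integral>\<^sup>+ a. ennreal (c z a) \<partial>pol n (restrict \<omega> {0..<Suc n}) s) \<partial>lborel))"

definition Vcrit :: "'s::topological_space set \<Rightarrow> ('s \<Rightarrow> 'b \<Rightarrow> 's measure) \<Rightarrow> ('s \<Rightarrow> 'b \<Rightarrow> real)
    \<Rightarrow> ('s, 'b) policy \<Rightarrow> 's \<Rightarrow> ennreal" where
  "Vcrit S qt c pol x = (\<integral>\<^sup>+ \<omega>. ennexp (pathcost c pol \<omega>) \<partial>Pth S qt pol x)"

definition Vstar :: "'s::topological_space set \<Rightarrow> 'b::topological_space set \<Rightarrow> ('s \<Rightarrow> 'b \<Rightarrow> 's measure)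
    \<Rightarrow> ('s \<Rightarrow> 'b \<Rightarrow> real) \<Rightarrow> 's \<Rightarrow> ennreal" where
  "Vstar S A qt c x = (INF pol \<in> {pol. is_policy S A pol}. Vcrit S qt c pol x)"

text \<open>Optimality equation 0 = inf_a { c(x,a)V(x) + int_S q(dy|x,a) V(y) } at every x with V(x) finite;
  int_S q(dy|x,a)V(y) = int V dqt(.|x,a) - q_x(a) V(x).\<close>
definition opt_eq :: "'s set \<Rightarrow> 'b set \<Rightarrow> ('s \<Rightarrow> 'b \<Rightarrow> 's measure) \<Rightarrow> ('s \<Rightarrow> 'b \<Rightarrow> real)
    \<Rightarrow> ('s \<Rightarrow> ennreal) \<Rightarrow> bool" where
  "opt_eq S A qt c V \<longleftrightarrow>
     (\<forall>x\<in>S. V x < \<top> \<longrightarrow>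
        (INF a\<in>A. ereal (c x a * enn2real (V x)) + enn2ereal (\<integral>\<^sup>+ y. V y \<partial>qt x a)
                   - ereal (qrate S qt x a * enn2real (V x))) = 0)"

definition lsc_on :: "'a::topological_space set \<Rightarrow> ('a \<Rightarrow> 'c::linorder) \<Rightarrow> bool" where
  "lsc_on S f \<longleftrightarrow> (\<forall>x\<in>S. \<forall>t. t < f x \<longrightarrow> eventually (\<lambda>y. t < f y) (at x within S))"

end

theory Submission
  imports Defs
begin

text \<open>
  Fix a state \<open>x\<close> and suppose that \<open>V \<ge> 1\<close> is collected at the first jump. Constant controls are
  optimal for this one-jump problem, and the constant control \<open>a\<close> has value at most \<open>v\<close> iff
  \<open>\<integral> V dq\<^sub>t(x,a) + v c(x,a) \<le> v q\<^sub>x(a)\<close>. Hence the optimal one-jump value \<open>L V\<close> has the sublevel sets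
  \<open>{x. \<exists>a. \<integral> V dq\<^sub>t(x,a) + v c(x,a) \<le> v q\<^sub>x(a)}\<close>, which are projections along the compact set \<open>A\<close>;
  they are closed in case (a), and in case (b) they are Borel because a Borel set with compact
  sections has a Borel projection (Novikov). The iterates \<open>L\<^sup>n 1\<close> increase to a function \<open>U\<close> of the
  same regularity; by compactness \<open>U\<close> solves the optimality equation, and every solution \<open>V\<close>
  satisfies \<open>L V \<le> V\<close> and so dominates \<open>U\<close>. Finally \<open>V\<^sup>* = U\<close>: the cost of any policy up to the
  \<open>n\<close>-th jump is worth at least \<open>L\<^sup>n 1\<close>, and the stationary policy given by a measurable selector of
  the actions attaining the optimality equation costs at most \<open>U\<close>.
\<close>

text \<open>Values and integrals may be infinite, so everything is phrased through finite levels v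
  and the inequality g + v c <= v q between nonnegative quantities, where g is the integral of V
  against the jump measure. No infinity is ever subtracted; an infinite g just makes the action
  inadmissible at every level. The inequality is affine in (g, c, q), which is why randomised and
  time-dependent actions gain nothing: its reverse for all single actions survives averaging at each
  time. The reverse is needed with a margin \<open>\<delta>\<close> > 0, however: in a state where g
  = c = q = 0 both sides agree for every v, yet the one-jump value is 1. Compactness of the sets of
  nearly admissible actions supplies the margin whenever no action is admissible, and the same
  argument makes infima attained and lets limits pass. The iteration starts at 1 for two reasons: 1
  lies below every candidate solution, and it is the terminal value of a cost that stops being
  charged at a jump. Projections of Borel sets are in general only analytic. Both the projections
  and the selector are kept Borel by separating analytic sets and exploiting that the sections are
  compact.\<close>

section \<open>Analytic sets and measurable selection\<close>

text \<open>Topology of the Baire space, spelled out through agreement on finite initial segments.\<close>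

definition cyl_closed :: "(nat \<Rightarrow> nat) set \<Rightarrow> bool" where
  "cyl_closed C \<longleftrightarrow> (\<forall>s. (\<forall>k. \<exists>t\<in>C. \<forall>i<k. t i = s i) \<longrightarrow> s \<in> C)"

definition cyl_cont :: "(nat \<Rightarrow> nat) set \<Rightarrow> ((nat \<Rightarrow> nat) \<Rightarrow> 'a::topological_space) \<Rightarrow> bool" where
  "cyl_cont C f \<longleftrightarrow> (\<forall>s\<in>C. \<forall>U. open U \<and> f s \<in> U \<longrightarrow> (\<exists>k. \<forall>t\<in>C. (\<forall>i<k. t i = s i) \<longrightarrow> f t \<in> U))"

text \<open>Images of closed subsets rather than of the whole Baire space: codes can be constrained
  (to converge, or to have equal limits) without retracting onto the constraint set, and the empty
  set is included.\<close>

definition analytic_set :: "'a::topological_space set \<Rightarrow> bool" where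
  "analytic_set A \<longleftrightarrow> (\<exists>C f. cyl_closed C \<and> cyl_cont C f \<and> A = f ` C)"

lemma cyl_closedD: "cyl_closed C \<Longrightarrow> (\<And>k. \<exists>t\<in>C. \<forall>i<k. t i = s i) \<Longrightarrow> s \<in> C"
  unfolding cyl_closed_def by blast

lemma cyl_contD:
  "cyl_cont C f \<Longrightarrow> s \<in> C \<Longrightarrow> open U \<Longrightarrow> f s \<in> U \<Longrightarrow> \<exists>k. \<forall>t\<in>C. (\<forall>i<k. t i = s i) \<longrightarrow> f t \<in> U"
  unfolding cyl_cont_def by blast

section \<open>Closure properties of analytic sets\<close>

lemma dense_sequence_exists:
  obtains d :: "nat \<Rightarrow> 'a::{metric_space, second_countable_topology}"
  where "\<And>x e. 0 < e \<Longrightarrow> \<exists>n. dist (d n) x < e"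
proof -
  obtain D :: "'a set" where D: "countable D" "\<And>X. open X \<Longrightarrow> X \<noteq> {} \<Longrightarrow> \<exists>d\<in>D. d \<in> X"
    using countable_dense_exists by (metis (no_types))
  have ne: "D \<noteq> {}" using D(2)[of UNIV] by auto
  show ?thesis
  proof (rule that)
    fix x :: 'a and e :: real assume "0 < e"
    then obtain y where "y \<in> D" "y \<in> ball x e" using D(2)[of "ball x e"] by auto
    moreover obtain n where "from_nat_into D n = y"
      using from_nat_into_surj[OF D(1) \<open>y \<in> D\<close>] by blast
    ultimately show "\<exists>n. dist (from_nat_into D n) x < e" by (metis dist_commute mem_ball)
  qed
qed

text \<open>A point is coded by indices into a dense sequence whose consecutive distances are at
  most 2^-n. Such codes converge by completeness, and agreement on the first n + 1 entries puts the
  limits within 4 * 2^-n of each other; this gives both closedness of the set of codes and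
  continuity of the limit map.\<close>

lemma analytic_closed:
  fixes F :: "'a::{complete_space, second_countable_topology} set"
  assumes "closed F"
  shows "analytic_set F"
proof -
  obtain d :: "nat \<Rightarrow> 'a" where d: "\<And>x e. 0 < e \<Longrightarrow> \<exists>n. dist (d n) x < e"
    by (rule dense_sequence_exists) blast
  define C0 where "C0 = {s. \<forall>n. dist (d (s n)) (d (s (Suc n))) \<le> (1/2)^n}"
  define f where "f s = lim (\<lambda>n. d (s n))" for s
  \<comment> \<open>The subtracted term makes the geometric sum exact, so that the induction on m
    closes; \<open>close'\<close> drops it again.\<close>
  have close: "dist (d (s n)) (d (s (n + m))) \<le> 2 * (1/2)^n - 2 * (1/2)^(n+m)" if "s \<in> C0" for s n m
  proof (induction m)
    case (Suc m)
    have "dist (d (s n)) (d (s (n + Suc m)))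
        \<le> dist (d (s n)) (d (s (n + m))) + dist (d (s (n + m))) (d (s (Suc (n + m))))"
      by (metis add_Suc_right dist_triangle)
    moreover have "dist (d (s (n + m))) (d (s (Suc (n + m)))) \<le> (1/2)^(n+m)"
      using that unfolding C0_def by blast
    moreover have "2 * (1/2::real)^(n + Suc m) = (1/2)^(n+m)" by simp
    ultimately show ?case using Suc by linarith
  qed simp
  have close': "dist (d (s n)) (d (s m)) \<le> 2 * (1/2)^n" if "s \<in> C0" "n \<le> m" for s n m
    using close[OF that(1), of n "m - n"] that(2)
    by (smt (verit) le_add_diff_inverse zero_le_power zero_le_divide_1_iff)
  have pow0: "(\<lambda>n. 4 * (1/2::real)^n) \<longlonglongrightarrow> 0"
    using tendsto_mult[OF tendsto_const LIMSEQ_power_zero[of "1/2::real"], of 4] by simp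
  have small: "\<exists>n. 4 * (1/2::real)^n < e" if "0 < e" for e :: real
    using order_tendstoD(2)[OF pow0 that] by (auto simp: eventually_sequentially)
  have lim: "(\<lambda>n. d (s n)) \<longlonglongrightarrow> f s" if "s \<in> C0" for s
  proof -
    have "Cauchy (\<lambda>n. d (s n))"
    proof (rule metric_CauchyI)
      fix e :: real assume "0 < e"
      then obtain N where N: "4 * (1/2::real)^N < e" using small by blast
      have "dist (d (s m)) (d (s n)) < e" if "m \<ge> N" "n \<ge> N" for m n
      proof -
        have "dist (d (s m)) (d (s n)) \<le> dist (d (s N)) (d (s m)) + dist (d (s N)) (d (s n))"
          by (rule dist_triangle3)
        also have "\<dots> \<le> 2 * (1/2)^N + 2 * (1/2)^N"
          using close'[OF \<open>s \<in> C0\<close>] that by (intro add_mono) auto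
        finally show ?thesis using N by simp
      qed
      then show "\<exists>M. \<forall>m\<ge>M. \<forall>n\<ge>M. dist (d (s m)) (d (s n)) < e" by blast
    qed
    then show ?thesis unfolding f_def using Cauchy_convergent convergent_LIMSEQ_iff by blast
  qed
  have flim: "dist (d (s n)) (f s) \<le> 2 * (1/2)^n" if "s \<in> C0" for s n
  proof (rule LIMSEQ_le_const2)
    show "(\<lambda>m. dist (d (s n)) (d (s m))) \<longlonglongrightarrow> dist (d (s n)) (f s)"
      by (intro tendsto_intros lim that)
    show "\<exists>N. \<forall>m\<ge>N. dist (d (s n)) (d (s m)) \<le> 2 * (1/2)^n"
      using close'[OF that] by blast
  qed
  have fclose: "dist (f s) (f t) \<le> 4 * (1/2)^n" if "s \<in> C0" "t \<in> C0" "\<forall>i<Suc n. t i = s i" for s t n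
  proof -
    have "dist (f s) (f t) \<le> dist (d (s n)) (f s) + dist (d (s n)) (f t)" by (rule dist_triangle3)
    also have "\<dots> \<le> 2 * (1/2)^n + 2 * (1/2)^n"
      using flim[OF that(1)] flim[OF that(2), of n] that(3) by (intro add_mono) auto
    finally show ?thesis by simp
  qed
  define C where "C = {s\<in>C0. f s \<in> F}"
  have "cyl_closed C"
    unfolding cyl_closed_def
  proof (intro allI impI)
    fix s assume s: "\<forall>k. \<exists>t\<in>C. \<forall>i<k. t i = s i"
    have s0: "s \<in> C0"
      unfolding C0_def
    proof (intro CollectI allI)
      fix n
      obtain t where t: "t \<in> C" "\<forall>i<Suc (Suc n). t i = s i" using s by blast
      from t show "dist (d (s n)) (d (s (Suc n))) \<le> (1/2)^n"
        unfolding C_def C0_def by (metis (mono_tags, lifting) lessI less_SucI mem_Collect_eq)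
    qed
    have "f s \<in> closure F"
    proof (subst closure_approachable, intro allI impI)
      fix e :: real assume "0 < e"
      then obtain n where n: "4 * (1/2::real)^n < e" using small by blast
      obtain t where t: "t \<in> C" "\<forall>i<Suc n. t i = s i" using s by blast
      then have "dist (f s) (f t) \<le> 4 * (1/2)^n" using fclose s0 unfolding C_def by blast
      then have "dist (f t) (f s) < e" using n by (simp add: dist_commute)
      then show "\<exists>y\<in>F. dist y (f s) < e" using t unfolding C_def by blast
    qed
    then show "s \<in> C" using s0 assms unfolding C_def by simp
  qed
  moreover have "cyl_cont C f"
    unfolding cyl_cont_def
  proof (intro ballI allI impI)
    fix s U assume s: "s \<in> C" and U: "open U \<and> f s \<in> U"
    then obtain e where e: "0 < e" "\<And>y. dist y (f s) < e \<Longrightarrow> y \<in> U" by (metis open_dist)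
    obtain n where n: "4 * (1/2::real)^n < e" using small e by blast
    have "f t \<in> U" if "t \<in> C" "\<forall>i<Suc n. t i = s i" for t
      using fclose[of s t n] s that n e by (force simp: C_def dist_commute)
    then show "\<exists>k. \<forall>t\<in>C. (\<forall>i<k. t i = s i) \<longrightarrow> f t \<in> U" by blast
  qed
  moreover have "F = f ` C"
  proof
    show "F \<subseteq> f ` C"
    proof
      fix x assume x: "x \<in> F"
      have "\<exists>m. dist (d m) x < (1/2)^n / 2" for n by (intro d) simp
      then obtain s where s: "\<And>n. dist (d (s n)) x < (1/2)^n / 2" by metis
      have "dist (d (s n)) (d (s (Suc n))) \<le> (1/2)^n" for n
      proof -
        have "dist (d (s n)) (d (s (Suc n))) \<le> dist (d (s n)) x + dist (d (s (Suc n))) x"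
          by (rule dist_triangle2)
        also have "\<dots> \<le> (1/2)^n / 2 + (1/2)^(Suc n) / 2"
          using s[of n] s[of "Suc n"] by linarith
        also have "\<dots> \<le> (1/2)^n" by (simp add: field_simps)
        finally show ?thesis .
      qed
      then have s0: "s \<in> C0" unfolding C0_def by simp
      have "(\<lambda>n. d (s n)) \<longlonglongrightarrow> x"
      proof (rule metric_LIMSEQ_I)
        fix e :: real assume "0 < e"
        then obtain N where N: "4 * (1/2::real)^N < e" using small by blast
        have "dist (d (s n)) x < e" if "N \<le> n" for n
        proof -
          have "(1/2::real)^n \<le> (1/2)^N" using that by (intro power_decreasing) auto
          moreover have "(0::real) < (1/2)^N" by simp
          ultimately show ?thesis using s[of n] N by linarith
        qed
        then show "\<exists>no. \<forall>n\<ge>no. dist (d (s n)) x < e" by blast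
      qed
      then have "f s = x" using lim[OF s0] LIMSEQ_unique by blast
      then show "x \<in> f ` C" using s0 x unfolding C_def by blast
    qed
  qed (auto simp: C_def)
  ultimately show ?thesis unfolding analytic_set_def by blast
qed

lemma analytic_image:
  assumes "analytic_set A" "continuous_on A g"
  shows "analytic_set (g ` A)"
proof -
  obtain C f where C: "cyl_closed C" "cyl_cont C f" "A = f ` C"
    using assms(1) unfolding analytic_set_def by blast
  have "cyl_cont C (g \<circ> f)"
    unfolding cyl_cont_def
  proof (intro ballI allI impI)
    fix s U assume s: "s \<in> C" and U: "open U \<and> (g \<circ> f) s \<in> U"
    obtain W where W: "open W" "W \<inter> A = g -` U \<inter> A"
      using assms(2) U unfolding continuous_on_open_invariant by blast
    have "f s \<in> W" using W U s C(3) by auto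
    then obtain k where "\<forall>t\<in>C. (\<forall>i<k. t i = s i) \<longrightarrow> f t \<in> W"
      using cyl_contD[OF C(2) s W(1)] by blast
    then show "\<exists>k. \<forall>t\<in>C. (\<forall>i<k. t i = s i) \<longrightarrow> (g \<circ> f) t \<in> U"
      using W(2) C(3) by fastforce
  qed
  then show ?thesis
    unfolding analytic_set_def using C by (intro exI[of _ C] exI[of _ "g \<circ> f"]) (simp add: image_comp)
qed

text \<open>The first entry of a code names the set, the remaining entries are a code for a point of
  that set.\<close>

lemma analytic_UN:
  fixes A :: "nat \<Rightarrow> 'a::topological_space set"
  assumes "\<And>n. analytic_set (A n)"
  shows "analytic_set (\<Union>n. A n)"
proof -
  have "\<forall>n. \<exists>C f. cyl_closed C \<and> cyl_cont C f \<and> A n = f ` C"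
    using assms unfolding analytic_set_def by blast
  then obtain C f where C: "\<And>n. cyl_closed (C n)" "\<And>n. cyl_cont (C n) (f n)" "\<And>n. A n = f n ` C n"
    by metis
  define tl where "tl s = (\<lambda>n. s (Suc n) :: nat)" for s
  define D where "D = {s. tl s \<in> C (s 0)}"
  define g where "g s = f (s 0) (tl s)" for s
  have agree: "\<forall>i<k. tl t i = tl s i" if "\<forall>i<Suc k. t i = s i" for t s k
    using that unfolding tl_def by simp
  have "cyl_closed D"
    unfolding cyl_closed_def
  proof (intro allI impI)
    fix s assume s: "\<forall>k. \<exists>t\<in>D. \<forall>i<k. t i = s i"
    have "tl s \<in> C (s 0)"
    proof (rule cyl_closedD[OF C(1)])
      fix k
      obtain t where "t \<in> D" "\<forall>i<Suc k. t i = s i" using s by blast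
      then show "\<exists>t\<in>C (s 0). \<forall>i<k. t i = tl s i"
        using agree[of k t s] unfolding D_def by (intro bexI[of _ "tl t"]) auto
    qed
    then show "s \<in> D" unfolding D_def by simp
  qed
  moreover have "cyl_cont D g"
    unfolding cyl_cont_def
  proof (intro ballI allI impI)
    fix s U assume s: "s \<in> D" and U: "open U \<and> g s \<in> U"
    then obtain k where k: "\<And>t. t \<in> C (s 0) \<Longrightarrow> \<forall>i<k. t i = tl s i \<Longrightarrow> f (s 0) t \<in> U"
      using cyl_contD[of "C (s 0)" "f (s 0)" "tl s" U] C(2) unfolding D_def g_def by blast
    have "g t \<in> U" if "t \<in> D" "\<forall>i<Suc k. t i = s i" for t
    proof -
      have "t 0 = s 0" using that(2) by simp
      then show ?thesis using k[of "tl t"] agree[OF that(2)] that(1) unfolding g_def D_def by simp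
    qed
    then show "\<exists>k. \<forall>t\<in>D. (\<forall>i<k. t i = s i) \<longrightarrow> g t \<in> U" by blast
  qed
  moreover have "(\<Union>n. A n) = g ` D"
  proof
    show "(\<Union>n. A n) \<subseteq> g ` D"
    proof
      fix x assume "x \<in> (\<Union>n. A n)"
      then obtain n t where t: "t \<in> C n" "x = f n t" using C(3) by auto
      have "tl (case_nat n t) = t" unfolding tl_def by auto
      then have "case_nat n t \<in> D" "g (case_nat n t) = x" unfolding D_def g_def using t by auto
      then show "x \<in> g ` D" by blast
    qed
  qed (auto simp: D_def g_def C(3))
  ultimately show ?thesis unfolding analytic_set_def by blast
qed

text \<open>Row i of a sequence read as a two-dimensional array through the pairing function, so
  that one code can carry countably many codes.\<close>

definition fiber :: "nat \<Rightarrow> (nat \<Rightarrow> nat) \<Rightarrow> nat \<Rightarrow> nat" where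
  "fiber i u = (\<lambda>j. u (prod_encode (i, j)))"

lemma fiber_agree: "\<exists>m. \<forall>t s. (\<forall>n<m. t n = s n) \<longrightarrow> (\<forall>j<k. fiber i t j = fiber i s j)"
proof -
  have "finite ((\<lambda>j. prod_encode (i, j)) ` {..<k})" by simp
  then obtain m where "\<forall>n\<in>(\<lambda>j. prod_encode (i, j)) ` {..<k}. n < m"
    using finite_nat_set_iff_bounded by blast
  then show ?thesis unfolding fiber_def by (intro exI[of _ m]) auto
qed

text \<open>Codes are arrays whose row i codes a point of \<open>A i\<close>, all rows coding the
  same point. The Hausdorff property makes this set of arrays closed: if two rows of a limit coded
  different points, disjoint neighbourhoods would already separate the corresponding rows of an
  array close to it.\<close>

lemma analytic_INT:
  fixes A :: "nat \<Rightarrow> 'a::t2_space set"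
  assumes "\<And>n. analytic_set (A n)"
  shows "analytic_set (\<Inter>n. A n)"
proof -
  have "\<forall>n. \<exists>C f. cyl_closed C \<and> cyl_cont C f \<and> A n = f ` C"
    using assms unfolding analytic_set_def by blast
  then obtain C f where C: "\<And>n. cyl_closed (C n)" "\<And>n. cyl_cont (C n) (f n)" "\<And>n. A n = f n ` C n"
    by metis
  define D where "D = {s. \<forall>i. fiber i s \<in> C i \<and> f i (fiber i s) = f 0 (fiber 0 s)}"
  have cont: "\<exists>m. \<forall>t. fiber i t \<in> C i \<longrightarrow> (\<forall>n<m. t n = s n) \<longrightarrow> f i (fiber i t) \<in> U"
    if fib: "fiber i s \<in> C i" "open U" "f i (fiber i s) \<in> U" for i s U
  proof -
    obtain k where k: "\<forall>t\<in>C i. (\<forall>j<k. t j = fiber i s j) \<longrightarrow> f i t \<in> U"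
      using cyl_contD[of "C i" "f i" "fiber i s" U] C(2) fib by blast
    obtain m where m: "\<forall>t s. (\<forall>n<m. t n = s n) \<longrightarrow> (\<forall>j<k. fiber i t j = fiber i s j)"
      using fiber_agree by blast
    show ?thesis
    proof (intro exI[of _ m] allI impI)
      fix t assume "fiber i t \<in> C i" "\<forall>n<m. t n = s n"
      then show "f i (fiber i t) \<in> U" using k m by blast
    qed
  qed
  have "cyl_closed D"
    unfolding cyl_closed_def
  proof (intro allI impI)
    fix s assume s: "\<forall>k. \<exists>t\<in>D. \<forall>i<k. t i = s i"
    have mem: "fiber i s \<in> C i" for i
    proof (rule cyl_closedD[OF C(1)])
      fix k
      obtain m where m: "\<And>t s. (\<forall>n<m. t n = s n) \<Longrightarrow> (\<forall>j<k. fiber i t j = fiber i s j)"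
        using fiber_agree by meson
      obtain t where t: "t \<in> D" "\<forall>n<m. t n = s n" using s by blast
      show "\<exists>t\<in>C i. \<forall>j<k. t j = fiber i s j"
        using m[OF t(2)] t(1) unfolding D_def by blast
    qed
    have "f i (fiber i s) = f 0 (fiber 0 s)" for i
    proof (rule ccontr)
      assume "f i (fiber i s) \<noteq> f 0 (fiber 0 s)"
      then obtain U W where UW: "open U" "open W" "f i (fiber i s) \<in> U" "f 0 (fiber 0 s) \<in> W" "U \<inter> W = {}"
        using hausdorff[of "f i (fiber i s)" "f 0 (fiber 0 s)"] by auto
      obtain m1 where m1: "\<And>t. fiber i t \<in> C i \<Longrightarrow> (\<forall>n<m1. t n = s n) \<Longrightarrow> f i (fiber i t) \<in> U"
        using cont[OF mem[of i] UW(1,3)] by blast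
      obtain m2 where m2: "\<And>t. fiber 0 t \<in> C 0 \<Longrightarrow> (\<forall>n<m2. t n = s n) \<Longrightarrow> f 0 (fiber 0 t) \<in> W"
        using cont[OF mem[of 0] UW(2,4)] by blast
      obtain t where t: "t \<in> D" "\<forall>n<max m1 m2. t n = s n" using s by blast
      have "f i (fiber i t) \<in> U" "f 0 (fiber 0 t) \<in> W" using m1 m2 t unfolding D_def by auto
      moreover have "f i (fiber i t) = f 0 (fiber 0 t)" using t unfolding D_def by blast
      ultimately show False using UW(5) by auto
    qed
    then show "s \<in> D" using mem unfolding D_def by blast
  qed
  moreover have "cyl_cont D (\<lambda>s. f 0 (fiber 0 s))"
    unfolding cyl_cont_def
  proof (intro ballI allI impI)
    fix s U assume "s \<in> D" and "open U \<and> f 0 (fiber 0 s) \<in> U"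
    then show "\<exists>k. \<forall>t\<in>D. (\<forall>i<k. t i = s i) \<longrightarrow> f 0 (fiber 0 t) \<in> U"
      using cont[of 0 s U] unfolding D_def by blast
  qed
  moreover have "(\<Inter>n. A n) = (\<lambda>s. f 0 (fiber 0 s)) ` D"
  proof
    show "(\<Inter>n. A n) \<subseteq> (\<lambda>s. f 0 (fiber 0 s)) ` D"
    proof
      fix x assume "x \<in> (\<Inter>n. A n)"
      then have "\<forall>n. \<exists>t. t \<in> C n \<and> f n t = x" using C(3) by auto
      then obtain t where t: "\<And>n. t n \<in> C n" "\<And>n. f n (t n) = x" by metis
      define s where "s n = (case prod_decode n of (i, j) \<Rightarrow> t i j)" for n
      have "fiber i s = t i" for i unfolding fiber_def s_def by auto
      then have "s \<in> D" "f 0 (fiber 0 s) = x" unfolding D_def using t by auto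
      then show "x \<in> (\<lambda>s. f 0 (fiber 0 s)) ` D" by blast
    qed
    show "(\<lambda>s. f 0 (fiber 0 s)) ` D \<subseteq> (\<Inter>n. A n)"
    proof clarify
      fix s n assume "s \<in> D"
      then have "f n (fiber n s) = f 0 (fiber 0 s)" "fiber n s \<in> C n" unfolding D_def by blast+
      then show "f 0 (fiber 0 s) \<in> A n" using C(3) by (metis imageI)
    qed
  qed
  ultimately show ?thesis unfolding analytic_set_def by blast
qed

lemma open_eq_UN_closed:
  fixes U :: "'a::metric_space set"
  assumes "open U"
  shows "\<exists>F::nat \<Rightarrow> 'a set. (\<forall>n. closed (F n)) \<and> U = (\<Union>n. F n)"
\<comment> \<open>The distance to the empty set is 0 by convention, so the whole space needs its own
  case.\<close>
proof (cases "U = UNIV")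
  case True
  then show ?thesis by (intro exI[of _ "\<lambda>_. UNIV"]) auto
next
  case False
  have ne: "- U \<noteq> {}" and cl: "closed (- U)" using False assms by auto
  define F where "F n = {x. inverse (real (Suc n)) \<le> infdist x (- U)}" for n
  have "closed (F n)" for n
    unfolding F_def by (intro closed_Collect_le continuous_intros)
  moreover have "U = (\<Union>n. F n)"
  proof
    show "U \<subseteq> (\<Union>n. F n)"
    proof
      fix x assume "x \<in> U"
      then have "infdist x (- U) > 0"
        using in_closed_iff_infdist_zero[OF cl ne] infdist_nonneg[of x "- U"] by force
      then obtain n where "inverse (real (Suc n)) < infdist x (- U)" using reals_Archimedean by blast
      then show "x \<in> (\<Union>n. F n)" unfolding F_def by (auto intro: less_imp_le)
    qed
    show "(\<Union>n. F n) \<subseteq> U"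
    proof clarify
      fix x n assume "x \<in> F n"
      then have "infdist x (- U) \<noteq> 0" unfolding F_def
        by (smt (verit) inverse_positive_iff_positive mem_Collect_eq of_nat_0_less_iff zero_less_Suc)
      then show "x \<in> U" using in_closed_iff_infdist_zero[OF cl ne] by blast
    qed
  qed
  ultimately show ?thesis by blast
qed

text \<open>Analytic sets are not closed under complements; the induction therefore carries the set
  and its complement together, which exchanges the roles of countable unions and
  intersections.\<close>

lemma analytic_borel:
  fixes B :: "'a::{complete_space, second_countable_topology} set"
  assumes "B \<in> sets borel"
  shows "analytic_set B"
proof -
  have "B \<in> sigma_sets UNIV {S. open S}" using assms by (simp add: sets_borel)
  then have "analytic_set B \<and> analytic_set (- B)"
  proof (induction rule: sigma_sets.induct)
    case (Basic U)
    then obtain F :: "nat \<Rightarrow> 'a set" where "\<And>n. closed (F n)" "U = (\<Union>n. F n)"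
      using open_eq_UN_closed[of U] by auto
    then have "analytic_set U" using analytic_UN[of F] analytic_closed by auto
    moreover have "analytic_set (- U)" using Basic by (intro analytic_closed) auto
    ultimately show ?case by blast
  next
    case (Union A)
    have "- (\<Union>i. A i) = (\<Inter>i. - A i)" by auto
    then show ?case using Union analytic_UN[of A] analytic_INT[of "\<lambda>i. - A i"] by auto
  qed (auto simp: analytic_closed Compl_eq_Diff_UNIV[symmetric])
  then show ?thesis by blast
qed

section \<open>Separation by Borel sets\<close>

text \<open>Novikov's separation theorem: if the conclusion fails, failure propagates to ever smaller
  cylinders (refined one coordinate of one \<open>A i\<close> at a time) and hence to a sequence of single points,
  two of which are distinct and can be separated by open sets.\<close>

lemma analytic_separation:
  fixes A :: "nat \<Rightarrow> 'a::t2_space set"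
  assumes "\<And>n. analytic_set (A n)" and "(\<Inter>n. A n) = {}"
  shows "\<exists>B. (\<forall>n. B n \<in> sets borel \<and> A n \<subseteq> B n) \<and> (\<Inter>n. B n) = {}"
proof (rule ccontr)
  assume neg: "\<not> ?thesis"
  have "\<forall>n. \<exists>C f. cyl_closed C \<and> cyl_cont C f \<and> A n = f ` C"
    using assms unfolding analytic_set_def by blast
  then obtain C f where C: "\<And>n. cyl_closed (C n)" "\<And>n. cyl_cont (C n) (f n)" "\<And>n. A n = f n ` C n"
    by metis
  \<comment> \<open>One array \<open>u\<close> prescribes codes for all sets at once:
    \<open>P u k i\<close> is the piece of \<open>A i\<close> whose codes follow row i of
    \<open>u\<close> at the array positions below k.\<close>
  define P where "P u k i = f i ` {t\<in>C i. \<forall>j. prod_encode (i, j) < k \<longrightarrow> t j = u (prod_encode (i, j))}" for u k i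
  define sep where "sep u k \<longleftrightarrow> (\<exists>B. (\<forall>n. B n \<in> sets borel \<and> P u k n \<subseteq> B n) \<and> (\<Inter>n. B n) = {})" for u k
  have step: "\<exists>m. \<not> sep (u(k := m)) (Suc k)" if "\<not> sep u k" for u k
  proof (rule ccontr)
    assume "\<not> ?thesis"
    then have "\<forall>m. \<exists>B. (\<forall>n. B n \<in> sets borel \<and> P (u(k := m)) (Suc k) n \<subseteq> B n) \<and> (\<Inter>n. B n) = {}"
      unfolding sep_def by blast
    then obtain B where B: "\<And>m n. B m n \<in> sets borel" "\<And>m n. P (u(k := m)) (Suc k) n \<subseteq> B m n"
      "\<And>m. (\<Inter>n. B m n) = {}" by metis
    obtain i0 j0 where k: "prod_encode (i0, j0) = k" by (metis prod_decode_inverse surj_pair)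
    \<comment> \<open>Position k lies in row \<open>i0\<close> only. Its possible values cut the
      piece of \<open>A i0\<close> into countably many, hence the union there; the pieces in the
      other rows do not depend on the value, hence the intersection.\<close>
    define D where "D n = (if n = i0 then \<Union>m. B m n else \<Inter>m. B m n)" for n
    have "D n \<in> sets borel" for n unfolding D_def using B(1) by auto
    moreover have "P u k n \<subseteq> D n" for n
    proof
      fix y assume "y \<in> P u k n"
      then obtain t where t: "t \<in> C n" "\<And>j. prod_encode (n, j) < k \<Longrightarrow> t j = u (prod_encode (n, j))" "y = f n t"
        unfolding P_def by blast
      show "y \<in> D n"
      proof (cases "n = i0")
        case True
        have "y \<in> P (u(k := t j0)) (Suc k) n"
          unfolding P_def t(3)
        proof (intro imageI CollectI conjI allI impI t(1))
          fix j assume "prod_encode (n, j) < Suc k"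
          then consider "prod_encode (n, j) < k" | "prod_encode (n, j) = k" by linarith
          then show "t j = (u(k := t j0)) (prod_encode (n, j))"
          proof cases
            case 2
            then have "j = j0" using k by (metis Pair_inject prod_encode_inverse)
            then show ?thesis using 2 by simp
          qed (use t(2) in auto)
        qed
        then show ?thesis unfolding D_def using B(2) True by auto
      next
        case False
        have "y \<in> P (u(k := m)) (Suc k) n" for m
          unfolding P_def t(3)
        proof (intro imageI CollectI conjI allI impI t(1))
          fix j assume "prod_encode (n, j) < Suc k"
          moreover have "prod_encode (n, j) \<noteq> k" using k False by (metis Pair_inject prod_encode_inverse)
          ultimately show "t j = (u(k := m)) (prod_encode (n, j))" using t(2) by auto
        qed
        then show ?thesis unfolding D_def using B(2) False by auto
      qed
    qed
    moreover have "(\<Inter>n. D n) = {}"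
    proof (rule ccontr)
      assume "(\<Inter>n. D n) \<noteq> {}"
      then obtain y where y: "\<And>n. y \<in> D n" by blast
      then obtain m where "y \<in> B m i0" unfolding D_def by (metis (full_types) UN_E)
      then have "y \<in> B m n" for n using y[of n] unfolding D_def by (cases "n = i0") auto
      then show False using B(3)[of m] by blast
    qed
    ultimately show False using that unfolding sep_def by blast
  qed
  have "P u 0 n = A n" for u n unfolding P_def C(3) by simp
  then have base: "\<not> sep u 0" for u using neg unfolding sep_def by simp
  have "\<exists>v. \<forall>k. \<not> sep (v k) k \<and> (\<exists>m. v (Suc k) = (v k)(k := m))"
  proof (rule dependent_nat_choice)
    show "\<exists>v. \<not> sep v 0" using base by blast
    show "\<exists>w. \<not> sep w (Suc k) \<and> (\<exists>m. w = v(k := m))" if "\<not> sep v k" for v k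
      using step[OF that] by blast
  qed
  then obtain v where v: "\<And>k. \<not> sep (v k) k" "\<And>k. \<exists>m. v (Suc k) = (v k)(k := m)" by metis
  \<comment> \<open>Position n is written in the passage from \<open>v n\<close> to
    \<open>v (Suc n)\<close> and never again, so this is its final value.\<close>
  define u where "u n = v (Suc n) n" for n
  have vu: "v k n = u n" if "n < k" for k n
    using that
  proof (induction k)
    case (Suc k)
    obtain m where "v (Suc k) = (v k)(k := m)" using v(2) by blast
    then show ?case using Suc by (cases "n = k") (auto simp: u_def)
  qed simp
  have nsep: "\<not> sep u k" for k
  proof -
    have "P u k = P (v k) k" unfolding P_def using vu by (intro ext arg_cong2[where f=image] refl Collect_cong) auto
    then show ?thesis using v(1) unfolding sep_def by simp
  qed
  have Pfiber: "\<exists>m. \<forall>t. (\<forall>j. prod_encode (i, j) < m \<longrightarrow> t j = u (prod_encode (i, j))) \<longrightarrow> (\<forall>j<k. t j = fiber i u j)" for i k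
  proof -
    have "finite ((\<lambda>j. prod_encode (i, j)) ` {..<k})" by simp
    then obtain m where "\<forall>n\<in>(\<lambda>j. prod_encode (i, j)) ` {..<k}. n < m"
      using finite_nat_set_iff_bounded by blast
    then show ?thesis unfolding fiber_def by (intro exI[of _ m]) auto
  qed
  have nonempty: "P u k i \<noteq> {}" for k i
  proof
    assume "P u k i = {}"
    then have "sep u k" unfolding sep_def
      by (intro exI[of _ "\<lambda>n. if n = i then {} else UNIV"]) (auto split: if_splits)
    then show False using nsep by blast
  qed
  have mem: "fiber i u \<in> C i" for i
  proof (rule cyl_closedD[OF C(1)])
    fix k
    obtain m where m: "\<forall>t. (\<forall>j. prod_encode (i, j) < m \<longrightarrow> t j = u (prod_encode (i, j))) \<longrightarrow> (\<forall>j<k. t j = fiber i u j)"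
      using Pfiber by blast
    show "\<exists>t\<in>C i. \<forall>j<k. t j = fiber i u j" using nonempty[of m i] m unfolding P_def by blast
  qed
  have near: "\<exists>m. \<forall>k\<ge>m. P u k i \<subseteq> U" if U: "open U" "f i (fiber i u) \<in> U" for U i
  proof -
    obtain k where k: "\<And>t. t \<in> C i \<Longrightarrow> (\<forall>j<k. t j = fiber i u j) \<Longrightarrow> f i t \<in> U"
      using cyl_contD[of "C i" "f i" "fiber i u" U] C(2) mem U by blast
    obtain m where m: "\<And>t. (\<forall>j. prod_encode (i, j) < m \<longrightarrow> t j = u (prod_encode (i, j))) \<Longrightarrow> (\<forall>j<k. t j = fiber i u j)"
      using Pfiber by blast
    show ?thesis
    proof (intro exI[of _ m] allI impI subsetI)
      fix k' y assume "m \<le> k'" "y \<in> P u k' i"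
      then obtain t where t: "t \<in> C i" "\<And>j. prod_encode (i, j) < k' \<Longrightarrow> t j = u (prod_encode (i, j))" "y = f i t"
        unfolding P_def by blast
      show "y \<in> U" unfolding t(3) using t(2) \<open>m \<le> k'\<close> by (intro k[OF t(1)] m) auto
    qed
  qed
  have "\<exists>i. f i (fiber i u) \<noteq> f 0 (fiber 0 u)"
  proof (rule ccontr)
    assume "\<not> ?thesis"
    then have "f 0 (fiber 0 u) \<in> A n" for n using C(3) mem by (metis imageI)
    then show False using assms(2) by blast
  qed
  then obtain i where i: "f i (fiber i u) \<noteq> f 0 (fiber 0 u)" by blast
  then obtain U W where UW: "open U" "open W" "f i (fiber i u) \<in> U" "f 0 (fiber 0 u) \<in> W" "U \<inter> W = {}"
    using hausdorff[OF i] by auto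
  obtain m1 where m1: "\<forall>k\<ge>m1. P u k i \<subseteq> U" using near[OF UW(1,3)] by blast
  obtain m2 where m2: "\<forall>k\<ge>m2. P u k 0 \<subseteq> W" using near[OF UW(2,4)] by blast
  have "i \<noteq> 0" using i by metis
  have "sep u (max m1 m2)"
    unfolding sep_def
  proof (intro exI[of _ "\<lambda>n. if n = i then U else if n = 0 then W else UNIV"] conjI allI)
    show "(\<Inter>n. if n = i then U else if n = 0 then W else UNIV) = {}"
    proof (rule ccontr)
      assume "(\<Inter>n. if n = i then U else if n = 0 then W else UNIV) \<noteq> {}"
      then obtain y where "\<And>n. y \<in> (if n = i then U else if n = 0 then W else UNIV)" by blast
      from this[of i] this[of 0] show False using UW(5) \<open>i \<noteq> 0\<close> by auto
    qed
  qed (use UW m1 m2 in auto)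
  then show False using nsep by blast
qed

text \<open>Lusin's theorem as a case of Novikov's: the sequence A, B, B, ... has empty
  intersection, and the Borel set obtained for A misses B because B lies in all the others.\<close>

lemma analytic_separation_two:
  fixes A B :: "'a::t2_space set"
  assumes "analytic_set A" "analytic_set B" "A \<inter> B = {}"
  shows "\<exists>D\<in>sets borel. A \<subseteq> D \<and> D \<inter> B = {}"
proof -
  define E where "E n = (if n = 0 then A else B)" for n :: nat
  have "(\<Inter>n. E n) = {}"
  proof (rule ccontr)
    assume "(\<Inter>n. E n) \<noteq> {}"
    then obtain y where "\<And>n. y \<in> E n" by blast
    from this[of 0] this[of 1] show False using assms(3) unfolding E_def by auto
  qed
  moreover have "analytic_set (E n)" for n using assms unfolding E_def by simp
  ultimately obtain F where F: "\<And>n. F n \<in> sets borel" "\<And>n. E n \<subseteq> F n" "(\<Inter>n. F n) = {}"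
    using analytic_separation[of E] by metis
  have "F 0 \<inter> B = {}"
  proof (rule ccontr)
    assume "F 0 \<inter> B \<noteq> {}"
    then obtain y where y: "y \<in> F 0" "y \<in> B" by blast
    then have "y \<in> F n" for n using F(2)[of n] by (cases "n = 0") (auto simp: E_def)
    then show False using F(3) by blast
  qed
  then show ?thesis using F(1,2)[of 0] unfolding E_def by auto
qed


text \<open>Call n a witness for (x, a) if \<open>V n\<close> contains a and misses the section over
  x; since sections are closed, each point off B has a witness. The x whose section misses
  \<open>V n\<close> form the complement of the analytic set \<open>P n\<close>, which need not be
  Borel. Novikov's theorem for the sets \<open>E n\<close> of points off B without witness n,
  followed by a separation from \<open>P n\<close>, produces Borel sets \<open>D n\<close> in their
  place.\<close>

lemma borel_open_sections:
  fixes B :: "('s::{complete_space, second_countable_topology} \<times> 'b::{complete_space, second_countable_topology}) set"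
  assumes B: "B \<in> sets borel" and closed: "\<And>x. closed {a. (x, a) \<in> B}"
  shows "\<exists>(V :: nat \<Rightarrow> 'b set) D. (\<forall>n. open (V n) \<and> D n \<in> sets borel) \<and> - B = (\<Union>n. D n \<times> V n)"
proof -
  obtain \<B> :: "'b set set" where basis: "countable \<B>" "topological_basis \<B>"
    using ex_countable_basis by blast
  have ne: "\<B> \<noteq> {}"
    using topological_basisE[OF basis(2) open_UNIV UNIV_I] by blast
  define V where "V = from_nat_into \<B>"
  have Vopen: "open (V n)" for n
    unfolding V_def using topological_basis_open[OF basis(2)] from_nat_into[OF ne] by blast
  have V: "\<exists>n. a \<in> V n \<and> V n \<inter> {a. (x, a) \<in> B} = {}" if "(x, a) \<notin> B" for x a
  proof -
    have op: "open (- {a. (x, a) \<in> B})" using closed[of x] by (rule open_Compl)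
    have mem: "a \<in> - {a. (x, a) \<in> B}" using that by simp
    obtain B' where "B' \<in> \<B>" "a \<in> B'" "B' \<subseteq> - {a. (x, a) \<in> B}"
      by (rule topological_basisE[OF basis(2) op mem])
    then show ?thesis unfolding V_def using from_nat_into_surj[OF basis(1)] by blast
  qed
  define P where "P n = fst ` (B \<inter> UNIV \<times> V n)" for n
  have VB: "UNIV \<times> V n \<in> sets (borel :: ('s \<times> 'b) measure)" for n
    using Vopen by (intro borel_open open_Times) auto
  have Pan: "analytic_set (P n)" for n
    unfolding P_def by (intro analytic_image analytic_borel continuous_intros sets.Int B VB)
  define E where "E n = - B \<inter> (- (UNIV \<times> V n) \<union> fst -` P n)" for n
  have "analytic_set (E n)" for n
  proof -
    \<comment> \<open>The preimage of \<open>P n\<close> under the first projection is exhibited as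
      the image of a Borel set of triples, the extra component b being the point of
      \<open>V n\<close> in the section over x.\<close>
    define T1 where "T1 = (\<lambda>(x, a, b). (x, a)) -` (- B) \<inter> (\<lambda>(x, a, b). (x, b)) -` (B \<inter> UNIV \<times> V n)"
    have m: "(\<lambda>(x::'s, a::'b, b::'b). (x, a)) \<in> borel_measurable borel"
      "(\<lambda>(x::'s, a::'b, b::'b). (x, b)) \<in> borel_measurable borel"
      unfolding split_beta by (intro borel_measurable_continuous_onI continuous_intros)+
    have "T1 \<in> sets borel"
      unfolding T1_def
      using measurable_sets_borel[OF m(1), of "- B"] measurable_sets_borel[OF m(2), of "B \<inter> UNIV \<times> V n"] B VB
      by auto
    then have "analytic_set ((\<lambda>(x, a, b). (x, a)) ` T1)"
      by (intro analytic_image analytic_borel) (auto simp: split_beta intro!: continuous_intros)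
    moreover have "(\<lambda>(x, a, b). (x, a)) ` T1 = - B \<inter> fst -` P n"
    proof (intro equalityI subsetI)
      fix p assume "p \<in> - B \<inter> fst -` P n"
      then obtain x a b where "p = (x, a)" "(x, a) \<notin> B" "(x, b) \<in> B" "b \<in> V n"
        unfolding P_def by (cases p) auto
      then show "p \<in> (\<lambda>(x, a, b). (x, a)) ` T1" unfolding T1_def by (intro image_eqI[of _ _ "(x, a, b)"]) auto
    qed (auto simp: T1_def P_def image_iff Bex_def)
    moreover have "analytic_set (- B \<inter> - (UNIV \<times> V n))"
      by (intro analytic_borel sets.Int borel_comp B VB)
    ultimately have "analytic_set (\<Union>k::nat. if k = 0 then - B \<inter> fst -` P n else - B \<inter> - (UNIV \<times> V n))"
      by (intro analytic_UN) auto
    moreover have "(\<Union>k::nat. if k = 0 then - B \<inter> fst -` P n else - B \<inter> - (UNIV \<times> V n)) = E n"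
      unfolding E_def by (auto split: if_splits)
    ultimately show ?thesis by simp
  qed
  moreover have "(\<Inter>n. E n) = {}"
  proof (rule ccontr)
    assume "(\<Inter>n. E n) \<noteq> {}"
    then obtain x a where xa: "\<And>n. (x, a) \<in> E n" by force
    then have "(x, a) \<notin> B" unfolding E_def by blast
    then obtain n where "a \<in> V n" "V n \<inter> {a. (x, a) \<in> B} = {}" using V by blast
    then show False using xa[of n] unfolding E_def P_def by auto
  qed
  ultimately obtain F where F: "\<And>n. F n \<in> sets borel" "\<And>n. E n \<subseteq> F n" "(\<Inter>n. F n) = {}"
    using analytic_separation[of E] by metis
  \<comment> \<open>Off B and off \<open>F n\<close> every point has witness n, so its first
    component is not in \<open>P n\<close>.\<close>
  have "\<exists>D\<in>sets borel. fst ` (- B \<inter> - F n) \<subseteq> D \<and> D \<inter> P n = {}" for n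
  proof (rule analytic_separation_two)
    show "analytic_set (fst ` (- B \<inter> - F n))"
      using B F(1)[of n] by (intro analytic_image analytic_borel continuous_intros) auto
    show "fst ` (- B \<inter> - F n) \<inter> P n = {}" using F(2)[of n] unfolding E_def by auto
  qed (rule Pan)
  then obtain D where D: "\<And>n. D n \<in> sets borel" "\<And>n. fst ` (- B \<inter> - F n) \<subseteq> D n" "\<And>n. D n \<inter> P n = {}"
    by metis
  have "- B = (\<Union>n. D n \<times> V n)"
  proof (intro equalityI subsetI)
    fix p assume p: "p \<in> - B"
    then obtain n where n: "p \<notin> F n" using F(3) by blast
    then have "p \<in> UNIV \<times> V n" using F(2)[of n] p unfolding E_def by blast
    moreover have "fst p \<in> D n" using D(2)[of n] p n by blast
    ultimately show "p \<in> (\<Union>n. D n \<times> V n)" by (auto simp: mem_Times_iff)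
  next
    fix p assume "p \<in> (\<Union>n. D n \<times> V n)"
    then obtain n where "fst p \<in> D n" "snd p \<in> V n" by auto
    then show "p \<in> - B" using D(3)[of n] unfolding P_def by (cases p) force
  qed
  then show ?thesis using Vopen D(1) by blast
qed

text \<open>Compactness turns emptiness of a section into a finite covering condition.\<close>

lemma borel_projection_compact_sections:
  fixes B :: "('s::{complete_space, second_countable_topology} \<times> 'b::{complete_space, second_countable_topology}) set"
  assumes B: "B \<in> sets borel" and sec: "\<And>x. compact {a. (x, a) \<in> B}"
    and K: "compact K" "B \<subseteq> UNIV \<times> K"
  shows "fst ` B \<in> sets borel"
proof -
  obtain V :: "nat \<Rightarrow> 'b set" and D where V: "\<And>n. open (V n)" "\<And>n. D n \<in> sets borel" "- B = (\<Union>n. D n \<times> V n)"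
    using borel_open_sections[OF B compact_imp_closed[OF sec]] by blast
  define \<F> where "\<F> = {F :: nat set. finite F \<and> K \<subseteq> (\<Union>n\<in>F. V n)}"
  have "- fst ` B = (\<Union>F\<in>\<F>. \<Inter>n\<in>F. D n)"
  proof (intro equalityI subsetI)
    fix x assume x: "x \<in> - fst ` B"
    have "K \<subseteq> \<Union> (V ` {n. x \<in> D n})"
    proof
      fix a assume "a \<in> K"
      have "(x, a) \<notin> B" using x by force
      then have "(x, a) \<in> (\<Union>n. D n \<times> V n)" using V(3) by blast
      then show "a \<in> \<Union> (V ` {n. x \<in> D n})" by blast
    qed
    then obtain F where F: "F \<subseteq> {n. x \<in> D n}" "finite F" "K \<subseteq> \<Union> (V ` F)"
      using compactE_image[OF K(1), of "{n. x \<in> D n}" V] V(1) by blast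
    then show "x \<in> (\<Union>F\<in>\<F>. \<Inter>n\<in>F. D n)" unfolding \<F>_def by blast
  next
    fix x assume "x \<in> (\<Union>F\<in>\<F>. \<Inter>n\<in>F. D n)"
    then obtain F where F: "K \<subseteq> (\<Union>n\<in>F. V n)" "\<And>n. n \<in> F \<Longrightarrow> x \<in> D n" unfolding \<F>_def by blast
    have "(x, a) \<notin> B" for a
    proof
      assume "(x, a) \<in> B"
      then have "a \<in> K" using K(2) by blast
      then obtain n where "n \<in> F" "a \<in> V n" using F(1) by blast
      then have "(x, a) \<in> - B" using F(2) V(3) by blast
      then show False using \<open>(x, a) \<in> B\<close> by blast
    qed
    then show "x \<in> - fst ` B" by auto
  qed
  moreover have "(\<Union>F\<in>\<F>. \<Inter>n\<in>F. D n) \<in> sets borel"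
  proof (rule sets.countable_UN'')
    have "\<F> \<subseteq> Collect finite" unfolding \<F>_def by blast
    then show "countable \<F>" using countable_Collect_finite countable_subset by blast
    fix F assume "F \<in> \<F>"
    then have fin: "finite F" unfolding \<F>_def by blast
    have "(\<Inter>n\<in>F. D n) = UNIV" if "F = {}" using that by simp
    then show "(\<Inter>n\<in>F. D n) \<in> sets borel"
      using fin V(2) by (cases "F = {}") (auto intro!: sets.finite_INT)
  qed
  ultimately have "- fst ` B \<in> sets borel" by simp
  then have "- (- fst ` B) \<in> sets borel" by (rule borel_comp)
  then show ?thesis by simp
qed

lemma compact_decreasing_nonempty:
  fixes F :: "nat \<Rightarrow> 'a::t2_space set"
  assumes "\<And>n. compact (F n)" "\<And>n. F n \<noteq> {}" "\<And>m n. m \<le> n \<Longrightarrow> F n \<subseteq> F m"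
  shows "(\<Inter>n. F n) \<noteq> {}"
proof -
  have "F 0 \<inter> (\<Inter>n. F n) \<noteq> {}"
  proof (rule compact_imp_fip_image)
    fix I :: "nat set" assume "finite I"
    then obtain m where "\<forall>n\<in>I. n \<le> m" using finite_nat_set_iff_bounded_le by blast
    then have "F m \<subseteq> F 0 \<inter> (\<Inter>n\<in>I. F n)" using assms(3) by blast
    then show "F 0 \<inter> (\<Inter>n\<in>I. F n) \<noteq> {}" using assms(2) by blast
  qed (simp_all add: assms(1) compact_imp_closed)
  then show ?thesis by blast
qed

section \<open>Selection from compact sections\<close>

definition argmin_sections :: "('s \<times> 'b) set \<Rightarrow> ('b \<Rightarrow> real) \<Rightarrow> ('s \<times> 'b) set" where
  "argmin_sections B \<phi> = {(x, a) \<in> B. \<forall>b. (x, b) \<in> B \<longrightarrow> \<phi> a \<le> \<phi> b}"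

text \<open>A point (x, a) of B fails to minimise iff some rational r satisfies
  \<open>\<phi>\<close> b < r < \<open>\<phi>\<close> a for another point b of the section over x.
  Each rational contributes a rectangle over \<open>P r\<close>, which is Borel by the projection
  theorem. Minima over compact sections are attained, so the projection does not shrink.\<close>

lemma argmin_sections:
  fixes B :: "('s::{complete_space, second_countable_topology} \<times> 'b::{complete_space, second_countable_topology}) set"
  assumes B: "B \<in> sets borel" and sec: "\<And>x. compact {a. (x, a) \<in> B}"
    and K: "compact K" "B \<subseteq> UNIV \<times> K" and \<phi>: "continuous_on UNIV \<phi>"
  shows "argmin_sections B \<phi> \<in> sets borel"
    and "compact {a. (x, a) \<in> argmin_sections B \<phi>}"
    and "fst ` argmin_sections B \<phi> = fst ` B"
proof -
  define P where "P r = fst ` (B \<inter> UNIV \<times> {b. \<phi> b \<le> r})" for r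
  have cl: "closed {b. \<phi> b \<le> r}" for r by (intro closed_Collect_le \<phi> continuous_intros)
  have P: "P r \<in> sets borel" for r
    unfolding P_def
  proof (rule borel_projection_compact_sections[OF _ _ K(1)])
    show "B \<inter> UNIV \<times> {b. \<phi> b \<le> r} \<in> sets borel"
      by (intro sets.Int B borel_closed closed_Times cl closed_UNIV)
    fix x
    have "{a. (x, a) \<in> B \<inter> UNIV \<times> {b. \<phi> b \<le> r}} = {a. (x, a) \<in> B} \<inter> {b. \<phi> b \<le> r}" by auto
    then show "compact {a. (x, a) \<in> B \<inter> UNIV \<times> {b. \<phi> b \<le> r}}" using sec[of x] cl by (simp add: compact_Int_closed)
  qed (use K in blast)
  have "argmin_sections B \<phi> = B - (\<Union>r\<in>\<rat>. P r \<times> {b. r < \<phi> b})"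
  proof (intro equalityI subsetI)
    fix p assume "p \<in> argmin_sections B \<phi>"
    then show "p \<in> B - (\<Union>r\<in>\<rat>. P r \<times> {b. r < \<phi> b})"
      unfolding argmin_sections_def P_def by fastforce
  next
    fix p assume p: "p \<in> B - (\<Union>r\<in>\<rat>. P r \<times> {b. r < \<phi> b})"
    obtain x a where xa: "p = (x, a)" by fastforce
    have "\<phi> a \<le> \<phi> b" if "(x, b) \<in> B" for b
    proof (rule ccontr)
      assume "\<not> \<phi> a \<le> \<phi> b"
      then obtain r where r: "r \<in> \<rat>" "\<phi> b < r" "r < \<phi> a"
        using Rats_dense_in_real[of "\<phi> b" "\<phi> a"] by auto
      then have "x \<in> P r" unfolding P_def using that by force
      then show False using p r xa by auto
    qed
    then show "p \<in> argmin_sections B \<phi>" using p xa unfolding argmin_sections_def by auto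
  qed
  moreover have "P r \<times> {b. r < \<phi> b} \<in> sets (borel :: ('s \<times> 'b) measure)" for r
  proof -
    have "{b. r < \<phi> b} \<in> sets borel" by (intro borel_open open_Collect_less \<phi> continuous_intros)
    then show ?thesis using P unfolding borel_prod[symmetric] by auto
  qed
  ultimately show "argmin_sections B \<phi> \<in> sets borel"
    using B by (auto intro!: sets.countable_UN'' countable_rat)
  have "{a. (x, a) \<in> argmin_sections B \<phi>} = {a. (x, a) \<in> B} \<inter> (\<Inter>b\<in>{b. (x, b) \<in> B}. {a. \<phi> a \<le> \<phi> b})"
    unfolding argmin_sections_def by auto
  then show "compact {a. (x, a) \<in> argmin_sections B \<phi>}"
    using sec[of x] cl by (auto intro!: compact_Int_closed closed_INT)
  show "fst ` argmin_sections B \<phi> = fst ` B"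
  proof (intro equalityI subsetI)
    fix x assume "x \<in> fst ` B"
    then have "{a. (x, a) \<in> B} \<noteq> {}" by auto
    then obtain a where "a \<in> {a. (x, a) \<in> B}" "\<forall>b\<in>{a. (x, a) \<in> B}. \<phi> a \<le> \<phi> b"
      using continuous_attains_inf[OF sec[of x]] \<phi> continuous_on_subset by blast
    then show "x \<in> fst ` argmin_sections B \<phi>" unfolding argmin_sections_def by force
  qed (auto simp: argmin_sections_def)
qed

text \<open>The selector minimises the distances to the points of a dense sequence one after the other,
  which leaves exactly one point in each section.\<close>

lemma measurable_selection_compact_sections:
  fixes B :: "('s::{complete_space, second_countable_topology} \<times> 'b::{complete_space, second_countable_topology}) set"
  assumes B: "B \<in> sets borel" and sec: "\<And>x. compact {a. (x, a) \<in> B}"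
    and K: "compact K" "B \<subseteq> UNIV \<times> K"
  shows "\<exists>f\<in>borel_measurable (restrict_space borel (fst ` B)). \<forall>x\<in>fst ` B. (x, f x) \<in> B"
proof -
  obtain d :: "nat \<Rightarrow> 'b" where d: "\<And>x e. 0 < e \<Longrightarrow> \<exists>n. dist (d n) x < e"
    by (rule dense_sequence_exists) blast
  define E where "E = rec_nat B (\<lambda>n E. argmin_sections E (\<lambda>a. dist (d n) a))"
  have E0: "E 0 = B" and ES: "E (Suc n) = argmin_sections (E n) (\<lambda>a. dist (d n) a)" for n
    unfolding E_def by simp_all
  have E: "E n \<in> sets borel \<and> (\<forall>x. compact {a. (x, a) \<in> E n}) \<and> E n \<subseteq> UNIV \<times> K \<and> fst ` E n = fst ` B" for n
  proof (induction n)
    case (Suc n)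
    have cont: "continuous_on UNIV (\<lambda>a. dist (d n) a)" by (intro continuous_intros)
    have IH: "E n \<in> sets borel" "\<And>x. compact {a. (x, a) \<in> E n}" "E n \<subseteq> UNIV \<times> K" "fst ` E n = fst ` B"
      using Suc by auto
    have "E (Suc n) \<subseteq> E n" unfolding ES argmin_sections_def by blast
    then show ?case
      using argmin_sections[OF IH(1,2) K(1) IH(3) cont] IH(3,4) unfolding ES by simp
  qed (use assms E0 in auto)
  have dec: "E m \<subseteq> E n" if "n \<le> m" for m n
    using that by (induction m rule: dec_induct) (auto simp: ES argmin_sections_def)
  define G where "G = (\<Inter>n. E n)"
  have GB: "G \<in> sets borel" unfolding G_def using E by auto
  have Gsec: "compact {a. (x, a) \<in> G}" for x
  proof -
    have "{a. (x, a) \<in> G} = {a. (x, a) \<in> E 0} \<inter> (\<Inter>n. {a. (x, a) \<in> E n})" unfolding G_def by auto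
    moreover have "closed (\<Inter>n. {a. (x, a) \<in> E n})" using E compact_imp_closed by blast
    ultimately show ?thesis using E[of 0] by (simp add: compact_Int_closed)
  qed
  \<comment> \<open>A point \<open>d n\<close> within half the distance of a is strictly closer to a
    than to b, so b cannot survive the minimisation of the distance to \<open>d n\<close>.\<close>
  have uniq: "a = b" if "(x, a) \<in> G" "(x, b) \<in> G" for x a b
  proof (rule ccontr)
    assume "a \<noteq> b"
    then obtain n where n: "dist (d n) a < dist a b / 2" using d[of "dist a b / 2" a] by auto
    have "(x, a) \<in> E (Suc n)" "(x, b) \<in> E (Suc n)" using that unfolding G_def by blast+
    then have "dist (d n) b \<le> dist (d n) a" unfolding ES argmin_sections_def by blast
    then show False using n dist_triangle3[of a b "d n"] by linarith
  qed
  have ex: "\<exists>a. (x, a) \<in> G" if "x \<in> fst ` B" for x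
  proof -
    have "(\<Inter>n. {a. (x, a) \<in> E n}) \<noteq> {}"
    proof (rule compact_decreasing_nonempty)
      show "{a. (x, a) \<in> E n} \<noteq> {}" for n
      proof -
        have "x \<in> fst ` E n" using E[of n] \<open>x \<in> fst ` B\<close> by simp
        then show ?thesis by auto
      qed
      show "{a. (x, a) \<in> E n} \<subseteq> {a. (x, a) \<in> E m}" if "m \<le> n" for m n using dec[OF that] by blast
    qed (use E in blast)
    then show ?thesis unfolding G_def by blast
  qed
  define f where "f x = (SOME a. (x, a) \<in> G)" for x
  have f: "(x, f x) \<in> G" if "x \<in> fst ` B" for x
    unfolding f_def using ex[OF that] by (rule someI_ex)
  have "f \<in> borel_measurable (restrict_space borel (fst ` B))"
  proof (rule borel_measurableI)
    fix U :: "'b set" assume "open U"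
    then have cl: "closed (- U)" by blast
    have D: "fst ` B \<in> sets borel"
      by (rule borel_projection_compact_sections[OF B sec K])
    \<comment> \<open>Sections of G over the projection of B are singletons, so the points with f x
      outside U are exactly the projection of the part of G off U, again a Borel set with compact
      sections.\<close>
    have "fst ` (G \<inter> UNIV \<times> (- U)) \<in> sets borel"
    proof (rule borel_projection_compact_sections[OF _ _ K(1)])
      show "G \<inter> UNIV \<times> (- U) \<in> sets borel"
        by (intro sets.Int GB borel_closed closed_Times cl closed_UNIV)
      show "G \<inter> UNIV \<times> (- U) \<subseteq> UNIV \<times> K" using E[of 0] unfolding G_def by blast
      fix x
      have "{a. (x, a) \<in> G \<inter> UNIV \<times> (- U)} = {a. (x, a) \<in> G} \<inter> (- U)" by auto
      then show "compact {a. (x, a) \<in> G \<inter> UNIV \<times> (- U)}" using Gsec cl by (simp add: compact_Int_closed)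
    qed
    moreover have "f -` U \<inter> fst ` B = fst ` B - fst ` (G \<inter> UNIV \<times> (- U))"
    proof (intro equalityI subsetI)
      fix x assume "x \<in> f -` U \<inter> fst ` B"
      then have x: "f x \<in> U" "x \<in> fst ` B" by auto
      have "(x, a) \<notin> G \<inter> UNIV \<times> (- U)" for a using uniq[of x a "f x"] f[OF x(2)] x(1) by auto
      then show "x \<in> fst ` B - fst ` (G \<inter> UNIV \<times> (- U))" using x(2) by (auto simp: image_iff)
    next
      fix x assume x: "x \<in> fst ` B - fst ` (G \<inter> UNIV \<times> (- U))"
      then have "f x \<in> U" using f[of x] by force
      then show "x \<in> f -` U \<inter> fst ` B" using x by blast
    qed
    ultimately show "f -` U \<inter> space (restrict_space borel (fst ` B)) \<in> sets (restrict_space borel (fst ` B))"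
      using D by (simp add: space_restrict_space sets_restrict_space_iff sets.Diff)
  qed
  then show ?thesis using f G_def E0 by (intro bexI[of _ f]) blast+
qed

section \<open>Sojourn times with measurable rates\<close>

lemma integrable_interval_bounded:
  fixes f :: "real \<Rightarrow> real"
  assumes [measurable]: "f \<in> borel_measurable borel" and "\<And>s. a < s \<Longrightarrow> s \<le> b \<Longrightarrow> \<bar>f s\<bar> \<le> M"
  shows "integrable lborel (\<lambda>s. indicator {a<..b} s * f s)"
proof (rule integrableI_bounded_set[where A="{a<..b}" and B="max 0 M"])
  show "emeasure lborel {a<..b} < \<infinity>" by (cases "a \<le> b") auto
  show "AE x in lborel. x \<in> {a<..b} \<longrightarrow> norm (indicator {a<..b} x * f x) \<le> max 0 M"
    using assms(2) by (intro AE_I2) (force simp: indicator_def abs_mult)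
qed (auto simp: indicator_def)

lemma integral_interval_bound:
  fixes f :: "real \<Rightarrow> real"
  assumes [measurable]: "f \<in> borel_measurable borel" and "\<And>s. a < s \<Longrightarrow> s \<le> b \<Longrightarrow> \<bar>f s\<bar> \<le> M"
    and "a \<le> b" "0 \<le> M"
  shows "\<bar>\<integral>s. indicator {a<..b} s * f s \<partial>lborel\<bar> \<le> M * (b - a)"
proof -
  have int: "integrable lborel (\<lambda>s. indicator {a<..b} s * f s)"
    by (rule integrable_interval_bounded) (use assms in auto)
  have "\<bar>\<integral>s. indicator {a<..b} s * f s \<partial>lborel\<bar> \<le> (\<integral>s. \<bar>indicator {a<..b} s * f s\<bar> \<partial>lborel)"
    by (rule integral_abs_bound)
  also have "\<dots> \<le> (\<integral>s. indicator {a<..b} s * M \<partial>lborel)"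
  proof (rule integral_mono)
    show "integrable lborel (\<lambda>s. indicator {a<..b} s * M)"
      by (rule integrable_interval_bounded[where M="\<bar>M\<bar>"]) auto
    show "\<bar>indicator {a<..b} s * f s\<bar> \<le> indicator {a<..b} s * M" for s
      using assms(2,4) by (auto simp: indicator_def abs_mult)
  qed (use int in auto)
  also have "\<dots> = M * (b - a)" using assms(3) by simp
  finally show ?thesis .
qed

lemma integral_interval_split:
  fixes f :: "real \<Rightarrow> real"
  assumes [measurable]: "f \<in> borel_measurable borel" and "\<And>s. a < s \<Longrightarrow> s \<le> d \<Longrightarrow> \<bar>f s\<bar> \<le> M"
    and "a \<le> b" "b \<le> d"
  shows "(\<integral>s. indicator {a<..d} s * f s \<partial>lborel) =
    (\<integral>s. indicator {a<..b} s * f s \<partial>lborel) + (\<integral>s. indicator {b<..d} s * f s \<partial>lborel)"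
proof -
  have "(\<integral>s. indicator {a<..d} s * f s \<partial>lborel) = (\<integral>s. indicator {a<..b} s * f s + indicator {b<..d} s * f s \<partial>lborel)"
    using assms(3,4) by (intro Bochner_Integration.integral_cong refl) (auto simp: indicator_def)
  also have "\<dots> = (\<integral>s. indicator {a<..b} s * f s \<partial>lborel) + (\<integral>s. indicator {b<..d} s * f s \<partial>lborel)"
    by (intro Bochner_Integration.integral_add integrable_interval_bounded[where M=M]) (use assms in auto)
  finally show ?thesis .
qed

lemma exp_minus_bounds:
  fixes x :: real
  assumes "\<bar>x\<bar> \<le> 1"
  shows "\<bar>exp (- x) - 1 + x\<bar> \<le> x\<^sup>2" "\<bar>exp (- x) - 1\<bar> \<le> 2 * \<bar>x\<bar>"
proof -
  have lo: "1 - x \<le> exp (- x)" using exp_ge_add_one_self[of "- x"] by simp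
  have up: "exp (- x) \<le> 1 - x + x\<^sup>2"
  proof (cases "x \<le> 0")
    case True
    then show ?thesis using exp_bound[of "- x"] assms by simp
  next
    case False
    \<comment> \<open>The product equals 1 + x^3.\<close>
    have "1 \<le> (1 - x + x\<^sup>2) * (1 + x)" using False by (simp add: algebra_simps power2_eq_square)
    also have "\<dots> \<le> (1 - x + x\<^sup>2) * exp x"
    proof (rule mult_left_mono)
      have "0 \<le> (x - 1/2)\<^sup>2 + 3/4" by simp
      also have "\<dots> = 1 - x + x\<^sup>2" by (simp add: power2_eq_square algebra_simps)
      finally show "0 \<le> 1 - x + x\<^sup>2" .
    qed simp
    finally show ?thesis by (simp add: exp_minus field_simps)
  qed
  show "\<bar>exp (- x) - 1 + x\<bar> \<le> x\<^sup>2" using lo up by simp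
  have "x\<^sup>2 = \<bar>x\<bar> * \<bar>x\<bar>" by (simp add: power2_eq_square)
  also have "\<dots> \<le> \<bar>x\<bar> * 1" using assms by (intro mult_left_mono) auto
  finally have "x\<^sup>2 \<le> \<bar>x\<bar>" by simp
  then show "\<bar>exp (- x) - 1\<bar> \<le> 2 * \<bar>x\<bar>" using lo up by linarith
qed

text \<open>The integrand \<open>r\<close> is only measurable, so the fundamental theorem of calculus does not apply
  pointwise; instead the defect of the identity has increments that are quadratic in the step.\<close>

lemma integral_rate_exp:
  fixes r :: "real \<Rightarrow> real"
  assumes r[measurable]: "r \<in> borel_measurable borel" and bnd: "\<And>s. \<bar>r s\<bar> \<le> K"
  defines "R \<equiv> \<lambda>t. \<integral>s. indicator {0<..t} s * r s \<partial>lborel"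
  assumes T: "0 \<le> T"
  shows "R \<in> borel_measurable borel"
    and "(\<integral>t. indicator {0<..T} t * (r t * exp (- R t)) \<partial>lborel) = 1 - exp (- R T)"
proof -
  have K: "0 \<le> K" using bnd[of 0] by linarith
  show [measurable]: "R \<in> borel_measurable borel"
  proof -
    have "(\<lambda>t. \<integral>s. (if 0 < s \<and> s \<le> t then r s else 0) \<partial>lborel) \<in> borel_measurable borel"
      by measurable
    moreover have "R = (\<lambda>t. \<integral>s. (if 0 < s \<and> s \<le> t then r s else 0) \<partial>lborel)"
      unfolding R_def by (intro ext Bochner_Integration.integral_cong refl) (auto simp: indicator_def)
    ultimately show ?thesis by simp
  qed
  have Rinc: "R b - R a = (\<integral>s. indicator {a<..b} s * r s \<partial>lborel)" if "0 \<le> a" "a \<le> b" for a b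
    unfolding R_def using integral_interval_split[OF r bnd that] by simp
  have Rlip: "\<bar>R b - R a\<bar> \<le> K * (b - a)" if "0 \<le> a" "a \<le> b" for a b
    unfolding Rinc[OF that] by (rule integral_interval_bound) (use bnd K that in auto)
  have R0: "R 0 = 0" unfolding R_def by simp
  have Rbd: "exp (- R t) \<le> exp (K * T)" if "0 \<le> t" "t \<le> T" for t
  proof -
    have "\<bar>R t\<bar> \<le> K * t" using Rlip[of 0 t] that R0 by simp
    moreover have "K * t \<le> K * T" using that K by (intro mult_left_mono) auto
    ultimately have "- R t \<le> K * T" by linarith
    then show ?thesis by simp
  qed
  define f where "f t = r t * exp (- R t)" for t
  have [measurable]: "f \<in> borel_measurable borel" unfolding f_def by measurable
  have fbd: "\<bar>f s\<bar> \<le> K * exp (K * T)" if "0 < s" "s \<le> T" for s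
    unfolding f_def abs_mult using bnd Rbd that K by (intro mult_mono) auto
  \<comment> \<open>The claim says that \<open>D\<close> takes the same value at 0 and at T;
    constancy on the whole interval follows from a zero derivative.\<close>
  define D where "D t = exp (- R t) + (\<integral>s. indicator {0<..t} s * f s \<partial>lborel)" for t
  \<comment> \<open>Of the three K^2, one comes from the second-order remainder of the exponential
    and two from the integral of \<open>g\<close> below; \<open>exp (K * T)\<close> bounds the
    common factor exp(-R a).\<close>
  define M where "M = exp (K * T) * (3 * K\<^sup>2)"
  have key: "\<bar>D b - D a\<bar> \<le> M * (b - a)\<^sup>2" if ab: "0 \<le> a" "a \<le> b" "b \<le> T" "K * (b - a) \<le> 1" for a b
  proof -
    have d: "\<bar>R s - R a\<bar> \<le> K * (b - a)" "\<bar>R s - R a\<bar> \<le> 1" if "a < s" "s \<le> b" for s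
    proof -
      have "\<bar>R s - R a\<bar> \<le> K * (s - a)" using Rlip[of a s] that ab by simp
      also have "\<dots> \<le> K * (b - a)" using that K by (intro mult_left_mono) auto
      finally show "\<bar>R s - R a\<bar> \<le> K * (b - a)" .
      then show "\<bar>R s - R a\<bar> \<le> 1" using ab by linarith
    qed
    have d': "\<bar>R b - R a\<bar> \<le> K * (b - a)" "\<bar>R b - R a\<bar> \<le> 1" using Rlip[OF ab(1,2)] ab(4) by auto
    \<comment> \<open>On (a, b] the integrand is exp(-R a) (r + g). The part r cancels the
      first-order term of exp(-R b) - exp(-R a), and g is of order b - a, so its integral is
      quadratic.\<close>
    define g where "g s = r s * (exp (- (R s - R a)) - 1)" for s
    have [measurable]: "g \<in> borel_measurable borel" unfolding g_def by measurable
    have gbd: "\<bar>g s\<bar> \<le> K * (2 * (K * (b - a)))" if "a < s" "s \<le> b" for s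
      unfolding g_def abs_mult
    proof (intro mult_mono bnd K abs_ge_zero)
      have "\<bar>exp (- (R s - R a)) - 1\<bar> \<le> 2 * \<bar>R s - R a\<bar>"
        by (rule exp_minus_bounds(2)) (rule d[OF that])
      also have "\<dots> \<le> 2 * (K * (b - a))" using d(1)[OF that] by simp
      finally show "\<bar>exp (- (R s - R a)) - 1\<bar> \<le> 2 * (K * (b - a))" .
    qed
    have fg: "f s = exp (- R a) * (r s + g s)" for s
      unfolding f_def g_def by (simp add: algebra_simps flip: exp_add)
    have "D b - D a = exp (- R b) - exp (- R a) + (\<integral>s. indicator {a<..b} s * f s \<partial>lborel)"
      unfolding D_def using integral_interval_split[of f 0 b "K * exp (K * T)" a] fbd ab by simp
    also have "(\<integral>s. indicator {a<..b} s * f s \<partial>lborel)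
        = exp (- R a) * (\<integral>s. indicator {a<..b} s * r s + indicator {a<..b} s * g s \<partial>lborel)"
      unfolding fg by (subst integral_mult_right_zero[symmetric], intro Bochner_Integration.integral_cong refl)
        (simp add: algebra_simps)
    also have "(\<integral>s. indicator {a<..b} s * r s + indicator {a<..b} s * g s \<partial>lborel)
        = (R b - R a) + (\<integral>s. indicator {a<..b} s * g s \<partial>lborel)"
      unfolding Rinc[OF ab(1,2)]
      by (intro Bochner_Integration.integral_add integrable_interval_bounded[OF r bnd]
          integrable_interval_bounded[OF _ gbd]) auto
    also have "exp (- R b) = exp (- R a) * exp (- (R b - R a))" by (simp flip: exp_add)
    finally have eq: "D b - D a = exp (- R a) * ((exp (- (R b - R a)) - 1 + (R b - R a))
        + (\<integral>s. indicator {a<..b} s * g s \<partial>lborel))"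
      by (simp add: algebra_simps)
    have "\<bar>exp (- (R b - R a)) - 1 + (R b - R a)\<bar> \<le> (R b - R a)\<^sup>2"
      by (rule exp_minus_bounds(1)) (rule d')
    also have "\<dots> \<le> (K * (b - a))\<^sup>2" using d'(1) by (metis abs_ge_zero power2_abs power_mono)
    finally have 1: "\<bar>exp (- (R b - R a)) - 1 + (R b - R a)\<bar> \<le> (K * (b - a))\<^sup>2" .
    have "\<bar>\<integral>s. indicator {a<..b} s * g s \<partial>lborel\<bar> \<le> K * (2 * (K * (b - a))) * (b - a)"
      using gbd ab K by (intro integral_interval_bound) auto
    then have 2: "\<bar>\<integral>s. indicator {a<..b} s * g s \<partial>lborel\<bar> \<le> 2 * (K * (b - a))\<^sup>2"
      by (simp add: power2_eq_square algebra_simps)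
    have "\<bar>D b - D a\<bar> = exp (- R a) * \<bar>(exp (- (R b - R a)) - 1 + (R b - R a)) + (\<integral>s. indicator {a<..b} s * g s \<partial>lborel)\<bar>"
      unfolding eq abs_mult by simp
    also have "\<dots> \<le> exp (K * T) * (3 * (K * (b - a))\<^sup>2)"
      using Rbd[of a] ab 1 2 by (intro mult_mono) auto
    finally show ?thesis unfolding M_def by (simp add: power_mult_distrib)
  qed
  have sym: "\<bar>D y - D x\<bar> \<le> M * \<bar>y - x\<bar>\<^sup>2" if "x \<in> {0..T}" "y \<in> {0..T}" "K * \<bar>y - x\<bar> \<le> 1" for x y
    using key[of x y] key[of y x] that by (cases "x \<le> y") (auto simp: abs_minus_commute power2_commute)
  have "\<exists>c. \<forall>x\<in>{0..T}. D x = c"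
  proof (rule has_field_derivative_zero_constant)
    show "convex {0..T}" by simp
    fix x assume x: "x \<in> {0..T}"
    show "(D has_field_derivative 0) (at x within {0..T})"
      unfolding has_field_derivative_iff
    proof (rule Lim_null_comparison)
      have "((\<lambda>y. K * \<bar>y - x\<bar>) \<longlongrightarrow> K * \<bar>x - x\<bar>) (at x within {0..T})" by (intro tendsto_intros)
      then have "\<forall>\<^sub>F y in at x within {0..T}. K * \<bar>y - x\<bar> < 1" by (rule order_tendstoD(2)) simp
      moreover have "\<forall>\<^sub>F y in at x within {0..T}. y \<in> {0..T} \<and> y \<noteq> x"
        by (auto simp: eventually_at_filter)
      ultimately show "\<forall>\<^sub>F y in at x within {0..T}. norm ((D y - D x) / (y - x)) \<le> M * \<bar>y - x\<bar>"
      proof eventually_elim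
        case (elim y)
        then have "\<bar>D y - D x\<bar> \<le> M * \<bar>y - x\<bar> * \<bar>y - x\<bar>"
          using sym[OF x, of y] by (simp add: power2_eq_square mult.assoc)
        then show ?case using elim by (simp add: divide_le_eq)
      qed
      have "((\<lambda>y. M * \<bar>y - x\<bar>) \<longlongrightarrow> M * \<bar>x - x\<bar>) (at x within {0..T})" by (intro tendsto_intros)
      then show "((\<lambda>y. M * \<bar>y - x\<bar>) \<longlongrightarrow> 0) (at x within {0..T})" by simp
    qed
  qed
  then have "D T = D 0" using T by auto
  moreover have "D 0 = 1" unfolding D_def R0 by simp
  ultimately show "(\<integral>t. indicator {0<..T} t * (r t * exp (- R t)) \<partial>lborel) = 1 - exp (- R T)"
    unfolding D_def f_def by simp
qed

section \<open>Extended exponentials and cumulative rates\<close>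

lemma ennexp_neg_ennreal: "0 \<le> x \<Longrightarrow> ennexp_neg (ennreal x) = ennreal (exp (- x))"
  unfolding ennexp_neg_def by simp

lemma ennexp_ennreal: "0 \<le> x \<Longrightarrow> ennexp (ennreal x) = ennreal (exp x)"
  unfolding ennexp_def by simp

lemma ennexp_0[simp]: "ennexp 0 = 1" "ennexp_neg 0 = 1"
  unfolding ennexp_def ennexp_neg_def by simp_all

lemma measurable_ennexp[measurable]: "ennexp \<in> borel_measurable borel" "ennexp_neg \<in> borel_measurable borel"
  unfolding ennexp_def[abs_def] ennexp_neg_def[abs_def] by measurable

lemma ennexp_ge_1: "1 \<le> ennexp L"
  unfolding ennexp_def by (cases L) (auto simp: ennreal_1[symmetric] simp del: ennreal_1)

lemma ennexp_mono: "L \<le> L' \<Longrightarrow> ennexp L \<le> ennexp L'"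
  by (cases L; cases L') (auto simp: ennexp_ennreal ennexp_def[of top] top_unique)


lemma ennexp_neg_le_1: "ennexp_neg L \<le> 1"
  unfolding ennexp_neg_def by (cases L) (auto simp: ennreal_1[symmetric] simp del: ennreal_1)

lemma ennexp_add: "ennexp (L + L') = ennexp L * ennexp L'"
proof (cases "L = \<top> \<or> L' = \<top>")
  case True
  have "ennexp M \<noteq> 0" for M using ennexp_ge_1[of M] by auto
  then show ?thesis using True by (auto simp: ennexp_def[of top] ennreal_top_mult ennreal_mult_top)
next
  case False
  then obtain x y where "L = ennreal x" "L' = ennreal y" "0 \<le> x" "0 \<le> y" by (metis ennreal_cases)
  then show ?thesis by (simp add: ennexp_ennreal exp_add ennreal_mult flip: ennreal_plus)
qed

text \<open>Reduces the exponential of an infinite path cost to costs up to finitely many jumps. A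
  level y below exp x is reached because ln y lies below the supremum; levels below 1 are reached
  trivially, and an infinite supremum uses n <= exp n.\<close>

lemma ennexp_SUP:
  fixes L :: "nat \<Rightarrow> ennreal"
  assumes "incseq L"
  shows "ennexp (SUP n. L n) = (SUP n. ennexp (L n))"
proof (rule antisym)
  show "(SUP n. ennexp (L n)) \<le> ennexp (SUP n. L n)"
    by (intro SUP_least ennexp_mono SUP_upper) auto
  show "ennexp (SUP n. L n) \<le> (SUP n. ennexp (L n))"
  proof (cases "SUP n. L n")
    case (real x)
    have "ennreal (exp x) \<le> (SUP n. ennexp (L n))"
    proof (rule dense_le)
      fix e assume "e < ennreal (exp x)"
      then obtain y where y: "e = ennreal y" "0 \<le> y" "y < exp x"
        by (cases e) (auto simp: ennreal_less_iff)
      show "e \<le> (SUP n. ennexp (L n))"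
      proof (cases "y < 1")
        case True
        have "e \<le> 1" using True y by (simp add: ennreal_1[symmetric] del: ennreal_1)
        also have "1 \<le> ennexp (L 0)" by (rule ennexp_ge_1)
        also have "\<dots> \<le> (SUP n. ennexp (L n))" by (rule SUP_upper) simp
        finally show ?thesis .
      next
        case False
        then have "ln y < x" "0 \<le> ln y" using y by (auto simp: ln_less_cancel_iff[of y "exp x", simplified])
        then have "ennreal (ln y) < (SUP n. L n)" using real by (simp add: ennreal_less_iff)
        then obtain n where n: "ennreal (ln y) < L n" by (auto simp: less_SUP_iff)
        have "e = ennexp (ennreal (ln y))" using y False \<open>0 \<le> ln y\<close> by (simp add: ennexp_ennreal)
        also have "\<dots> \<le> ennexp (L n)" by (rule ennexp_mono) (use n in simp)
        also have "\<dots> \<le> (SUP n. ennexp (L n))" by (rule SUP_upper) simp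
        finally show ?thesis .
      qed
    qed
    then show ?thesis using real by (simp add: ennexp_ennreal)
  next
    case top
    have "(SUP n. ennexp (L n)) = \<top>"
    proof (rule ennreal_SUP_eq_top)
      fix n :: nat
      have "ennreal (real n) < (SUP n. L n)" unfolding top by simp
      then obtain i where i: "ennreal (real n) < L i" by (auto simp: less_SUP_iff)
      have "of_nat n \<le> ennexp (ennreal (real n))"
      proof -
        have "real n \<le> exp (real n)" using exp_ge_add_one_self[of "real n"] by linarith
        then show ?thesis by (simp add: ennexp_ennreal ennreal_of_nat_eq_real_of_nat)
      qed
      also have "\<dots> \<le> ennexp (L i)" by (rule ennexp_mono) (use i in simp)
      finally show "\<exists>i\<in>UNIV. of_nat n \<le> ennexp (L i)" by blast
    qed
    then show ?thesis by (metis top_greatest)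
  qed
qed

text \<open>Common form of \<open>Lam\<close> and of the summands of \<open>pathcost\<close>; the
  end point t may be infinite.\<close>

definition cumul :: "(real \<Rightarrow> ennreal) \<Rightarrow> ennreal \<Rightarrow> ennreal" where
  "cumul f t = (\<integral>\<^sup>+ s. indicator {s. 0 < s \<and> ennreal s < t} s * f s \<partial>lborel)"

lemma cumul_mono: "t \<le> t' \<Longrightarrow> cumul f t \<le> cumul f t'"
  unfolding cumul_def by (intro nn_integral_mono mult_right_mono) (auto simp: indicator_def)


lemma cumul_ennreal:
  fixes f :: "real \<Rightarrow> real"
  assumes [measurable]: "f \<in> borel_measurable borel" and f: "\<And>s. 0 \<le> f s" "\<And>s. f s \<le> K"
  shows "cumul (\<lambda>s. ennreal (f s)) (ennreal t) = ennreal (\<integral>s. indicator {0<..t} s * f s \<partial>lborel)"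
proof -
  have "cumul (\<lambda>s. ennreal (f s)) (ennreal t) = (\<integral>\<^sup>+ s. ennreal (indicator {0<..t} s * f s) \<partial>lborel)"
    unfolding cumul_def
  proof (rule nn_integral_cong_AE)
    \<comment> \<open>The open interval in \<open>cumul\<close> and the half-open one of the real
      integral differ only in the end point t.\<close>
    have "AE s in lborel. s \<noteq> t" by (rule AE_lborel_singleton)
    then show "AE s in lborel. indicator {s. 0 < s \<and> ennreal s < ennreal t} s * ennreal (f s) = ennreal (indicator {0<..t} s * f s)"
      by eventually_elim (auto simp: indicator_def ennreal_less_iff)
  qed
  also have "\<dots> = ennreal (\<integral>s. indicator {0<..t} s * f s \<partial>lborel)"
    by (intro nn_integral_eq_integral integrable_interval_bounded[where M=K]) (use f in auto)
  finally show ?thesis .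
qed

lemma measurable_cumul[measurable]:
  assumes [measurable]: "f \<in> borel_measurable borel"
  shows "cumul f \<in> borel_measurable borel"
  unfolding cumul_def[abs_def] by measurable

lemma cumul_top:
  assumes [measurable]: "f \<in> borel_measurable borel"
  shows "cumul f \<top> = (SUP n. cumul f (ennreal (real n)))"
proof -
  have "cumul f \<top> = (\<integral>\<^sup>+ s. (SUP n. indicator {s. 0 < s \<and> ennreal s < ennreal (real n)} s * f s) \<partial>lborel)"
    unfolding cumul_def
  proof (rule nn_integral_cong)
    fix s :: real
    show "indicator {s. 0 < s \<and> ennreal s < \<top>} s * f s = (SUP n. indicator {s. 0 < s \<and> ennreal s < ennreal (real n)} s * f s)"
    proof (cases "0 < s")
      case True
      obtain n where n: "s < real n" using reals_Archimedean2 by blast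
      show ?thesis
      proof (rule antisym)
        have "indicator {s. 0 < s \<and> ennreal s < \<top>} s * f s = indicator {s. 0 < s \<and> ennreal s < ennreal (real n)} s * f s"
          using True n by (simp add: indicator_def ennreal_less_iff)
        also have "\<dots> \<le> (SUP n. indicator {s. 0 < s \<and> ennreal s < ennreal (real n)} s * f s)" by (rule SUP_upper) simp
        finally show "indicator {s. 0 < s \<and> ennreal s < \<top>} s * f s \<le> (SUP n. indicator {s. 0 < s \<and> ennreal s < ennreal (real n)} s * f s)" .
      qed (auto intro!: SUP_least mult_right_mono simp: indicator_def)
    qed simp
  qed
  also have "\<dots> = (SUP n. cumul f (ennreal (real n)))"
    unfolding cumul_def
  proof (rule nn_integral_monotone_convergence_SUP)
    show "incseq (\<lambda>n s. indicator {s. 0 < s \<and> ennreal s < ennreal (real n)} s * f s)"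
      by (auto simp: incseq_def le_fun_def indicator_def ennreal_less_iff)
  qed measurable
  finally show ?thesis .
qed

lemma ennexp_neg_eq_inverse: "ennexp_neg L = inverse (ennexp L)"
  by (cases L) (auto simp: ennexp_neg_ennreal ennexp_ennreal ennexp_def[of top] ennexp_neg_def[of top]
      inverse_ennreal exp_minus)

lemma ennexp_neg_LIMSEQ:
  assumes "incseq L"
  shows "(\<lambda>n. ennexp_neg (L n)) \<longlonglongrightarrow> ennexp_neg (SUP n. L n)"
proof -
  have "incseq (\<lambda>n. ennexp (L n))" using assms ennexp_mono unfolding incseq_def by blast
  then have "(\<lambda>n. ennexp (L n)) \<longlonglongrightarrow> ennexp (SUP n. L n)"
    unfolding ennexp_SUP[OF assms] by (rule LIMSEQ_SUP)
  then have "(\<lambda>n. inverse (ennexp (L n))) \<longlonglongrightarrow> inverse (ennexp (SUP n. L n))"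
    by (rule continuous_on_tendsto_compose[where s=UNIV, OF continuous_on_inverse_ennreal[OF continuous_on_id]]) auto
  then show ?thesis unfolding ennexp_neg_eq_inverse .
qed

lemma incseq_cumul: "incseq (\<lambda>n. cumul f (ennreal (real n)))"
  by (intro incseq_SucI cumul_mono ennreal_leI) simp

lemma nn_integral_halfline_SUP:
  assumes [measurable]: "f \<in> borel_measurable borel"
  shows "(\<integral>\<^sup>+ t. indicator {0<..} t * f t \<partial>lborel) = (SUP n. \<integral>\<^sup>+ t. indicator {0<..real n} t * f t \<partial>lborel)"
proof -
  have "(SUP n. indicator {0<..real n} t * f t) = indicator {0<..} t * f t" for t :: real
  proof (rule antisym)
    obtain n where n: "t \<le> real n" using real_arch_simple by blast
    have "indicator {0<..} t * f t = indicator {0<..real n} t * f t" using n by (simp add: indicator_def)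
    also have "\<dots> \<le> (SUP n. indicator {0<..real n} t * f t)" by (rule SUP_upper) simp
    finally show "indicator {0<..} t * f t \<le> (SUP n. indicator {0<..real n} t * f t)" .
  qed (auto intro!: SUP_least mult_right_mono simp: indicator_def)
  then have "(\<integral>\<^sup>+ t. indicator {0<..} t * f t \<partial>lborel) = (\<integral>\<^sup>+ t. (SUP n. indicator {0<..real n} t * f t) \<partial>lborel)"
    by simp
  also have "\<dots> = (SUP n. \<integral>\<^sup>+ t. indicator {0<..real n} t * f t \<partial>lborel)"
    by (rule nn_integral_monotone_convergence_SUP) (auto simp: incseq_def le_fun_def indicator_def)
  finally show ?thesis .
qed

text \<open>Total mass of the sojourn law: up to T the density integrates to 1 - exp(-R T), which
  the survival probability at T complements to 1, and both terms converge as T grows.\<close>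

lemma nn_integral_sojourn:
  fixes r :: "real \<Rightarrow> real"
  assumes r[measurable]: "r \<in> borel_measurable borel" and bnd: "\<And>s. 0 \<le> r s" "\<And>s. r s \<le> K"
  defines "\<rho> \<equiv> \<lambda>s. ennreal (r s)"
  shows "(\<integral>\<^sup>+ t. indicator {0<..} t * (ennexp_neg (cumul \<rho> (ennreal t)) * \<rho> t) \<partial>lborel) + ennexp_neg (cumul \<rho> \<top>) = 1"
proof -
  define R where "R t = (\<integral>s. indicator {0<..t} s * r s \<partial>lborel)" for t
  have abs: "\<bar>r s\<bar> \<le> K" for s using bnd[of s] by simp
  note RE = integral_rate_exp[OF r abs, folded R_def]
  have [measurable]: "R \<in> borel_measurable borel" using RE(1)[of 0] by simp
  have R0: "0 \<le> R t" for t unfolding R_def using bnd by (intro integral_nonneg_AE) auto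
  have accR: "cumul \<rho> (ennreal t) = ennreal (R t)" for t
    unfolding \<rho>_def R_def by (rule cumul_ennreal[OF r bnd])
  have [measurable]: "\<rho> \<in> borel_measurable borel" unfolding \<rho>_def by measurable
  have part: "(\<integral>\<^sup>+ t. indicator {0<..T} t * (ennexp_neg (cumul \<rho> (ennreal t)) * \<rho> t) \<partial>lborel) = ennreal (1 - exp (- R T))"
    if "0 \<le> T" for T
  proof -
    have "(\<integral>\<^sup>+ t. indicator {0<..T} t * (ennexp_neg (cumul \<rho> (ennreal t)) * \<rho> t) \<partial>lborel)
        = (\<integral>\<^sup>+ t. ennreal (indicator {0<..T} t * (r t * exp (- R t))) \<partial>lborel)"
      unfolding accR using bnd R0
      by (intro nn_integral_cong) (auto simp: \<rho>_def indicator_def ennexp_neg_ennreal ennreal_mult mult.commute)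
    also have "\<dots> = ennreal (\<integral>t. indicator {0<..T} t * (r t * exp (- R t)) \<partial>lborel)"
    proof (intro nn_integral_eq_integral integrable_interval_bounded[where M=K])
      show "\<bar>r s * exp (- R s)\<bar> \<le> K" for s
        using mult_mono[OF bnd(2)[of s], of "exp (- R s)" 1] R0[of s] bnd[of s] by (simp add: abs_mult)
    qed (use bnd in auto)
    finally show ?thesis using RE(2)[OF that] by simp
  qed
  define F where "F n = (\<integral>\<^sup>+ t. indicator {0<..real n} t * (ennexp_neg (cumul \<rho> (ennreal t)) * \<rho> t) \<partial>lborel)" for n :: nat
  have "incseq F"
    unfolding F_def incseq_def by (intro allI impI nn_integral_mono mult_right_mono) (auto simp: indicator_def)
  then have "F \<longlonglongrightarrow> (SUP n. F n)" by (rule LIMSEQ_SUP)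
  then have F: "F \<longlonglongrightarrow> (\<integral>\<^sup>+ t. indicator {0<..} t * (ennexp_neg (cumul \<rho> (ennreal t)) * \<rho> t) \<partial>lborel)"
    unfolding F_def by (subst nn_integral_halfline_SUP) measurable
  have "(\<lambda>n. ennexp_neg (cumul \<rho> (ennreal (real n)))) \<longlonglongrightarrow> ennexp_neg (cumul \<rho> \<top>)"
    by (subst cumul_top) (measurable, rule ennexp_neg_LIMSEQ[OF incseq_cumul])
  from tendsto_add[OF F this] have "(\<lambda>n. F n + ennexp_neg (cumul \<rho> (ennreal (real n)))) \<longlonglongrightarrow>
    (\<integral>\<^sup>+ t. indicator {0<..} t * (ennexp_neg (cumul \<rho> (ennreal t)) * \<rho> t) \<partial>lborel) + ennexp_neg (cumul \<rho> \<top>)" .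
  moreover have "F n + ennexp_neg (cumul \<rho> (ennreal (real n))) = 1" for n
  proof -
    have "F n = ennreal (1 - exp (- R n))" unfolding F_def by (rule part) simp
    then have "F n + ennexp_neg (cumul \<rho> (ennreal (real n))) = ennreal (1 - exp (- R n)) + ennreal (exp (- R n))"
      unfolding accR using R0 by (simp add: ennexp_neg_ennreal)
    also have "\<dots> = ennreal 1" using R0[of "real n"] by (subst ennreal_plus[symmetric]) auto
    finally show ?thesis by simp
  qed
  ultimately show ?thesis by (simp add: LIMSEQ_const_iff)
qed

section \<open>Bounds for the one-jump value\<close>

text \<open>If the right-hand side were below \<open>v\<close>, the weight \<open>m t = exp (- \<integral>\<^sub>0\<^sup>t (q - c))\<close> would stay above a
  positive constant and grow at least linearly; then either \<open>\<integral> q = \<infinity>\<close> and the integral over jumps is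
  infinite, or the survival term is.\<close>

lemma one_jump_lower_bound:
  fixes q c :: "real \<Rightarrow> real" and G :: "real \<Rightarrow> ennreal"
  assumes q[measurable]: "q \<in> borel_measurable borel" and c[measurable]: "c \<in> borel_measurable borel"
    and G[measurable]: "G \<in> borel_measurable borel"
    and qb: "\<And>s. 0 \<le> q s" "\<And>s. q s \<le> K" and cb: "\<And>s. 0 \<le> c s" "\<And>s. c s \<le> K"
    and v: "1 \<le> v" and \<delta>: "0 < \<delta>"
    and Gq: "\<And>s. ennreal (q s) \<le> G s"
    and Gv: "\<And>s. ennreal (v * q s + \<delta>) \<le> G s + ennreal (v * c s)"
  defines "Q \<equiv> cumul (\<lambda>s. ennreal (q s))" and "C \<equiv> cumul (\<lambda>s. ennreal (c s))"
  shows "ennreal v \<le> (\<integral>\<^sup>+ t. indicator {0<..} t * (ennexp_neg (Q (ennreal t)) * (ennexp (C (ennreal t)) * G t)) \<partial>lborel)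
      + ennexp_neg (Q \<top>) * ennexp (C \<top>)" (is "_ \<le> ?J + ?E")
proof (rule ccontr)
  assume "\<not> ?thesis"
  then have less: "?J + ?E < ennreal v" by simp
  then have "?J + ?E < \<top>" using ennreal_less_top less_trans by blast
  then obtain j where j: "?J + ?E = ennreal j" "0 \<le> j" by (cases "?J + ?E") auto
  have jv: "j < v" using less j by (simp add: ennreal_less_iff)
  define Rq where "Rq t = (\<integral>s. indicator {0<..t} s * q s \<partial>lborel)" for t
  define Rc where "Rc t = (\<integral>s. indicator {0<..t} s * c s \<partial>lborel)" for t
  define R where "R t = (\<integral>s. indicator {0<..t} s * (q s - c s) \<partial>lborel)" for t
  define m where "m t = exp (- R t)" for t
  have R: "R t = Rq t - Rc t" for t
  proof -
    have "R t = (\<integral>s. indicator {0<..t} s * q s - indicator {0<..t} s * c s \<partial>lborel)"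
      unfolding R_def by (simp add: algebra_simps)
    also have "\<dots> = Rq t - Rc t" unfolding Rq_def Rc_def
      by (intro Bochner_Integration.integral_diff integrable_interval_bounded[where M=K]) (use qb cb in auto)
    finally show ?thesis .
  qed
  have abs: "\<bar>q s - c s\<bar> \<le> K" for s using qb[of s] cb[of s] by linarith
  have qc: "(\<lambda>s. q s - c s) \<in> borel_measurable borel" by measurable
  note RE = integral_rate_exp[OF qc abs, folded R_def]
  have [measurable]: "R \<in> borel_measurable borel" using RE(1)[of 0] by simp
  have [measurable]: "m \<in> borel_measurable borel" unfolding m_def by measurable
  have m0: "0 < m t" for t unfolding m_def by simp
  have R0: "0 \<le> Rq t" "0 \<le> Rc t" for t
    unfolding Rq_def Rc_def using qb cb by (auto intro!: integral_nonneg_AE)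
  have QR: "Q (ennreal t) = ennreal (Rq t)" for t
    unfolding Q_def Rq_def by (rule cumul_ennreal[OF q qb])
  have CR: "C (ennreal t) = ennreal (Rc t)" for t
    unfolding C_def Rc_def by (rule cumul_ennreal[OF c cb])
  have mQC: "ennexp_neg (Q (ennreal t)) * ennexp (C (ennreal t)) = ennreal (m t)" for t
    unfolding QR CR m_def R using R0
    by (simp add: ennexp_neg_ennreal ennexp_ennreal ennreal_mult[symmetric] exp_add[symmetric])
  have J: "?J = (\<integral>\<^sup>+ t. indicator {0<..} t * (ennreal (m t) * G t) \<partial>lborel)"
    unfolding mult.assoc[symmetric, of "ennexp_neg _"] mQC ..
  \<comment> \<open>\<open>Gv\<close> multiplied by \<open>m\<close> and integrated over (0, T]: the
    integral of m G is at most \<open>?J\<close>, hence at most j, and the integral of (q - c) m is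
    1 - m T by \<open>integral_rate_exp\<close>.\<close>
  have main: "v * (1 - m T) + \<delta> * (\<integral>t. indicator {0<..T} t * m t \<partial>lborel) \<le> j" if T: "0 \<le> T" for T
  proof -
    have mb: "m t \<le> exp (K * T)" if "0 < t" "t \<le> T" for t
    proof -
      have "\<bar>R t\<bar> \<le> K * (t - 0)"
        unfolding R_def using abs that qb[of 0] by (intro integral_interval_bound) auto
      also have "\<dots> \<le> K * T" using that qb[of 0] by (simp add: mult_left_mono)
      finally show ?thesis unfolding m_def by simp
    qed
    have K0: "0 \<le> K" using qb[of 0] by linarith
    have i: "integrable lborel (\<lambda>t. indicator {0<..T} t * (h t * m t))"
      if [measurable]: "h \<in> borel_measurable borel" and h: "\<And>t. \<bar>h t\<bar> \<le> H" for h H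
    proof (rule integrable_interval_bounded[where M="H * exp (K * T)"])
      fix s assume s: "0 < s" "s \<le> T"
      show "\<bar>h s * m s\<bar> \<le> H * exp (K * T)"
        unfolding abs_mult using h[of s] mb[OF s] m0[of s] by (intro mult_mono) auto
    qed measurable
    define Iq where "Iq = (\<integral>t. indicator {0<..T} t * (q t * m t) \<partial>lborel)"
    define Ic where "Ic = (\<integral>t. indicator {0<..T} t * (c t * m t) \<partial>lborel)"
    define I1 where "I1 = (\<integral>t. indicator {0<..T} t * m t \<partial>lborel)"
    have iq: "integrable lborel (\<lambda>t. indicator {0<..T} t * (q t * m t))" by (rule i[where H=K]) (use qb in auto)
    have ic: "integrable lborel (\<lambda>t. indicator {0<..T} t * (c t * m t))" by (rule i[where H=K]) (use cb in auto)
    have i1: "integrable lborel (\<lambda>t. indicator {0<..T} t * m t)" using i[of "\<lambda>_. 1" 1] by simp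
    have nn: "0 \<le> Iq" "0 \<le> Ic" "0 \<le> I1" unfolding Iq_def Ic_def I1_def
      using qb cb m0 by (auto intro!: integral_nonneg_AE simp: less_imp_le)
    have "ennreal (v * Iq + \<delta> * I1) = (\<integral>\<^sup>+ t. ennreal (indicator {0<..T} t * (m t * (v * q t + \<delta>))) \<partial>lborel)"
    proof -
      have "v * Iq + \<delta> * I1 = (\<integral>t. v * (indicator {0<..T} t * (q t * m t)) + \<delta> * (indicator {0<..T} t * m t) \<partial>lborel)"
        unfolding Iq_def I1_def using iq i1 by simp
      also have "\<dots> = (\<integral>t. indicator {0<..T} t * (m t * (v * q t + \<delta>)) \<partial>lborel)"
        by (intro Bochner_Integration.integral_cong refl) (simp add: algebra_simps)
      finally have eq: "v * Iq + \<delta> * I1 = (\<integral>t. indicator {0<..T} t * (m t * (v * q t + \<delta>)) \<partial>lborel)" .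
      have "integrable lborel (\<lambda>t. v * (indicator {0<..T} t * (q t * m t)) + \<delta> * (indicator {0<..T} t * m t))"
        using iq i1 by simp
      then have "integrable lborel (\<lambda>t. indicator {0<..T} t * (m t * (v * q t + \<delta>)))"
        by (simp add: algebra_simps)
      then show ?thesis unfolding eq
        using qb m0 v \<delta> by (intro nn_integral_eq_integral[symmetric]) (auto simp: less_imp_le)
    qed
    also have "\<dots> \<le> (\<integral>\<^sup>+ t. indicator {0<..} t * (ennreal (m t) * G t) + ennreal (v * (indicator {0<..T} t * (c t * m t))) \<partial>lborel)"
    proof (rule nn_integral_mono)
      fix t
      have "ennreal (m t * (v * q t + \<delta>)) = ennreal (m t) * ennreal (v * q t + \<delta>)"
        using m0[of t] qb[of t] v \<delta> by (intro ennreal_mult) auto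
      also have "\<dots> \<le> ennreal (m t) * (G t + ennreal (v * c t))"
        by (intro mult_left_mono Gv) simp
      also have "\<dots> = ennreal (m t) * G t + ennreal (v * (c t * m t))"
        using m0[of t] cb[of t] v by (simp add: distrib_left ennreal_mult[symmetric] ac_simps)
      finally show "ennreal (indicator {0<..T} t * (m t * (v * q t + \<delta>)))
          \<le> indicator {0<..} t * (ennreal (m t) * G t) + ennreal (v * (indicator {0<..T} t * (c t * m t)))"
        by (simp add: indicator_def)
    qed
    also have "\<dots> = ?J + ennreal (v * Ic)"
    proof -
      have "(\<integral>\<^sup>+ t. ennreal (v * (indicator {0<..T} t * (c t * m t))) \<partial>lborel) = ennreal (v * Ic)"
        unfolding Ic_def using ic cb m0 v
        by (subst nn_integral_eq_integral) (auto simp: less_imp_le)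
      then show ?thesis unfolding J by (subst nn_integral_add) auto
    qed
    also have "\<dots> \<le> ennreal j + ennreal (v * Ic)" using j(1) by (metis add_right_mono le_iff_add)
    also have "\<dots> = ennreal (j + v * Ic)" using j nn v by (subst ennreal_plus) auto
    finally have "v * Iq + \<delta> * I1 \<le> j + v * Ic"
      using j nn v by (subst (asm) ennreal_le_iff) auto
    moreover have "Iq - Ic = 1 - m T"
    proof -
      have "Iq - Ic = (\<integral>t. indicator {0<..T} t * (q t * m t) - indicator {0<..T} t * (c t * m t) \<partial>lborel)"
        unfolding Iq_def Ic_def by (rule Bochner_Integration.integral_diff[OF iq ic, symmetric])
      also have "\<dots> = (\<integral>t. indicator {0<..T} t * ((q t - c t) * exp (- R t)) \<partial>lborel)"
        unfolding m_def by (intro Bochner_Integration.integral_cong refl) (simp add: algebra_simps)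
      finally show ?thesis using RE(2)[OF T] unfolding m_def by simp
    qed
    moreover have "v * (Iq - Ic) = v * Iq - v * Ic" by (simp add: algebra_simps)
    ultimately show ?thesis unfolding I1_def by simp
  qed
  \<comment> \<open>The bound v (1 - m T) <= j, which is \<open>main\<close> without its nonnegative
    \<open>\<delta>\<close> term, solved for m T.\<close>
  define \<kappa> where "\<kappa> = (v - j) / v"
  have \<kappa>: "0 < \<kappa>" unfolding \<kappa>_def using jv v by simp
  have m\<kappa>: "\<kappa> \<le> m T" if "0 \<le> T" for T
  proof -
    have "0 \<le> (\<integral>t. indicator {0<..T} t * m t \<partial>lborel)"
      using m0 by (intro integral_nonneg_AE) (auto simp: less_imp_le)
    then have "v * (1 - m T) \<le> j" using main[OF that] \<delta> by (smt (verit) mult_nonneg_nonneg)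
    then have "v - j \<le> m T * v" by (simp add: algebra_simps)
    then show ?thesis unfolding \<kappa>_def using v by (simp add: divide_le_eq)
  qed
  show False
  proof (cases "Q \<top>")
    case top
    have "(\<integral>\<^sup>+ t. indicator {0<..} t * ennreal (q t) \<partial>lborel) = Q \<top>"
      unfolding Q_def cumul_def by (intro nn_integral_cong) (auto simp: indicator_def)
    then have "\<top> = ennreal \<kappa> * (\<integral>\<^sup>+ t. indicator {0<..} t * ennreal (q t) \<partial>lborel)"
      using top \<kappa> by (simp add: ennreal_mult_top)
    also have "\<dots> = (\<integral>\<^sup>+ t. ennreal \<kappa> * (indicator {0<..} t * ennreal (q t)) \<partial>lborel)"
      by (rule nn_integral_cmult[symmetric]) measurable
    also have "\<dots> \<le> ?J" unfolding J
    proof (rule nn_integral_mono)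
      fix t
      have "ennreal \<kappa> * ennreal (q t) \<le> ennreal (m t) * G t" if "0 < t"
        using m\<kappa>[of t] that Gq[of t] by (intro mult_mono ennreal_leI) auto
      then show "ennreal \<kappa> * (indicator {0<..} t * ennreal (q t)) \<le> indicator {0<..} t * (ennreal (m t) * G t)"
        by (simp add: indicator_def)
    qed
    also have "?J \<le> ennreal j" using j(1) by (metis le_iff_add)
    finally show False by (simp add: top_unique)
  next
    case (real L)
    \<comment> \<open>If it were finite it would bound \<open>m\<close>, whereas \<open>main\<close>
      with m >= \<open>\<kappa>\<close> and j < v gives \<open>\<delta>\<close>
      \<open>\<kappa>\<close> T <= v m T for all T >= 0.\<close>
    have "ennexp (C \<top>) = \<top>"
    proof (rule ccontr)
      assume "ennexp (C \<top>) \<noteq> \<top>"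
      then obtain y where y: "ennexp (C \<top>) = ennreal y" "0 \<le> y" by (cases "ennexp (C \<top>)") auto
      have "m T \<le> y" for T
      proof -
        have "ennreal (m T) \<le> 1 * ennexp (C (ennreal T))"
          unfolding mQC[symmetric] by (intro mult_right_mono ennexp_neg_le_1) simp
        also have "\<dots> \<le> ennexp (C \<top>)" unfolding C_def by (simp add: ennexp_mono cumul_mono)
        finally show ?thesis using y by (simp add: ennreal_le_iff)
      qed
      moreover have "\<delta> * (\<kappa> * T) \<le> v * m T" if T: "0 \<le> T" for T
      proof -
        have mb: "m t \<le> y" for t by fact
        have "\<kappa> * T = (\<integral>t. indicator {0<..T} t * \<kappa> \<partial>lborel)" using T by simp
        also have "\<dots> \<le> (\<integral>t. indicator {0<..T} t * m t \<partial>lborel)"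
        proof (rule integral_mono)
          show "integrable lborel (\<lambda>t. indicator {0<..T} t * \<kappa>)"
            by (rule integrable_interval_bounded[where M="\<bar>\<kappa>\<bar>"]) auto
          show "integrable lborel (\<lambda>t. indicator {0<..T} t * m t)"
            by (rule integrable_interval_bounded[where M=y]) (use mb m0 in \<open>auto simp: less_imp_le\<close>)
          show "indicator {0<..T} t * \<kappa> \<le> indicator {0<..T} t * m t" for t
            using m\<kappa>[of t] by (auto simp: indicator_def)
        qed
        finally have "\<delta> * (\<kappa> * T) \<le> \<delta> * (\<integral>t. indicator {0<..T} t * m t \<partial>lborel)" using \<delta> by simp
        then show ?thesis using main[OF T] jv by (simp add: algebra_simps)
      qed
      ultimately have lin: "\<delta> * (\<kappa> * T) \<le> v * y" if "0 \<le> T" for T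
        using that v by (meson mult_left_mono order_trans zero_le_one)
      have "0 \<le> v * y" using v y by simp
      then have "v * y + 1 \<le> v * y"
      proof -
        have "\<delta> * (\<kappa> * ((v * y + 1) / (\<delta> * \<kappa>))) = v * y + 1" using \<delta> \<kappa> by simp
        moreover have "0 \<le> (v * y + 1) / (\<delta> * \<kappa>)"
          using \<open>0 \<le> v * y\<close> \<delta> \<kappa> by (intro divide_nonneg_nonneg mult_nonneg_nonneg) auto
        ultimately show ?thesis using lin by metis
      qed
      then show False by simp
    qed
    moreover have "ennexp_neg (Q \<top>) \<noteq> 0" using real by (simp add: ennexp_neg_ennreal)
    ultimately have "?E = \<top>" by (simp add: ennreal_mult_top)
    then show False using j by simp
  qed
qed

lemma cumul_const: "0 \<le> r \<Longrightarrow> 0 \<le> t \<Longrightarrow> cumul (\<lambda>_. ennreal r) (ennreal t) = ennreal (r * t)"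
  by (subst cumul_ennreal[where K=r]) (auto simp: mult.commute)

lemma cumul_const_top:
  assumes "0 < r" shows "cumul (\<lambda>_. ennreal r) \<top> = \<top>"
proof (rule ccontr)
  assume "cumul (\<lambda>_. ennreal r) \<top> \<noteq> \<top>"
  then obtain y where y: "cumul (\<lambda>_. ennreal r) \<top> = ennreal y" "0 \<le> y" by (cases "cumul (\<lambda>_. ennreal r) \<top>") auto
  have "cumul (\<lambda>_. ennreal r) (ennreal ((y + 1) / r)) \<le> cumul (\<lambda>_. ennreal r) \<top>" by (rule cumul_mono) simp
  then have "ennreal (r * ((y + 1) / r)) \<le> ennreal y"
    using assms y by (subst (asm) cumul_const) auto
  then show False using assms y by (simp add: ennreal_le_iff)
qed

text \<open>If c < q, the hypothesis gives g <= v (q - c), so the integrand is at most v times the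
  sojourn density with rate q - c, and the survival term vanishes because q > 0. If q <= c, the
  hypotheses force g = q = c = 0: no jump, no cost, value 1.\<close>

lemma one_jump_upper_bound:
  fixes q c v :: real and g :: ennreal
  assumes qc: "0 \<le> q" "0 \<le> c" and v: "1 \<le> v" and gq: "ennreal q \<le> g"
    and le: "g + ennreal (v * c) \<le> ennreal (v * q)"
  defines "Q \<equiv> cumul (\<lambda>_. ennreal q)" and "C \<equiv> cumul (\<lambda>_. ennreal c)"
  shows "(\<integral>\<^sup>+ t. indicator {0<..} t * (ennexp_neg (Q (ennreal t)) * (ennexp (C (ennreal t)) * g)) \<partial>lborel)
      + ennexp_neg (Q \<top>) * ennexp (C \<top>) \<le> ennreal v"
proof -
  have "g \<le> ennreal (v * q)" using le by (metis dual_order.trans le_iff_add)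
  then obtain g' where g': "g = ennreal g'" "0 \<le> g'" by (cases g) (auto simp: top_unique)
  have g'q: "q \<le> g'" using gq g' by (simp add: ennreal_le_iff)
  have "ennreal (g' + v * c) \<le> ennreal (v * q)" using le g' qc v by simp
  then have gl: "g' + v * c \<le> v * q" using qc v by (simp add: ennreal_le_iff)
  show ?thesis
  proof (cases "c < q")
    case True
    define l where "l = q - c"
    have l: "0 < l" unfolding l_def using True by simp
    have "(\<integral>\<^sup>+ t. indicator {0<..} t * (ennexp_neg (Q (ennreal t)) * (ennexp (C (ennreal t)) * g)) \<partial>lborel)
        \<le> (\<integral>\<^sup>+ t. ennreal v * (indicator {0<..} t * (ennexp_neg (cumul (\<lambda>_. ennreal l) (ennreal t)) * ennreal l)) \<partial>lborel)"
    proof (rule nn_integral_mono)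
      fix t :: real
      have "ennexp_neg (Q (ennreal t)) * (ennexp (C (ennreal t)) * g) \<le> ennreal v * (ennexp_neg (cumul (\<lambda>_. ennreal l) (ennreal t)) * ennreal l)"
        if t: "0 < t"
      proof -
        have "ennexp_neg (Q (ennreal t)) = ennreal (exp (- (q * t)))" "ennexp (C (ennreal t)) = ennreal (exp (c * t))"
          unfolding Q_def C_def using qc t by (simp_all only: cumul_const less_imp_le ennexp_neg_ennreal ennexp_ennreal mult_nonneg_nonneg)
        then have "ennexp_neg (Q (ennreal t)) * (ennexp (C (ennreal t)) * g) = ennreal (exp (- (q * t)) * exp (c * t) * g')"
          using g' by (simp add: ennreal_mult mult.assoc)
        also have "exp (- (q * t)) * exp (c * t) = exp (- (l * t))"
          unfolding l_def by (simp add: algebra_simps flip: exp_add)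
        also have "ennreal (exp (- (l * t)) * g') \<le> ennreal (exp (- (l * t)) * (v * l))"
          using gl unfolding l_def by (intro ennreal_leI mult_left_mono) (auto simp: algebra_simps)
        also have "\<dots> = ennreal v * (ennreal (exp (- (l * t))) * ennreal l)"
          using l v by (simp add: ennreal_mult ac_simps)
        also have "ennreal (exp (- (l * t))) = ennexp_neg (cumul (\<lambda>_. ennreal l) (ennreal t))"
          using l t by (simp only: cumul_const less_imp_le ennexp_neg_ennreal mult_nonneg_nonneg)
        finally show ?thesis .
      qed
      then show "indicator {0<..} t * (ennexp_neg (Q (ennreal t)) * (ennexp (C (ennreal t)) * g))
        \<le> ennreal v * (indicator {0<..} t * (ennexp_neg (cumul (\<lambda>_. ennreal l) (ennreal t)) * ennreal l))"
        by (simp add: indicator_def)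
    qed
    also have "\<dots> = ennreal v * (\<integral>\<^sup>+ t. indicator {0<..} t * (ennexp_neg (cumul (\<lambda>_. ennreal l) (ennreal t)) * ennreal l) \<partial>lborel)"
      by (rule nn_integral_cmult) measurable
    also have "\<dots> \<le> ennreal v * 1"
    proof (intro mult_left_mono)
      show "(\<integral>\<^sup>+ t. indicator {0<..} t * (ennexp_neg (cumul (\<lambda>_. ennreal l) (ennreal t)) * ennreal l) \<partial>lborel) \<le> 1"
        (is "?I \<le> 1")
      proof -
        have "?I + ennexp_neg (cumul (\<lambda>_. ennreal l) \<top>) = 1"
          by (rule nn_integral_sojourn[where K=l]) (use l in auto)
        then show ?thesis using le_iff_add by metis
      qed
    qed simp
    finally have "(\<integral>\<^sup>+ t. indicator {0<..} t * (ennexp_neg (Q (ennreal t)) * (ennexp (C (ennreal t)) * g)) \<partial>lborel) \<le> ennreal v"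
      by simp
    moreover have "ennexp_neg (Q \<top>) = 0" unfolding Q_def using True qc by (simp add: cumul_const_top ennexp_neg_def)
    ultimately show ?thesis by simp
  next
    case False
    then have "v * q \<le> v * c" using v by simp
    then have "g' = 0" using gl g' by simp
    then have "q = 0" using g'q qc by simp
    then have "v * c \<le> 0" using gl g' by simp
    then have "c = 0" using v qc by (simp add: mult_le_0_iff)
    show ?thesis
      unfolding Q_def C_def using \<open>g' = 0\<close> \<open>q = 0\<close> \<open>c = 0\<close> g' v
      by (simp add: cumul_def)
  qed
qed

section \<open>The jump kernel\<close>

text \<open>A Daniell-type principle: a homogeneous additive functional with monotone convergence is
  integration against the measure it assigns to indicators. \<open>qmix\<close> and
  \<open>jump\<close> are \<open>measure_of\<close> terms, whose values mean nothing before
  countable additivity is known; additivity and the integral formula come out together here.\<close>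

lemma measure_of_functional:
  fixes I :: "('a \<Rightarrow> ennreal) \<Rightarrow> ennreal"
  assumes cong: "\<And>f g. f \<in> borel_measurable M \<Longrightarrow> g \<in> borel_measurable M \<Longrightarrow> (\<And>x. x \<in> space M \<Longrightarrow> f x = g x) \<Longrightarrow> I f = I g"
    and cmult: "\<And>k f. f \<in> borel_measurable M \<Longrightarrow> I (\<lambda>x. k * f x) = k * I f"
    and add: "\<And>f g. f \<in> borel_measurable M \<Longrightarrow> g \<in> borel_measurable M \<Longrightarrow> I (\<lambda>x. f x + g x) = I f + I g"
    and sup: "\<And>U :: nat \<Rightarrow> 'a \<Rightarrow> ennreal. (\<And>i. U i \<in> borel_measurable M) \<Longrightarrow> incseq U \<Longrightarrow> I (\<lambda>x. SUP i. U i x) = (SUP i. I (U i))"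
  defines "N \<equiv> measure_of (space M) (sets M) (\<lambda>B. I (indicator B))"
  shows "sets N = sets M" and "B \<in> sets M \<Longrightarrow> emeasure N B = I (indicator B)"
    and "f \<in> borel_measurable M \<Longrightarrow> (\<integral>\<^sup>+ x. f x \<partial>N) = I f"
proof -
  show sets: "sets N = sets M" unfolding N_def by simp
  have I0: "I (\<lambda>_. 0) = 0" using cmult[of "\<lambda>_. 0" 0] by simp
  have Isum: "I (\<lambda>x. \<Sum>i<n. f i x) = (\<Sum>i<n. I (f i))" if "\<And>i. f i \<in> borel_measurable M" for f :: "nat \<Rightarrow> 'a \<Rightarrow> ennreal" and n
    using that by (induction n) (auto simp: I0 add)
  have em: "emeasure N B = I (indicator B)" if B: "B \<in> sets M" for B
  proof (rule emeasure_measure_of[OF N_def[THEN meta_eq_to_obj_eq]])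
    show "sets M \<subseteq> Pow (space M)" by (rule sets.space_closed)
    show "B \<in> sets N" using B sets by simp
    show "positive (sets N) (\<lambda>B. I (indicator B))"
      unfolding positive_def using cong[of "indicator {}" "\<lambda>_. 0"] I0 by simp
    show "countably_additive (sets N) (\<lambda>B. I (indicator B))"
      unfolding sets
    proof (rule countably_additiveI)
      fix A :: "nat \<Rightarrow> 'a set" assume A: "range A \<subseteq> sets M" "disjoint_family A"
      have Am[measurable]: "A i \<in> sets M" for i using A by auto
      have "(\<Sum>i. I (indicator (A i))) = (SUP n. \<Sum>i<n. I (indicator (A i)))" by (rule suminf_eq_SUP)
      also have "\<dots> = (SUP n. I (\<lambda>x. \<Sum>i<n. indicator (A i) x))" by (subst Isum) auto
      also have "\<dots> = I (\<lambda>x. SUP n. \<Sum>i<n. indicator (A i) x)"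
      proof (rule sup[symmetric])
        show "incseq (\<lambda>n x. \<Sum>i<n. indicator (A i) x :: ennreal)"
          by (auto simp: incseq_def le_fun_def intro!: sum_mono2)
      qed measurable
      also have "(\<lambda>x. SUP n. \<Sum>i<n. indicator (A i) x :: ennreal) = indicator (\<Union>i. A i)"
        using suminf_indicator[OF A(2)] by (auto simp: suminf_eq_SUP[symmetric])
      finally show "(\<Sum>i. I (indicator (A i))) = I (indicator (\<Union>i. A i))" .
    qed
  qed
  show "B \<in> sets M \<Longrightarrow> emeasure N B = I (indicator B)" by (rule em)
  have msets: "g \<in> borel_measurable M \<Longrightarrow> g \<in> borel_measurable N" for g :: "'a \<Rightarrow> ennreal"
    using measurable_cong_sets[OF sets refl] by blast
  have spN: "space N = space M" using sets by (rule sets_eq_imp_space_eq)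
  assume "f \<in> borel_measurable M"
  then show "(\<integral>\<^sup>+ x. f x \<partial>N) = I f"
  proof (induction rule: borel_measurable_induct)
    case (cong f g)
    then show ?case using assms(1)[of f g] spN by (metis nn_integral_cong)
  next
    case (set B)
    then show ?case using em sets by simp
  next
    case (mult u k)
    then show ?case by (subst nn_integral_cmult) (auto simp: cmult msets)
  next
    case (add u v)
    then have uv: "u \<in> borel_measurable M" "v \<in> borel_measurable M" by simp_all
    have "(\<integral>\<^sup>+ x. v x + u x \<partial>N) = (\<integral>\<^sup>+ x. v x \<partial>N) + (\<integral>\<^sup>+ x. u x \<partial>N)"
      by (intro nn_integral_add msets uv)
    also have "(\<integral>\<^sup>+ x. v x \<partial>N) = I v" by fact
    also have "(\<integral>\<^sup>+ x. u x \<partial>N) = I u" by fact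
    also have "I v + I u = I (\<lambda>x. v x + u x)" by (rule assms(3)[OF uv(2,1), symmetric])
    finally show ?case .
  next
    case (seq U)
    have "(\<integral>\<^sup>+ x. (SUP i. U i) x \<partial>N) = (\<integral>\<^sup>+ x. (SUP i. U i x) \<partial>N)" by (simp add: image_comp)
    also have "\<dots> = (SUP i. \<integral>\<^sup>+ x. U i x \<partial>N)"
      by (rule nn_integral_monotone_convergence_SUP[OF \<open>incseq U\<close> msets[OF seq(1)]])
    also have "\<dots> = (SUP i. I (U i))" using seq.IH by simp
    also have "\<dots> = I (\<lambda>x. SUP i. U i x)" by (rule sup[OF seq(1) \<open>incseq U\<close>, symmetric])
    finally show ?case by (simp add: image_comp SUP_apply[abs_def])
  qed
qed

lemma space_Sinf: "space (Sinf S) = insert None (Some ` S)"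
  and Sinf_None: "{None} \<in> sets (Sinf S)"
  and Sinf_Some: "B \<in> sets (restrict_space borel S) \<Longrightarrow> Some ` B \<in> sets (Sinf S)"
proof -
  have "insert {None} ((\<lambda>B. Some ` B) ` sets (restrict_space borel S)) \<subseteq> Pow (insert None (Some ` S))"
    using sets.sets_into_space[of _ "restrict_space borel S"] by (force simp: space_restrict_space)
  then show "space (Sinf S) = insert None (Some ` S)" "{None} \<in> sets (Sinf S)"
    "B \<in> sets (restrict_space borel S) \<Longrightarrow> Some ` B \<in> sets (Sinf S)"
    unfolding Sinf_def by (auto simp: space_measure_of_conv sets_measure_of)
qed

lemma measurable_Some_Sinf[measurable]: "Some \<in> restrict_space borel S \<rightarrow>\<^sub>M Sinf S"
  unfolding Sinf_def
proof (rule measurable_measure_of)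
  show "insert {None} ((\<lambda>B. Some ` B) ` sets (restrict_space borel S)) \<subseteq> Pow (insert None (Some ` S))"
    using sets.sets_into_space[of _ "restrict_space borel S"] by (force simp: space_restrict_space)
  fix B assume B: "B \<in> insert {None} ((\<lambda>B. Some ` B) ` sets (restrict_space borel S))"
  then consider "B = {None}" | C where "B = Some ` C" "C \<in> sets (restrict_space borel S)" by blast
  then show "Some -` B \<inter> space (restrict_space borel S) \<in> sets (restrict_space borel S)"
  proof cases
    case 2
    then have "Some -` B \<inter> space (restrict_space borel S) = C" using sets.sets_into_space by fastforce
    then show ?thesis using 2 by simp
  qed (simp add: vimage_def)
qed (auto simp: space_restrict_space)

lemma measurable_from_Sinf:
  assumes "(\<lambda>x. f (Some x)) \<in> restrict_space borel S \<rightarrow>\<^sub>M N" "f None \<in> space N"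
  shows "f \<in> Sinf S \<rightarrow>\<^sub>M N"
proof (rule measurableI)
  fix x assume "x \<in> space (Sinf S)"
  then show "f x \<in> space N"
    using assms measurable_space[OF assms(1)] unfolding space_Sinf by (auto simp: space_restrict_space)
next
  fix B assume "B \<in> sets N"
  then have "(\<lambda>x. f (Some x)) -` B \<inter> space (restrict_space borel S) \<in> sets (restrict_space borel S)"
    using assms(1) by (rule measurable_sets[rotated])
  then have "Some ` ((\<lambda>x. f (Some x)) -` B \<inter> S) \<in> sets (Sinf S)"
    by (intro Sinf_Some) (simp add: space_restrict_space)
  moreover have "(if f None \<in> B then {None} else {}) \<in> sets (Sinf S)" by (simp add: Sinf_None)
  ultimately have "Some ` ((\<lambda>x. f (Some x)) -` B \<inter> S) \<union> (if f None \<in> B then {None} else {}) \<in> sets (Sinf S)"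
    by (rule sets.Un)
  moreover have "f -` B \<inter> space (Sinf S) = Some ` ((\<lambda>x. f (Some x)) -` B \<inter> S) \<union> (if f None \<in> B then {None} else {})"
    unfolding space_Sinf by (auto split: if_splits)
  ultimately show "f -` B \<inter> space (Sinf S) \<in> sets (Sinf S)" by simp
qed

section \<open>The controlled model and its kernels\<close>

locale ctmdp_model =
  fixes S :: "'s::polish_space set" and A :: "'b::polish_space set"
    and qt :: "'s \<Rightarrow> 'b \<Rightarrow> 's measure" and c :: "'s \<Rightarrow> 'b \<Rightarrow> real"
  assumes model: "ctmdp S A qt c" and cbar: "\<And>x. x \<in> S \<Longrightarrow> bdd_above ((\<lambda>a. c x a) ` A)"
begin

abbreviation "BS \<equiv> restrict_space borel S"
abbreviation "BA \<equiv> restrict_space borel A"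
abbreviation "q \<equiv> qrate S qt"

lemma S_borel: "S \<in> sets borel" and S_ne: "S \<noteq> {}" and A_borel: "A \<in> sets borel" and A_ne: "A \<noteq> {}"
  using model unfolding ctmdp_def by blast+

lemma space_BS[simp]: "space BS = S" and space_BA[simp]: "space BA = A"
  by (simp_all add: space_restrict_space)

lemma sets_qt: "x \<in> S \<Longrightarrow> a \<in> A \<Longrightarrow> sets (qt x a) = sets BS"
  using model unfolding ctmdp_def by blast

lemma space_qt: "x \<in> S \<Longrightarrow> a \<in> A \<Longrightarrow> space (qt x a) = S"
  using sets_eq_imp_space_eq[OF sets_qt] by simp

lemma measurable_qt_cong: "x \<in> S \<Longrightarrow> a \<in> A \<Longrightarrow> f \<in> measurable (qt x a) N \<longleftrightarrow> f \<in> measurable BS N"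
  using measurable_cong_sets[OF sets_qt refl] by blast

lemma c_nonneg: "x \<in> S \<Longrightarrow> a \<in> A \<Longrightarrow> 0 \<le> c x a"
  using model unfolding ctmdp_def by blast

lemma q_nonneg[simp]: "0 \<le> q x a" unfolding qrate_def by simp

lemma c_measurable[measurable]: "(\<lambda>(x, a). c x a) \<in> borel_measurable (BS \<Otimes>\<^sub>M BA)"
  using model unfolding ctmdp_def by blast

text \<open>One constant for rate and cost at x, as the one-jump bound demands; the bound on the
  mass also shows that \<open>measure\<close> loses nothing against \<open>emeasure\<close>.\<close>

lemma rate_bound: "x \<in> S \<Longrightarrow> \<exists>K. \<forall>a\<in>A. emeasure (qt x a) S \<le> ennreal K \<and> q x a \<le> K \<and> c x a \<le> K"
proof -
  assume x: "x \<in> S"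
  then have "(SUP a\<in>A. emeasure (qt x a) S) < \<top>" using model unfolding ctmdp_def by blast
  then obtain K where K: "(SUP a\<in>A. emeasure (qt x a) S) = ennreal K" "0 \<le> K" by (cases "SUP a\<in>A. emeasure (qt x a) S") auto
  obtain K' where K': "\<And>a. a \<in> A \<Longrightarrow> c x a \<le> K'" using cbar[OF x] unfolding bdd_above_def by auto
  have "emeasure (qt x a) S \<le> ennreal K" if "a \<in> A" for a using K SUP_upper[OF that, of "\<lambda>a. emeasure (qt x a) S"] by simp
  then have *: "emeasure (qt x a) S \<le> ennreal (max K K')" if "a \<in> A" for a
    using that by (meson ennreal_leI max.cobounded1 order_trans)
  have "q x a \<le> max K K'" if "a \<in> A" for a
    unfolding qrate_def measure_def using *[OF that] K(2) by (simp add: enn2real_leI)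
  then show ?thesis using * K' by (intro exI[of _ "max K K'"]) (auto intro: max.coboundedI2)
qed

lemma emeasure_qt: "x \<in> S \<Longrightarrow> a \<in> A \<Longrightarrow> emeasure (qt x a) S = ennreal (q x a)"
  using rate_bound[of x] unfolding qrate_def measure_def
  by (metis ennreal_enn2real ennreal_less_top order_le_less_trans)

lemma q_measurable[measurable]: "(\<lambda>(x, a). q x a) \<in> borel_measurable (BS \<Otimes>\<^sub>M BA)"
proof -
  have "S \<in> sets BS" by (metis sets.top space_BS)
  then have [measurable]: "(\<lambda>(x, a). emeasure (qt x a) S) \<in> borel_measurable (BS \<Otimes>\<^sub>M BA)"
    using model unfolding ctmdp_def by blast
  have "(\<lambda>p. enn2real ((\<lambda>(x, a). emeasure (qt x a) S) p)) \<in> borel_measurable (BS \<Otimes>\<^sub>M BA)" by measurable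
  then show ?thesis unfolding qrate_def measure_def by (simp add: split_beta')
qed

text \<open>Normalised by \<open>max 1 q\<close>, the rates become a sub-stochastic kernel to which the library applies.\<close>

definition nkernel :: "'s \<times> 'b \<Rightarrow> 's measure" where
  "nkernel p = scale_measure (ennreal (1 / max 1 (q (fst p) (snd p)))) (qt (fst p) (snd p))"

lemma nkernel_measurable: "nkernel \<in> BS \<Otimes>\<^sub>M BA \<rightarrow>\<^sub>M subprob_algebra BS"
proof (rule measurable_subprob_algebra)
  fix p assume "p \<in> space (BS \<Otimes>\<^sub>M BA)"
  then have p: "fst p \<in> S" "snd p \<in> A" by (auto simp: space_pair_measure)
  show "sets (nkernel p) = sets BS" unfolding nkernel_def using sets_qt[OF p] by simp
  show "subprob_space (nkernel p)"
  proof (rule subprob_spaceI)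
    have "1 / max 1 (q (fst p) (snd p)) * q (fst p) (snd p) \<le> 1" by (simp add: divide_le_eq)
    then show "emeasure (nkernel p) (space (nkernel p)) \<le> 1"
      unfolding nkernel_def space_scale_measure using p
      by (simp add: space_qt emeasure_qt ennreal_mult[symmetric] ennreal_le_1)
    show "space (nkernel p) \<noteq> {}" unfolding nkernel_def space_scale_measure using p S_ne by (simp add: space_qt)
  qed
next
  fix B assume "B \<in> sets BS"
  then have [measurable]: "(\<lambda>(x, a). emeasure (qt x a) B) \<in> borel_measurable (BS \<Otimes>\<^sub>M BA)"
    using model unfolding ctmdp_def by blast
  have "(\<lambda>p. ennreal (1 / max 1 ((\<lambda>(x, a). q x a) p)) * (\<lambda>(x, a). emeasure (qt x a) B) p) \<in> borel_measurable (BS \<Otimes>\<^sub>M BA)"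
    by measurable
  then show "(\<lambda>p. emeasure (nkernel p) B) \<in> borel_measurable (BS \<Otimes>\<^sub>M BA)"
    unfolding nkernel_def by (simp add: split_beta')
qed

lemma nn_integral_qt_nkernel:
  assumes "x \<in> S" "a \<in> A" "f \<in> borel_measurable BS"
  shows "(\<integral>\<^sup>+ y. f y \<partial>qt x a) = ennreal (max 1 (q x a)) * (\<integral>\<^sup>+ y. f y \<partial>nkernel (x, a))"
proof -
  have "(\<integral>\<^sup>+ y. f y \<partial>nkernel (x, a)) = ennreal (1 / max 1 (q x a)) * (\<integral>\<^sup>+ y. f y \<partial>qt x a)"
    unfolding nkernel_def using assms by (simp add: nn_integral_scale_measure measurable_qt_cong)
  moreover have "ennreal (max 1 (q x a)) * ennreal (1 / max 1 (q x a)) = 1"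
    by (subst ennreal_mult[symmetric]) auto
  ultimately show ?thesis by (simp add: mult.assoc[symmetric])
qed

lemma nn_integral_qt_measurable:
  assumes f: "(\<lambda>(w, y). f w y) \<in> borel_measurable (N \<Otimes>\<^sub>M BS)"
    and u: "u \<in> N \<rightarrow>\<^sub>M BS" and v: "v \<in> N \<rightarrow>\<^sub>M BA"
  shows "(\<lambda>w. \<integral>\<^sup>+ y. f w y \<partial>qt (u w) (v w)) \<in> borel_measurable N"
proof -
  note [measurable] = u v f
  have "(\<lambda>w. nkernel (u w, v w)) \<in> N \<rightarrow>\<^sub>M subprob_algebra BS"
    by (rule measurable_compose[OF _ nkernel_measurable]) measurable
  then have [measurable]: "(\<lambda>w. \<integral>\<^sup>+ y. f w y \<partial>nkernel (u w, v w)) \<in> borel_measurable N"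
    by (rule nn_integral_measurable_subprob_algebra2[OF f])
  have [measurable]: "(\<lambda>w. q (u w) (v w)) \<in> borel_measurable N"
    using measurable_compose[OF measurable_Pair[OF u v] q_measurable] by simp
  have "(\<lambda>w. ennreal (max 1 (q (u w) (v w))) * (\<integral>\<^sup>+ y. f w y \<partial>nkernel (u w, v w))) \<in> borel_measurable N"
    by measurable
  moreover have "(\<integral>\<^sup>+ y. f w y \<partial>qt (u w) (v w)) = ennreal (max 1 (q (u w) (v w))) * (\<integral>\<^sup>+ y. f w y \<partial>nkernel (u w, v w))"
    if "w \<in> space N" for w
    using measurable_space[OF u that] measurable_space[OF v that] measurable_Pair2[OF f that]
    by (intro nn_integral_qt_nkernel) auto
  ultimately show ?thesis using measurable_cong by (metis (no_types, lifting))
qed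

abbreviation "hist n \<equiv> PiM {0..<Suc n} (\<lambda>_. Mst S)"

lemma space_Mst: "space (Mst S) = UNIV \<times> insert None (Some ` S)"
  unfolding Mst_def by (simp add: space_pair_measure space_Sinf)

lemma nn_integral_qt_action_measurable:
  assumes f: "f \<in> borel_measurable BS" and x: "x \<in> S"
  shows "(\<lambda>a. \<integral>\<^sup>+ y. f y \<partial>qt x a) \<in> borel_measurable BA"
proof -
  have "(\<lambda>(w, y). f y) \<in> borel_measurable (BA \<Otimes>\<^sub>M BS)" using f by measurable
  then show ?thesis by (rule nn_integral_qt_measurable) (use x in auto)
qed

lemma q_action_measurable: "x \<in> S \<Longrightarrow> q x \<in> borel_measurable BA"
  using measurable_Pair2[OF q_measurable, of x] by simp

lemma c_action_measurable: "x \<in> S \<Longrightarrow> c x \<in> borel_measurable BA"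
  using measurable_Pair2[OF c_measurable, of x] by simp

end

locale ctmdp_policy = ctmdp_model S A qt c
  for S :: "'s::polish_space set" and A :: "'b::polish_space set"
    and qt :: "'s \<Rightarrow> 'b \<Rightarrow> 's measure" and c :: "'s \<Rightarrow> 'b \<Rightarrow> real" +
  fixes pol :: "('s, 'b) policy"
  assumes policy: "is_policy S A pol"
begin

lemma pol_measurable: "(\<lambda>(h, s). pol n h s) \<in> hist n \<Otimes>\<^sub>M borel \<rightarrow>\<^sub>M prob_algebra BA"
  using policy unfolding is_policy_def by blast

lemma pol_space: "h \<in> space (hist n) \<Longrightarrow> sets (pol n h s) = sets BA \<and> prob_space (pol n h s)"
  using measurable_space[OF pol_measurable, of "(h, s)" n] by (simp add: space_pair_measure space_prob_algebra)

lemma space_pol: "h \<in> space (hist n) \<Longrightarrow> space (pol n h s) = A"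
  using pol_space[of h n s] sets_eq_imp_space_eq[of "pol n h s" BA] by simp

lemma measurable_pol_cong: "h \<in> space (hist n) \<Longrightarrow> f \<in> measurable (pol n h s) N \<longleftrightarrow> f \<in> measurable BA N"
  using pol_space[of h n s] measurable_cong_sets[of "pol n h s" BA N N] by blast

lemma nn_integral_pol_measurable:
  assumes f: "(\<lambda>(w, a). f w a) \<in> borel_measurable (N \<Otimes>\<^sub>M BA)"
    and u: "u \<in> N \<rightarrow>\<^sub>M hist n" and v: "v \<in> N \<rightarrow>\<^sub>M borel"
  shows "(\<lambda>w. \<integral>\<^sup>+ a. f w a \<partial>pol n (u w) (v w)) \<in> borel_measurable N"
proof (rule nn_integral_measurable_subprob_algebra2[OF f])
  have "(\<lambda>w. (u w, v w)) \<in> N \<rightarrow>\<^sub>M hist n \<Otimes>\<^sub>M borel" using u v by measurable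
  from measurable_compose[OF this measurable_prob_algebraD[OF pol_measurable]]
  show "(\<lambda>w. pol n (u w) (v w)) \<in> N \<rightarrow>\<^sub>M subprob_algebra BA" by simp
qed

text \<open>With r = q this is the jump rate under the randomised action at time s, with r = c the
  running cost.\<close>

definition mix :: "('s \<Rightarrow> 'b \<Rightarrow> real) \<Rightarrow> nat \<Rightarrow> (nat \<Rightarrow> ennreal \<times> 's option) \<Rightarrow> 's \<Rightarrow> real \<Rightarrow> ennreal" where
  "mix r n h z s = (\<integral>\<^sup>+ a. ennreal (r z a) \<partial>pol n h s)"

lemma mix_measurable:
  assumes [measurable]: "(\<lambda>(x, a). r x a) \<in> borel_measurable (BS \<Otimes>\<^sub>M BA)"
  shows "(\<lambda>((h, z), s). mix r n h z s) \<in> borel_measurable ((hist n \<Otimes>\<^sub>M BS) \<Otimes>\<^sub>M borel)"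
proof -
  have "(\<lambda>(w, a). ennreal (r (snd (fst w)) a)) \<in> borel_measurable (((hist n \<Otimes>\<^sub>M BS) \<Otimes>\<^sub>M (borel :: real measure)) \<Otimes>\<^sub>M BA)"
  proof -
    have "(\<lambda>p. (snd (fst (fst p)), snd p)) \<in> ((hist n \<Otimes>\<^sub>M BS) \<Otimes>\<^sub>M (borel :: real measure)) \<Otimes>\<^sub>M BA \<rightarrow>\<^sub>M BS \<Otimes>\<^sub>M BA" by measurable
    from measurable_compose[OF this assms] show ?thesis by (simp add: split_beta')
  qed
  then have "(\<lambda>w. \<integral>\<^sup>+ a. ennreal (r (snd (fst w)) a) \<partial>pol n (fst (fst w)) (snd w)) \<in> borel_measurable ((hist n \<Otimes>\<^sub>M BS) \<Otimes>\<^sub>M borel)"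
    by (rule nn_integral_pol_measurable) measurable
  then show ?thesis unfolding mix_def by (simp add: split_beta')
qed

lemma mix_time_measurable:
  assumes "(\<lambda>(x, a). r x a) \<in> borel_measurable (BS \<Otimes>\<^sub>M BA)" "h \<in> space (hist n)" "z \<in> S"
  shows "mix r n h z \<in> borel_measurable borel"
  using measurable_Pair2[OF mix_measurable[OF assms(1)], of "(h, z)" n] assms by (simp add: space_pair_measure)

lemma cumul_mix_measurable:
  assumes "(\<lambda>(x, a). r x a) \<in> borel_measurable (BS \<Otimes>\<^sub>M BA)"
  shows "(\<lambda>((h, z), t). cumul (mix r n h z) t) \<in> borel_measurable ((hist n \<Otimes>\<^sub>M BS) \<Otimes>\<^sub>M borel)"
proof -
  have "(\<lambda>p. (fst (fst p), snd p)) \<in> ((hist n \<Otimes>\<^sub>M BS) \<Otimes>\<^sub>M (borel :: ennreal measure)) \<Otimes>\<^sub>M lborel \<rightarrow>\<^sub>M (hist n \<Otimes>\<^sub>M BS) \<Otimes>\<^sub>M borel" by measurable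
  from measurable_compose[OF this mix_measurable[OF assms]]
  have [measurable]: "(\<lambda>(w, s). mix r n (fst (fst w)) (snd (fst w)) s) \<in> borel_measurable (((hist n \<Otimes>\<^sub>M BS) \<Otimes>\<^sub>M (borel :: ennreal measure)) \<Otimes>\<^sub>M lborel)"
    by (simp add: split_beta')
  have "(\<lambda>w. \<integral>\<^sup>+ s. indicator {s. 0 < s \<and> ennreal s < snd w} s * mix r n (fst (fst w)) (snd (fst w)) s \<partial>lborel) \<in> borel_measurable ((hist n \<Otimes>\<^sub>M BS) \<Otimes>\<^sub>M borel)"
    by measurable
  then show ?thesis unfolding cumul_def by (simp add: split_beta')
qed

text \<open>The one-jump bounds speak of bounded real functions of time; averaging over a
  probability measure keeps the range [0, K], so the extended mixture has such a
  representative.\<close>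

lemma mix_real:
  assumes "(\<lambda>(x, a). r x a) \<in> borel_measurable (BS \<Otimes>\<^sub>M BA)" and h: "h \<in> space (hist n)" and z: "z \<in> S"
    and r: "\<And>a. a \<in> A \<Longrightarrow> 0 \<le> r z a" "\<And>a. a \<in> A \<Longrightarrow> r z a \<le> K"
  shows "\<exists>f\<in>borel_measurable borel. (\<forall>s. 0 \<le> f s \<and> f s \<le> K) \<and> mix r n h z = (\<lambda>s. ennreal (f s))"
proof (intro bexI conjI allI ext)
  have K: "0 \<le> K" using r A_ne by force
  have le: "mix r n h z s \<le> ennreal K" for s
  proof -
    interpret prob_space "pol n h s" using pol_space[OF h] by blast
    have "mix r n h z s \<le> (\<integral>\<^sup>+ a. ennreal K \<partial>pol n h s)"
      unfolding mix_def using r by (intro nn_integral_mono ennreal_leI) (simp add: space_pol[OF h])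
    also have "\<dots> = ennreal K" by (simp add: emeasure_space_1)
    finally show ?thesis .
  qed
  show "(\<lambda>s. enn2real (mix r n h z s)) \<in> borel_measurable borel"
    using mix_time_measurable[OF assms(1) h z] by measurable
  show "0 \<le> enn2real (mix r n h z s)" for s by simp
  show "enn2real (mix r n h z s) \<le> K" for s using le[of s] K by (simp add: enn2real_leI)
  show "mix r n h z s = ennreal (enn2real (mix r n h z s))" for s
    using le[of s] by (metis ennreal_enn2real ennreal_less_top order_le_less_trans)
qed

text \<open>The integral of F against the law of the next sojourn time and state, written out before
  that law is known to be a measure; \<open>nn_integral_jump\<close> identifies the two.\<close>

definition jint :: "nat \<Rightarrow> (nat \<Rightarrow> ennreal \<times> 's option) \<Rightarrow> 's \<Rightarrow> (ennreal \<times> 's option \<Rightarrow> ennreal) \<Rightarrow> ennreal" where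
  "jint n h z F = (\<integral>\<^sup>+ t. indicator {0<..} t * (ennexp_neg (cumul (mix q n h z) (ennreal t)) *
       (\<integral>\<^sup>+ a. \<integral>\<^sup>+ y. F (ennreal t, Some y) \<partial>qt z a \<partial>pol n h t)) \<partial>lborel)
     + ennexp_neg (cumul (mix q n h z) \<top>) * F (\<top>, None)"

lemma jump_integrand_measurable:
  assumes F: "(\<lambda>(w, p). F w p) \<in> borel_measurable ((hist n \<Otimes>\<^sub>M BS) \<Otimes>\<^sub>M Mst S)"
  shows "(\<lambda>(w, t). \<integral>\<^sup>+ a. \<integral>\<^sup>+ y. F w (ennreal t, Some y) \<partial>qt (snd w) a \<partial>pol n (fst w) t)
    \<in> borel_measurable ((hist n \<Otimes>\<^sub>M BS) \<Otimes>\<^sub>M borel)"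
proof -
  let ?W = "(hist n \<Otimes>\<^sub>M BS) \<Otimes>\<^sub>M (borel :: real measure)"
  have "(\<lambda>p. (fst (fst (fst p)), (ennreal (snd (fst (fst p))), Some (snd p)))) \<in> (?W \<Otimes>\<^sub>M BA) \<Otimes>\<^sub>M BS \<rightarrow>\<^sub>M (hist n \<Otimes>\<^sub>M BS) \<Otimes>\<^sub>M Mst S"
    unfolding Mst_def by measurable
  from measurable_compose[OF this F]
  have "(\<lambda>(p, y). F (fst (fst p)) (ennreal (snd (fst p)), Some y)) \<in> borel_measurable ((?W \<Otimes>\<^sub>M BA) \<Otimes>\<^sub>M BS)"
    by (simp add: split_beta')
  then have "(\<lambda>p. \<integral>\<^sup>+ y. F (fst (fst p)) (ennreal (snd (fst p)), Some y) \<partial>qt (snd (fst (fst p))) (snd p)) \<in> borel_measurable (?W \<Otimes>\<^sub>M BA)"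
    by (rule nn_integral_qt_measurable) measurable
  then have "(\<lambda>(w, a). \<integral>\<^sup>+ y. F (fst w) (ennreal (snd w), Some y) \<partial>qt (snd (fst w)) a) \<in> borel_measurable (?W \<Otimes>\<^sub>M BA)"
    by (simp add: split_beta')
  then have "(\<lambda>w. \<integral>\<^sup>+ a. \<integral>\<^sup>+ y. F (fst w) (ennreal (snd w), Some y) \<partial>qt (snd (fst w)) a \<partial>pol n (fst (fst w)) (snd w)) \<in> borel_measurable ?W"
    by (rule nn_integral_pol_measurable) measurable
  then show ?thesis by (simp add: split_beta')
qed

lemma jint_measurable:
  assumes F: "(\<lambda>(w, p). F w p) \<in> borel_measurable ((hist n \<Otimes>\<^sub>M BS) \<Otimes>\<^sub>M Mst S)"
  shows "(\<lambda>w. jint n (fst w) (snd w) (F w)) \<in> borel_measurable (hist n \<Otimes>\<^sub>M BS)"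
proof -
  let ?W = "hist n \<Otimes>\<^sub>M BS"
  have [measurable]: "(\<lambda>(w, t). \<integral>\<^sup>+ a. \<integral>\<^sup>+ y. F w (ennreal t, Some y) \<partial>qt (snd w) a \<partial>pol n (fst w) t)
    \<in> borel_measurable (?W \<Otimes>\<^sub>M lborel)"
    using jump_integrand_measurable[OF F] by simp
  have "(\<lambda>p. (fst p, ennreal (snd p))) \<in> ?W \<Otimes>\<^sub>M lborel \<rightarrow>\<^sub>M ?W \<Otimes>\<^sub>M borel" by measurable
  from measurable_compose[OF this cumul_mix_measurable[OF q_measurable]]
  have [measurable]: "(\<lambda>(w, t). cumul (mix q n (fst w) (snd w)) (ennreal t)) \<in> borel_measurable (?W \<Otimes>\<^sub>M lborel)"
    by (simp add: split_beta')
  have "(\<lambda>p. (p, \<top>)) \<in> ?W \<rightarrow>\<^sub>M ?W \<Otimes>\<^sub>M (borel :: ennreal measure)" by measurable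
  from measurable_compose[OF this cumul_mix_measurable[OF q_measurable]]
  have [measurable]: "(\<lambda>w. cumul (mix q n (fst w) (snd w)) \<top>) \<in> borel_measurable ?W"
    by (simp add: split_beta')
  have "(\<lambda>p. (p, (\<top>, None))) \<in> ?W \<rightarrow>\<^sub>M ?W \<Otimes>\<^sub>M Mst S"
    by (intro measurable_Pair measurable_ident_sets measurable_const refl) (simp add: space_Mst)
  from measurable_compose[OF this F]
  have [measurable]: "(\<lambda>w. F w (\<top>, None)) \<in> borel_measurable ?W" by simp
  show ?thesis unfolding jint_def by measurable
qed

section \<open>Integration against the jump law\<close>

context
  fixes n h z
  assumes h: "h \<in> space (hist n)" and z: "z \<in> S"
begin

lemma fixed_state_measurable:
  assumes [measurable]: "F \<in> borel_measurable (Mst S)"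
  shows "(\<lambda>(w, p). F p) \<in> borel_measurable ((hist n \<Otimes>\<^sub>M BS) \<Otimes>\<^sub>M Mst S)"
  by measurable

lemma jump_slice_measurable:
  assumes F: "F \<in> borel_measurable (Mst S)"
  shows "(\<lambda>y. F (t, Some y)) \<in> borel_measurable BS"
proof -
  have "(\<lambda>y. (t, Some y)) \<in> BS \<rightarrow>\<^sub>M Mst S" unfolding Mst_def by measurable
  from measurable_compose[OF this F] show ?thesis .
qed

lemma jump_inner_measurable[measurable]:
  assumes F: "F \<in> borel_measurable (Mst S)"
  shows "(\<lambda>t. \<integral>\<^sup>+ a. \<integral>\<^sup>+ y. F (ennreal t, Some y) \<partial>qt z a \<partial>pol n h t) \<in> borel_measurable borel"
  using measurable_Pair2[OF jump_integrand_measurable[OF fixed_state_measurable[OF F]], of "(h, z)"] h z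
  by (simp add: space_pair_measure)

lemma jump_weight_measurable[measurable]: "cumul (mix q n h z) \<in> borel_measurable borel"
  by (rule measurable_cumul[OF mix_time_measurable[OF q_measurable h z]])

text \<open>Additivity, homogeneity and monotone convergence of the nested integral are the
  hypotheses of \<open>measure_of_functional\<close>; they serve \<open>qmix\<close> directly and
  \<open>jump\<close> through the corresponding properties of \<open>jint\<close>.\<close>

lemma mix_inner_add:
  assumes f: "f \<in> borel_measurable BS" and g: "g \<in> borel_measurable BS"
  shows "(\<integral>\<^sup>+ a. \<integral>\<^sup>+ y. f y + g y \<partial>qt z a \<partial>pol n h t) = (\<integral>\<^sup>+ a. \<integral>\<^sup>+ y. f y \<partial>qt z a \<partial>pol n h t) + (\<integral>\<^sup>+ a. \<integral>\<^sup>+ y. g y \<partial>qt z a \<partial>pol n h t)"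
proof -
  have "(\<integral>\<^sup>+ a. \<integral>\<^sup>+ y. f y + g y \<partial>qt z a \<partial>pol n h t) = (\<integral>\<^sup>+ a. (\<integral>\<^sup>+ y. f y \<partial>qt z a) + (\<integral>\<^sup>+ y. g y \<partial>qt z a) \<partial>pol n h t)"
    using f g z by (intro nn_integral_cong nn_integral_add) (auto simp: space_pol[OF h] measurable_qt_cong)
  also have "\<dots> = (\<integral>\<^sup>+ a. \<integral>\<^sup>+ y. f y \<partial>qt z a \<partial>pol n h t) + (\<integral>\<^sup>+ a. \<integral>\<^sup>+ y. g y \<partial>qt z a \<partial>pol n h t)"
    by (intro nn_integral_add) (simp_all add: measurable_pol_cong[OF h] nn_integral_qt_action_measurable f g z)
  finally show ?thesis .
qed

lemma mix_inner_cmult: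
  assumes f: "f \<in> borel_measurable BS"
  shows "(\<integral>\<^sup>+ a. \<integral>\<^sup>+ y. k * f y \<partial>qt z a \<partial>pol n h t) = k * (\<integral>\<^sup>+ a. \<integral>\<^sup>+ y. f y \<partial>qt z a \<partial>pol n h t)"
proof -
  have "(\<integral>\<^sup>+ a. \<integral>\<^sup>+ y. k * f y \<partial>qt z a \<partial>pol n h t) = (\<integral>\<^sup>+ a. k * (\<integral>\<^sup>+ y. f y \<partial>qt z a) \<partial>pol n h t)"
    using f z by (intro nn_integral_cong nn_integral_cmult) (auto simp: space_pol[OF h] measurable_qt_cong)
  also have "\<dots> = k * (\<integral>\<^sup>+ a. \<integral>\<^sup>+ y. f y \<partial>qt z a \<partial>pol n h t)"
    by (intro nn_integral_cmult) (simp add: measurable_pol_cong[OF h] nn_integral_qt_action_measurable f z)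
  finally show ?thesis .
qed

lemma mix_inner_SUP:
  fixes U :: "nat \<Rightarrow> 's \<Rightarrow> ennreal"
  assumes U: "\<And>i. U i \<in> borel_measurable BS" and inc: "incseq U"
  shows "(\<integral>\<^sup>+ a. \<integral>\<^sup>+ y. (SUP i. U i y) \<partial>qt z a \<partial>pol n h t) = (SUP i. \<integral>\<^sup>+ a. \<integral>\<^sup>+ y. U i y \<partial>qt z a \<partial>pol n h t)"
proof -
  have "(\<integral>\<^sup>+ a. \<integral>\<^sup>+ y. (SUP i. U i y) \<partial>qt z a \<partial>pol n h t) = (\<integral>\<^sup>+ a. (SUP i. \<integral>\<^sup>+ y. U i y \<partial>qt z a) \<partial>pol n h t)"
    using U z inc by (intro nn_integral_cong nn_integral_monotone_convergence_SUP) (auto simp: space_pol[OF h] measurable_qt_cong)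
  also have "\<dots> = (SUP i. \<integral>\<^sup>+ a. \<integral>\<^sup>+ y. U i y \<partial>qt z a \<partial>pol n h t)"
    using inc by (intro nn_integral_monotone_convergence_SUP)
      (auto simp: measurable_pol_cong[OF h] nn_integral_qt_action_measurable U z incseq_def le_fun_def intro!: nn_integral_mono)
  finally show ?thesis .
qed

lemma mix_inner_cong:
  assumes "\<And>y. y \<in> S \<Longrightarrow> f y = g y"
  shows "(\<integral>\<^sup>+ a. \<integral>\<^sup>+ y. f y \<partial>qt z a \<partial>pol n h t) = (\<integral>\<^sup>+ a. \<integral>\<^sup>+ y. g y \<partial>qt z a \<partial>pol n h t)"
  using assms z by (intro nn_integral_cong) (auto simp: space_pol[OF h] space_qt)

lemma emeasure_qmix:
  assumes B: "B \<in> sets BS"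
  shows "emeasure (qmix S qt z (pol n h t)) B = (\<integral>\<^sup>+ a. \<integral>\<^sup>+ y. indicator B y \<partial>qt z a \<partial>pol n h t)"
proof -
  have "qmix S qt z (pol n h t) = measure_of (space BS) (sets BS) (\<lambda>B. \<integral>\<^sup>+ a. \<integral>\<^sup>+ y. indicator B y \<partial>qt z a \<partial>pol n h t)"
    unfolding qmix_def space_BS
  proof (rule measure_of_eq)
    show "sets BS \<subseteq> Pow S" using sets.space_closed[of BS] by simp
    fix B assume "B \<in> sigma_sets S (sets BS)"
    then have "B \<in> sets BS" using sets.sigma_sets_eq[of BS] by simp
    then show "(\<integral>\<^sup>+ a. emeasure (qt z a) B \<partial>pol n h t) = (\<integral>\<^sup>+ a. \<integral>\<^sup>+ y. indicator B y \<partial>qt z a \<partial>pol n h t)"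
      using z by (intro nn_integral_cong) (simp add: space_pol[OF h] sets_qt)
  qed
  also have "emeasure \<dots> B = (\<integral>\<^sup>+ a. \<integral>\<^sup>+ y. indicator B y \<partial>qt z a \<partial>pol n h t)"
  proof (rule measure_of_functional(2)[where I="\<lambda>f. \<integral>\<^sup>+ a. \<integral>\<^sup>+ y. f y \<partial>qt z a \<partial>pol n h t"])
    fix f g :: "'s \<Rightarrow> ennreal" assume "\<And>x. x \<in> space BS \<Longrightarrow> f x = g x"
    then show "(\<integral>\<^sup>+ a. \<integral>\<^sup>+ y. f y \<partial>qt z a \<partial>pol n h t) = (\<integral>\<^sup>+ a. \<integral>\<^sup>+ y. g y \<partial>qt z a \<partial>pol n h t)"
      by (intro mix_inner_cong) simp
  qed (rule mix_inner_add mix_inner_cmult mix_inner_SUP B; assumption)+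
  finally show ?thesis .
qed

lemma jint_add:
  assumes F: "F \<in> borel_measurable (Mst S)" and G: "G \<in> borel_measurable (Mst S)"
  shows "jint n h z (\<lambda>p. F p + G p) = jint n h z F + jint n h z G"
proof -
  note [measurable] = F G
  show ?thesis
    unfolding jint_def mix_inner_add[OF jump_slice_measurable[OF F] jump_slice_measurable[OF G]] distrib_left
    by (subst nn_integral_add) (auto simp: ac_simps)
qed

lemma jint_cmult:
  assumes F: "F \<in> borel_measurable (Mst S)"
  shows "jint n h z (\<lambda>p. k * F p) = k * jint n h z F"
proof -
  note [measurable] = F
  have "jint n h z (\<lambda>p. k * F p) = (\<integral>\<^sup>+ t. k * (indicator {0<..} t * (ennexp_neg (cumul (mix q n h z) (ennreal t)) *
       (\<integral>\<^sup>+ a. \<integral>\<^sup>+ y. F (ennreal t, Some y) \<partial>qt z a \<partial>pol n h t))) \<partial>lborel)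
     + k * (ennexp_neg (cumul (mix q n h z) \<top>) * F (\<top>, None))"
    unfolding jint_def mix_inner_cmult[OF jump_slice_measurable[OF F]] by (simp add: ac_simps)
  also have "\<dots> = k * jint n h z F"
    unfolding jint_def distrib_left by (subst nn_integral_cmult) auto
  finally show ?thesis .
qed

lemma jint_SUP:
  fixes U :: "nat \<Rightarrow> ennreal \<times> 's option \<Rightarrow> ennreal"
  assumes U: "\<And>i. U i \<in> borel_measurable (Mst S)" and inc: "incseq U"
  shows "jint n h z (\<lambda>p. SUP i. U i p) = (SUP i. jint n h z (U i))"
proof -
  note [measurable] = U
  have inc': "incseq (\<lambda>i y. U i (t, Some y))" for t
    using inc by (auto simp: incseq_def le_fun_def)
  have incI: "incseq (\<lambda>i. \<integral>\<^sup>+ a. \<integral>\<^sup>+ y. U i (ennreal t, Some y) \<partial>qt z a \<partial>pol n h t)" for t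
    using inc by (auto simp: incseq_def le_fun_def intro!: nn_integral_mono)
  have "jint n h z (\<lambda>p. SUP i. U i p) = (\<integral>\<^sup>+ t. (SUP i. indicator {0<..} t * (ennexp_neg (cumul (mix q n h z) (ennreal t)) *
       (\<integral>\<^sup>+ a. \<integral>\<^sup>+ y. U i (ennreal t, Some y) \<partial>qt z a \<partial>pol n h t))) \<partial>lborel)
     + (SUP i. ennexp_neg (cumul (mix q n h z) \<top>) * U i (\<top>, None))"
    unfolding jint_def mix_inner_SUP[OF jump_slice_measurable[OF U] inc'] by (simp add: SUP_mult_left_ennreal)
  also have "\<dots> = (SUP i. \<integral>\<^sup>+ t. indicator {0<..} t * (ennexp_neg (cumul (mix q n h z) (ennreal t)) *
       (\<integral>\<^sup>+ a. \<integral>\<^sup>+ y. U i (ennreal t, Some y) \<partial>qt z a \<partial>pol n h t)) \<partial>lborel)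
     + (SUP i. ennexp_neg (cumul (mix q n h z) \<top>) * U i (\<top>, None))"
  proof (subst nn_integral_monotone_convergence_SUP)
    show "incseq (\<lambda>i t. indicator {0<..} t * (ennexp_neg (cumul (mix q n h z) (ennreal t)) *
       (\<integral>\<^sup>+ a. \<integral>\<^sup>+ y. U i (ennreal t, Some y) \<partial>qt z a \<partial>pol n h t)))"
      unfolding incseq_def le_fun_def by (intro allI impI mult_left_mono incseqD[OF incI]) auto
  qed auto
  also have "\<dots> = (SUP i. jint n h z (U i))"
    unfolding jint_def
  proof (rule ennreal_SUP_add[symmetric])
    show "incseq (\<lambda>i. \<integral>\<^sup>+ t. indicator {0<..} t * (ennexp_neg (cumul (mix q n h z) (ennreal t)) *
       (\<integral>\<^sup>+ a. \<integral>\<^sup>+ y. U i (ennreal t, Some y) \<partial>qt z a \<partial>pol n h t)) \<partial>lborel)"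
      unfolding incseq_def by (intro allI impI nn_integral_mono mult_left_mono incseqD[OF incI]) auto
    show "incseq (\<lambda>i. ennexp_neg (cumul (mix q n h z) \<top>) * U i (\<top>, None))"
      using inc by (auto simp: incseq_def le_fun_def intro!: mult_left_mono)
  qed
  finally show ?thesis .
qed

lemma jint_cong:
  assumes "\<And>p. p \<in> space (Mst S) \<Longrightarrow> F p = G p"
  shows "jint n h z F = jint n h z G"
proof -
  have "(\<integral>\<^sup>+ a. \<integral>\<^sup>+ y. F (ennreal t, Some y) \<partial>qt z a \<partial>pol n h t) = (\<integral>\<^sup>+ a. \<integral>\<^sup>+ y. G (ennreal t, Some y) \<partial>qt z a \<partial>pol n h t)" for t
    by (rule mix_inner_cong) (use assms in \<open>simp add: space_Mst\<close>)
  moreover have "F (\<top>, None) = G (\<top>, None)" using assms by (simp add: space_Mst)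
  ultimately show ?thesis unfolding jint_def by simp
qed

lemma jump_eq_measure_of:
  "jump S qt pol n h z = measure_of (space (Mst S)) (sets (Mst S)) (\<lambda>B. jint n h z (indicator B))"
  unfolding jump_def
proof (rule measure_of_eq)
  show "sets (Mst S) \<subseteq> Pow (space (Mst S))" by (rule sets.space_closed)
  fix B assume "B \<in> sigma_sets (space (Mst S)) (sets (Mst S))"
  then have B[measurable]: "B \<in> sets (Mst S)" using sets.sigma_sets_eq[of "Mst S"] by simp
  have "emeasure (qmix S qt z (pol n h t)) {y\<in>S. (ennreal t, Some y) \<in> B} = (\<integral>\<^sup>+ a. \<integral>\<^sup>+ y. indicator B (ennreal t, Some y) \<partial>qt z a \<partial>pol n h t)" for t
  proof -
    have "(\<lambda>y. (ennreal t, Some y)) \<in> BS \<rightarrow>\<^sub>M Mst S" unfolding Mst_def by measurable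
    from measurable_sets[OF this B] have "{y\<in>S. (ennreal t, Some y) \<in> B} \<in> sets BS"
      by (simp add: vimage_def Int_def conj_commute)
    then show ?thesis
      by (subst emeasure_qmix) (auto intro!: mix_inner_cong simp: indicator_def)
  qed
  then show "(\<integral>\<^sup>+ t. indicator {0<..} t * ennexp_neg (Lam S qt pol n h z (ennreal t)) *
            emeasure (qmix S qt z (pol n h t)) {y \<in> S. (ennreal t, Some y) \<in> B} \<partial>lborel) +
         ennexp_neg (Lam S qt pol n h z \<top>) * indicator B (\<top>, None) = jint n h z (indicator B)"
    unfolding jint_def by (simp add: Lam_def cumul_def mix_def mult.assoc)
qed

lemma sets_jump: "sets (jump S qt pol n h z) = sets (Mst S)"
  unfolding jump_eq_measure_of by simp

lemma nn_integral_jump: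
  assumes "F \<in> borel_measurable (Mst S)"
  shows "(\<integral>\<^sup>+ p. F p \<partial>jump S qt pol n h z) = jint n h z F"
  unfolding jump_eq_measure_of
  by (rule measure_of_functional(3)[where I="jint n h z"])
    (use assms in \<open>simp_all add: jint_cmult jint_add jint_SUP cong: jint_cong\<close>)

lemma emeasure_jump:
  assumes "B \<in> sets (Mst S)"
  shows "emeasure (jump S qt pol n h z) B = jint n h z (indicator B)"
  using nn_integral_jump[of "indicator B"] assms sets_jump by simp

text \<open>Integrating 1 over the state after the jump leaves the mixed jump rate, so the total
  mass is that of the sojourn law.\<close>

lemma prob_space_jump: "prob_space (jump S qt pol n h z)"
proof (rule prob_spaceI)
  have sp: "space (jump S qt pol n h z) = space (Mst S)" by (rule sets_eq_imp_space_eq[OF sets_jump])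
  obtain K where K: "\<And>a. a \<in> A \<Longrightarrow> q z a \<le> K" using rate_bound[OF z] by blast
  obtain f where f: "f \<in> borel_measurable borel" "\<And>s. 0 \<le> f s" "\<And>s. f s \<le> K" "mix q n h z = (\<lambda>s. ennreal (f s))"
    using mix_real[OF q_measurable h z _ K] by auto
  have "emeasure (jump S qt pol n h z) (space (jump S qt pol n h z)) = jint n h z (\<lambda>_. 1)"
    unfolding sp by (subst emeasure_jump) (auto intro: jint_cong)
  also have "\<dots> = (\<integral>\<^sup>+ t. indicator {0<..} t * (ennexp_neg (cumul (mix q n h z) (ennreal t)) * mix q n h z t) \<partial>lborel) + ennexp_neg (cumul (mix q n h z) \<top>)"
  proof -
    have "(\<integral>\<^sup>+ a. \<integral>\<^sup>+ y. 1 \<partial>qt z a \<partial>pol n h t) = mix q n h z t" for t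
      unfolding mix_def using z by (intro nn_integral_cong) (simp add: space_pol[OF h] space_qt emeasure_qt)
    then show ?thesis unfolding jint_def by simp
  qed
  also have "\<dots> = 1" unfolding f(4) by (rule nn_integral_sojourn[OF f(1-3)])
  finally show "emeasure (jump S qt pol n h z) (space (jump S qt pol n h z)) = 1" .
qed

end

lemma jump_measurable: "(\<lambda>w. jump S qt pol n (fst w) (snd w)) \<in> hist n \<Otimes>\<^sub>M BS \<rightarrow>\<^sub>M subprob_algebra (Mst S)"
proof (rule measurable_subprob_algebra)
  fix w assume "w \<in> space (hist n \<Otimes>\<^sub>M BS)"
  then have w: "fst w \<in> space (hist n)" "snd w \<in> S" by (auto simp: space_pair_measure)
  show "subprob_space (jump S qt pol n (fst w) (snd w))"
    using prob_space_jump[OF w] by (rule prob_space_imp_subprob_space)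
  show "sets (jump S qt pol n (fst w) (snd w)) = sets (Mst S)" by (rule sets_jump[OF w])
next
  fix B assume B[measurable]: "B \<in> sets (Mst S)"
  have "(\<lambda>(w, p). indicator B p) \<in> borel_measurable ((hist n \<Otimes>\<^sub>M BS) \<Otimes>\<^sub>M Mst S)" by measurable
  then have "(\<lambda>w. jint n (fst w) (snd w) (indicator B)) \<in> borel_measurable (hist n \<Otimes>\<^sub>M BS)"
    by (rule jint_measurable)
  then show "(\<lambda>w. emeasure (jump S qt pol n (fst w) (snd w)) B) \<in> borel_measurable (hist n \<Otimes>\<^sub>M BS)"
    by (subst measurable_cong[where g="\<lambda>w. jint n (fst w) (snd w) (indicator B)"])
      (auto simp: space_pair_measure emeasure_jump)
qed

end

section \<open>The path measure\<close>

context ctmdp_policy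
begin

definition stage :: "nat \<Rightarrow> (nat \<Rightarrow> ennreal \<times> 's option) \<Rightarrow> ennreal \<times> 's option \<Rightarrow> ennreal" where
  "stage n h p = (case snd (h n) of None \<Rightarrow> 0 | Some z \<Rightarrow> cumul (mix c n h z) (fst p))"

definition cost_upto :: "nat \<Rightarrow> (nat \<Rightarrow> ennreal \<times> 's option) \<Rightarrow> ennreal" where
  "cost_upto k \<omega> = (\<Sum>i<k. stage i (restrict \<omega> {0..<Suc i}) (\<omega> (Suc i)))"

lemma pathcost_eq: "pathcost c pol \<omega> = (\<Sum>i. stage i (restrict \<omega> {0..<Suc i}) (\<omega> (Suc i)))"
  unfolding pathcost_def stage_def cumul_def mix_def by (intro suminf_cong) (simp split: option.split)

text \<open>A default state stands in for the cemetery so that kernels indexed by S compose with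
  histories; each use masks it by a test for \<open>None\<close>.\<close>

definition state_of :: "'s \<Rightarrow> 's option \<Rightarrow> 's" where
  "state_of x o' = (case o' of None \<Rightarrow> x | Some z \<Rightarrow> z)"

lemma state_of_measurable: "x \<in> S \<Longrightarrow> state_of x \<in> Sinf S \<rightarrow>\<^sub>M BS"
  by (rule measurable_from_Sinf) (auto simp: state_of_def)

lemma hist_state:
  fixes m n :: nat
  assumes "m < n"
  shows "(\<lambda>h. snd (h m)) \<in> PiM {0..<n} (\<lambda>_. Mst S) \<rightarrow>\<^sub>M Sinf S"
proof -
  have 1: "(\<lambda>h. h m) \<in> PiM {0..<n} (\<lambda>_. Mst S) \<rightarrow>\<^sub>M Mst S"
    using assms by (intro measurable_component_singleton) simp
  have 2: "snd \<in> Mst S \<rightarrow>\<^sub>M Sinf S" unfolding Mst_def by measurable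
  show ?thesis by (rule measurable_compose[OF 1 2])
qed

lemma hist_dead: "(m::nat) < n \<Longrightarrow> Measurable.pred (PiM {0..<n} (\<lambda>_. Mst S)) (\<lambda>h. snd (h m) = None)"
  using measurable_sets[OF hist_state Sinf_None] unfolding pred_def vimage_def
  by (simp add: Int_def conj_commute)

lemma hist_state_cases:
  assumes "h \<in> space (hist n)"
  obtains "snd (h n) = None" | z where "snd (h n) = Some z" "z \<in> S"
  using measurable_space[OF hist_state, of n "Suc n" h] assms unfolding space_Sinf by auto

lemma stage_measurable: "(\<lambda>(h, p). stage n h p) \<in> borel_measurable (hist n \<Otimes>\<^sub>M Mst S)"
proof -
  obtain x where x: "x \<in> S" using S_ne by blast
  note [measurable] = hist_state[of n "Suc n"] state_of_measurable[OF x] hist_dead[of n "Suc n"]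
  have [measurable]: "fst \<in> Mst S \<rightarrow>\<^sub>M borel" unfolding Mst_def by measurable
  have "(\<lambda>w. ((fst w, state_of x (snd (fst w n))), fst (snd w))) \<in> hist n \<Otimes>\<^sub>M Mst S \<rightarrow>\<^sub>M (hist n \<Otimes>\<^sub>M BS) \<Otimes>\<^sub>M borel"
    by measurable
  from measurable_compose[OF this cumul_mix_measurable[OF c_measurable]]
  have [measurable]: "(\<lambda>w. cumul (mix c n (fst w) (state_of x (snd (fst w n)))) (fst (snd w))) \<in> borel_measurable (hist n \<Otimes>\<^sub>M Mst S)"
    by (simp add: split_beta')
  have "(\<lambda>w. if snd (fst w n) = None then 0 else cumul (mix c n (fst w) (state_of x (snd (fst w n)))) (fst (snd w))) \<in> borel_measurable (hist n \<Otimes>\<^sub>M Mst S)"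
    by measurable
  moreover have "(\<lambda>w. if snd (fst w n) = None then 0 else cumul (mix c n (fst w) (state_of x (snd (fst w n)))) (fst (snd w))) = (\<lambda>(h, p). stage n h p)"
    by (auto simp: stage_def state_of_def fun_eq_iff split: option.split)
  ultimately show ?thesis by simp
qed

lemma cost_upto_measurable:
  assumes "{0..<Suc k} \<subseteq> J"
  shows "cost_upto k \<in> borel_measurable (PiM J (\<lambda>_. Mst S))"
  unfolding cost_upto_def
proof (rule borel_measurable_sum)
  fix i assume i: "i \<in> {..<k}"
  have "(\<lambda>\<omega>. (restrict \<omega> {0..<Suc i}, \<omega> (Suc i))) \<in> PiM J (\<lambda>_. Mst S) \<rightarrow>\<^sub>M hist i \<Otimes>\<^sub>M Mst S"
    using assms i by (intro measurable_Pair measurable_restrict_subset measurable_component_singleton) auto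
  from measurable_compose[OF this stage_measurable]
  show "(\<lambda>\<omega>. stage i (restrict \<omega> {0..<Suc i}) (\<omega> (Suc i))) \<in> borel_measurable (PiM J (\<lambda>_. Mst S))" by simp
qed

lemma restrict_hist: "h \<in> space (PiM J (\<lambda>_. Mst S)) \<Longrightarrow> restrict h J = h"
  by (auto simp: space_PiM PiE_def extensional_restrict)

lemma trans_Suc:
  assumes "h \<in> space (hist m)"
  shows "trans S qt pol x (Suc m) h = (case snd (h m) of Some z \<Rightarrow> jump S qt pol m h z | None \<Rightarrow> return (Mst S) (\<top>, None))"
  unfolding trans_def by (auto simp: restrict_hist[OF assms] split: option.split)

lemma top_None_Mst: "(\<top>, None) \<in> space (Mst S)"
  by (simp add: space_Mst)

lemma Ionescu_Tulcea_trans: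
  assumes x: "x \<in> S"
  shows "Ionescu_Tulcea (trans S qt pol x) (\<lambda>_. Mst S)"
proof (rule Ionescu_Tulcea.intro)
  show "trans S qt pol x i \<in> PiM {0..<i} (\<lambda>_. Mst S) \<rightarrow>\<^sub>M subprob_algebra (Mst S)" for i
  proof (cases i)
    case 0
    have "(\<lambda>_. (0, Some x)) \<in> PiM {0..<i} (\<lambda>_. Mst S) \<rightarrow>\<^sub>M Mst S" using x by (simp add: space_Mst)
    from measurable_compose[OF this return_measurable] show ?thesis unfolding trans_def 0 by simp
  next
    case (Suc m)
    note [measurable] = hist_state[of m "Suc m"] state_of_measurable[OF x] hist_dead[of m "Suc m"]
    have "(\<lambda>h. (h, state_of x (snd (h m)))) \<in> hist m \<rightarrow>\<^sub>M hist m \<Otimes>\<^sub>M BS" by measurable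
    from measurable_compose[OF this jump_measurable]
    have [measurable]: "(\<lambda>h. jump S qt pol m h (state_of x (snd (h m)))) \<in> hist m \<rightarrow>\<^sub>M subprob_algebra (Mst S)" by simp
    have [measurable]: "(\<lambda>h. return (Mst S) (\<top>, None)) \<in> hist m \<rightarrow>\<^sub>M subprob_algebra (Mst S)"
      using measurable_compose[OF measurable_const[OF top_None_Mst] return_measurable] .
    have "(\<lambda>h. if snd (h m) = None then return (Mst S) (\<top>, None) else jump S qt pol m h (state_of x (snd (h m)))) \<in> hist m \<rightarrow>\<^sub>M subprob_algebra (Mst S)"
      by measurable
    then show ?thesis
      unfolding Suc by (rule measurable_cong[THEN iffD1, rotated]) (auto simp: trans_Suc state_of_def split: option.split)
  qed
  show "prob_space (trans S qt pol x i h)" if h: "h \<in> space (PiM {0..<i} (\<lambda>_. Mst S))" for i h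
  proof (cases i)
    case 0
    then show ?thesis unfolding trans_def using x by (auto intro!: prob_space_return simp: space_Mst)
  next
    case (Suc m)
    then have hm: "h \<in> space (hist m)" using h by simp
    show ?thesis
      using hm unfolding Suc trans_Suc[OF hm]
      by (cases rule: hist_state_cases) (auto intro!: prob_space_return prob_space_jump[OF hm] top_None_Mst)
  qed
qed


text \<open>Conditional expectation, given the history up to jump k, of the cost factor of the next
  sojourn times W at the next state. In the cemetery no cost is charged and the state stays
  there.\<close>

definition next_value :: "nat \<Rightarrow> (nat \<Rightarrow> ennreal \<times> 's option) \<Rightarrow> ('s option \<Rightarrow> ennreal) \<Rightarrow> ennreal" where
  "next_value k h W = (case snd (h k) of None \<Rightarrow> W None
     | Some z \<Rightarrow> jint k h z (\<lambda>p. ennexp (stage k h p) * W (snd p)))"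

context
  fixes x assumes x: "x \<in> S"
begin

interpretation IT: Ionescu_Tulcea "trans S qt pol x" "\<lambda>_. Mst S"
  by (rule Ionescu_Tulcea_trans[OF x])

text \<open>Value from x of the cost charged up to jump k with terminal value W. The law is a finite
  composition of kernels, whose last coordinate can be integrated out; it has \<open>Suc k\<close>
  coordinates because coordinate 0 holds the initial state.\<close>

definition Ek :: "nat \<Rightarrow> ('s option \<Rightarrow> ennreal) \<Rightarrow> ennreal" where
  "Ek k W = (\<integral>\<^sup>+ \<omega>. ennexp (cost_upto k \<omega>) * W (snd (\<omega> k)) \<partial>IT.C 0 (Suc k) (\<lambda>_. undefined))"

lemma undef_space: "(\<lambda>_. undefined) \<in> space (PiM {0..<0::nat} (\<lambda>_. Mst S))"
  by (simp add: space_PiM PiE_def extensional_def)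

lemma space_C0: "space (IT.C 0 k (\<lambda>_. undefined)) = space (PiM {0..<k} (\<lambda>_. Mst S))"
  using IT.space_C[OF undef_space, of k] by simp

lemma sets_C0: "sets (IT.C 0 k (\<lambda>_. undefined)) = sets (PiM {0..<k} (\<lambda>_. Mst S))"
  using IT.sets_C[OF undef_space, of k] by simp

lemma nn_integral_C_Suc:
  assumes F: "F \<in> borel_measurable (PiM {0..<Suc k} (\<lambda>_. Mst S))"
  shows "(\<integral>\<^sup>+ \<omega>. F \<omega> \<partial>IT.C 0 (Suc k) (\<lambda>_. undefined)) =
    (\<integral>\<^sup>+ \<omega>. \<integral>\<^sup>+ p. F (fun_upd \<omega> k p) \<partial>trans S qt pol x k \<omega> \<partial>IT.C 0 k (\<lambda>_. undefined))"
proof -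
  have "(\<integral>\<^sup>+ \<omega>. F \<omega> \<partial>IT.C 0 (Suc k) (\<lambda>_. undefined)) = (\<integral>\<^sup>+ \<omega>. \<integral>\<^sup>+ \<omega>'. F \<omega>' \<partial>IT.eP k \<omega> \<partial>IT.C 0 k (\<lambda>_. undefined))"
    using F IT.measurable_eP[of k] by (simp add: nn_integral_bind[where B="PiM {0..<Suc k} (\<lambda>_. Mst S)"] measurable_cong_sets[OF sets_C0 refl])
  also have "\<dots> = (\<integral>\<^sup>+ \<omega>. \<integral>\<^sup>+ p. F (fun_upd \<omega> k p) \<partial>trans S qt pol x k \<omega> \<partial>IT.C 0 k (\<lambda>_. undefined))"
    by (intro nn_integral_cong IT.nn_integral_eP F) (simp add: space_C0)
  finally show ?thesis .
qed

lemma terminal_measurable: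
  assumes W: "W \<in> borel_measurable (Sinf S)"
  shows "(\<lambda>\<omega>. ennexp (cost_upto k \<omega>) * W (snd (\<omega> k))) \<in> borel_measurable (PiM {0..<Suc k} (\<lambda>_. Mst S))"
proof -
  note [measurable] = cost_upto_measurable[OF order_refl, of k] measurable_compose[OF hist_state[of k "Suc k"] W]
  show ?thesis by measurable
qed

lemma Ek_0:
  assumes W: "W \<in> borel_measurable (Sinf S)"
  shows "Ek 0 W = W (Some x)"
proof -
  have "Ek 0 W = (\<integral>\<^sup>+ \<omega>. \<integral>\<^sup>+ p. ennexp (cost_upto 0 (fun_upd \<omega> 0 p)) * W (snd ((fun_upd \<omega> 0 p) 0)) \<partial>trans S qt pol x 0 \<omega> \<partial>IT.C 0 0 (\<lambda>_. undefined))"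
    unfolding Ek_def by (rule nn_integral_C_Suc[OF terminal_measurable[OF W]])
  also have "\<dots> = (\<integral>\<^sup>+ \<omega>. W (Some x) \<partial>IT.C 0 0 (\<lambda>_. undefined))"
  proof (rule nn_integral_cong)
    fix \<omega>
    have "(\<lambda>p. W (snd p)) \<in> borel_measurable (Mst S)" unfolding Mst_def using W by measurable
    then show "(\<integral>\<^sup>+ p. ennexp (cost_upto 0 (fun_upd \<omega> 0 p)) * W (snd ((fun_upd \<omega> 0 p) 0)) \<partial>trans S qt pol x 0 \<omega>) = W (Some x)"
      unfolding trans_def using x by (simp add: cost_upto_def nn_integral_return space_Mst)
  qed
  also have "\<dots> = W (Some x)"
    using prob_space.emeasure_space_1[OF IT.prob_space_C[OF undef_space, of 0]] by simp
  finally show ?thesis .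
qed

text \<open>Costs add, so their exponentials multiply: the past cost is a constant factor when the
  last transition is integrated out.\<close>

lemma Ek_Suc:
  assumes W: "W \<in> borel_measurable (Sinf S)"
  shows "Ek (Suc k) W = (\<integral>\<^sup>+ \<omega>. ennexp (cost_upto k \<omega>) * next_value k \<omega> W \<partial>IT.C 0 (Suc k) (\<lambda>_. undefined))"
proof -
  have "Ek (Suc k) W = (\<integral>\<^sup>+ \<omega>. \<integral>\<^sup>+ p. ennexp (cost_upto (Suc k) (fun_upd \<omega> (Suc k) p)) * W (snd ((fun_upd \<omega> (Suc k) p) (Suc k))) \<partial>trans S qt pol x (Suc k) \<omega> \<partial>IT.C 0 (Suc k) (\<lambda>_. undefined))"
    unfolding Ek_def by (rule nn_integral_C_Suc[OF terminal_measurable[OF W]])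
  also have "\<dots> = (\<integral>\<^sup>+ \<omega>. ennexp (cost_upto k \<omega>) * next_value k \<omega> W \<partial>IT.C 0 (Suc k) (\<lambda>_. undefined))"
  proof (rule nn_integral_cong)
    fix \<omega> assume "\<omega> \<in> space (IT.C 0 (Suc k) (\<lambda>_. undefined))"
    then have h: "\<omega> \<in> space (hist k)" unfolding space_C0 .
    have cost: "cost_upto (Suc k) (fun_upd \<omega> (Suc k) p) = cost_upto k \<omega> + stage k \<omega> p" for p
    proof -
      have "restrict (fun_upd \<omega> (Suc k) p) {0..<Suc i} = restrict \<omega> {0..<Suc i}" if "i \<le> k" for i
        using that by (auto simp: restrict_def)
      moreover have "restrict \<omega> {0..<Suc k} = \<omega>" by (rule restrict_hist[OF h])
      ultimately show ?thesis unfolding cost_upto_def by (simp add: less_Suc_eq_le)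
    qed
    have st: "stage k \<omega> \<in> borel_measurable (Mst S)"
      using measurable_Pair2[OF stage_measurable h] by simp
    have Wm: "(\<lambda>p. W (snd p)) \<in> borel_measurable (Mst S)" unfolding Mst_def using W by measurable
    note [measurable] = st Wm
    have tm: "f \<in> borel_measurable (trans S qt pol x (Suc k) \<omega>)" if "f \<in> borel_measurable (Mst S)" for f :: "_ \<Rightarrow> ennreal"
      using that measurable_cong_sets[OF IT.sets_P[of \<omega> "Suc k"] refl] h by blast
    have "(\<integral>\<^sup>+ p. ennexp (cost_upto (Suc k) (fun_upd \<omega> (Suc k) p)) * W (snd ((fun_upd \<omega> (Suc k) p) (Suc k))) \<partial>trans S qt pol x (Suc k) \<omega>)
        = (\<integral>\<^sup>+ p. ennexp (cost_upto k \<omega>) * (ennexp (stage k \<omega> p) * W (snd p)) \<partial>trans S qt pol x (Suc k) \<omega>)"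
      unfolding cost ennexp_add by (simp add: mult.assoc)
    also have "\<dots> = ennexp (cost_upto k \<omega>) * (\<integral>\<^sup>+ p. ennexp (stage k \<omega> p) * W (snd p) \<partial>trans S qt pol x (Suc k) \<omega>)"
      by (rule nn_integral_cmult, rule tm) measurable
    also have "(\<integral>\<^sup>+ p. ennexp (stage k \<omega> p) * W (snd p) \<partial>trans S qt pol x (Suc k) \<omega>) = next_value k \<omega> W"
      using h
    proof (cases rule: hist_state_cases)
      case 1
      have "(\<integral>\<^sup>+ p. ennexp (stage k \<omega> p) * W (snd p) \<partial>return (Mst S) (\<top>, None)) = ennexp (stage k \<omega> (\<top>, None)) * W None"
        by (subst nn_integral_return) (auto simp: top_None_Mst)
      then show ?thesis unfolding trans_Suc[OF h] next_value_def using 1 by (simp add: stage_def)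
    next
      case (2 z)
      then show ?thesis unfolding trans_Suc[OF h] next_value_def
        by (simp add: nn_integral_jump[OF h])
    qed
    finally show "(\<integral>\<^sup>+ p. ennexp (cost_upto (Suc k) (fun_upd \<omega> (Suc k) p)) * W (snd ((fun_upd \<omega> (Suc k) p) (Suc k))) \<partial>trans S qt pol x (Suc k) \<omega>)
        = ennexp (cost_upto k \<omega>) * next_value k \<omega> W" .
  qed
  finally show ?thesis .
qed

text \<open>Dynamic programming: a comparison of \<open>next_value\<close> with a function of the
  current state, history by history, moves the terminal value from one jump to the next. This
  direction bounds policies from below, its mirror image bounds the selected policy from
  above.\<close>

lemma Ek_Suc_ge:
  assumes W: "W \<in> borel_measurable (Sinf S)"
    and "\<And>h. h \<in> space (hist k) \<Longrightarrow> W' (snd (h k)) \<le> next_value k h W"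
  shows "Ek k W' \<le> Ek (Suc k) W"
  unfolding Ek_Suc[OF W] unfolding Ek_def
  using assms(2) by (intro nn_integral_mono mult_left_mono) (auto simp: space_C0 simp del: IT.C.simps)

lemma Ek_Suc_le:
  assumes W: "W \<in> borel_measurable (Sinf S)"
    and "\<And>h. h \<in> space (hist k) \<Longrightarrow> next_value k h W \<le> W' (snd (h k))"
  shows "Ek (Suc k) W \<le> Ek k W'"
  unfolding Ek_Suc[OF W] unfolding Ek_def
  using assms(2) by (intro nn_integral_mono mult_left_mono) (auto simp: space_C0 simp del: IT.C.simps)

lemma Ek_mono:
  assumes "\<And>s. s \<in> space (Sinf S) \<Longrightarrow> W s \<le> W' s"
  shows "Ek k W \<le> Ek k W'"
  unfolding Ek_def
  using assms measurable_space[OF hist_state, of k "Suc k"]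
  by (intro nn_integral_mono mult_left_mono) (auto simp: space_C0 simp del: IT.C.simps)

text \<open>The cost up to jump k depends on coordinates 0 to k only, so the projective limit may be
  replaced by its marginal.\<close>

lemma nn_integral_Pth_cost: "(\<integral>\<^sup>+ \<omega>. ennexp (cost_upto k \<omega>) \<partial>Pth S qt pol x) = Ek k (\<lambda>_. 1)"
proof -
  let ?J = "{0..<Suc k}"
  have up: "IT.up_to ?J = Suc k"
  proof (rule antisym)
    show "IT.up_to ?J \<le> Suc k" by (subst IT.up_to_iff_Ico) auto
    show "Suc k \<le> IT.up_to ?J" using IT.up_to_less[of ?J k] by simp
  qed
  have cm: "cost_upto k \<in> borel_measurable (PiM ?J (\<lambda>_. Mst S))" by (rule cost_upto_measurable) simp
  note [measurable] = cm
  have restr: "cost_upto k (restrict \<omega> ?J) = cost_upto k \<omega>" for \<omega>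
  proof -
    have "restrict (restrict \<omega> ?J) {0..<Suc i} = restrict \<omega> {0..<Suc i}" if "i < k" for i
      using that by (auto simp: restrict_def)
    then show ?thesis unfolding cost_upto_def by (auto intro!: sum.cong)
  qed
  have P: "Pth S qt pol x = IT.PF.lim" unfolding Pth_def ..
  have rm: "(\<lambda>\<omega>. restrict \<omega> ?J) \<in> IT.PF.lim \<rightarrow>\<^sub>M PiM ?J (\<lambda>_. Mst S)"
    using measurable_restrict_subset[of ?J UNIV "\<lambda>_. Mst S"] measurable_cong_sets[OF IT.PF.sets_lim refl] by blast
  have rm': "(\<lambda>\<omega>. restrict \<omega> ?J) \<in> IT.C 0 (Suc k) (\<lambda>_. undefined) \<rightarrow>\<^sub>M PiM ?J (\<lambda>_. Mst S)"
    using measurable_restrict_subset[of ?J ?J "\<lambda>_. Mst S"] measurable_cong_sets[OF sets_C0 refl] by blast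
  have "(\<integral>\<^sup>+ \<omega>. ennexp (cost_upto k \<omega>) \<partial>Pth S qt pol x) = (\<integral>\<^sup>+ \<omega>. ennexp (cost_upto k (restrict \<omega> ?J)) \<partial>IT.PF.lim)"
    unfolding P restr ..
  also have "\<dots> = (\<integral>\<^sup>+ \<omega>. ennexp (cost_upto k \<omega>) \<partial>distr IT.PF.lim (PiM ?J (\<lambda>_. Mst S)) (\<lambda>\<omega>. restrict \<omega> ?J))"
    by (rule nn_integral_distr[OF rm, symmetric]) measurable
  also have "distr IT.PF.lim (PiM ?J (\<lambda>_. Mst S)) (\<lambda>\<omega>. restrict \<omega> ?J) = IT.CI ?J"
    by (rule IT.distr_lim) simp
  also have "IT.CI ?J = distr (IT.C 0 (Suc k) (\<lambda>_. undefined)) (PiM ?J (\<lambda>_. Mst S)) (\<lambda>\<omega>. restrict \<omega> ?J)"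
    unfolding IT.CI_def up ..
  also have "(\<integral>\<^sup>+ \<omega>. ennexp (cost_upto k \<omega>) \<partial>\<dots>) = (\<integral>\<^sup>+ \<omega>. ennexp (cost_upto k (restrict \<omega> ?J)) \<partial>IT.C 0 (Suc k) (\<lambda>_. undefined))"
    by (rule nn_integral_distr[OF rm']) measurable
  also have "\<dots> = Ek k (\<lambda>_. 1)" unfolding Ek_def restr by simp
  finally show ?thesis .
qed

text \<open>Costs are nonnegative: the costs up to jump k increase to the path cost, and monotone
  convergence passes this through the exponential and the expectation.\<close>

lemma Vcrit_eq_SUP: "Vcrit S qt c pol x = (SUP k. Ek k (\<lambda>_. 1))"
proof -
  have cm: "cost_upto k \<in> borel_measurable (Pth S qt pol x)" for k
    using cost_upto_measurable[of k UNIV] measurable_cong_sets[OF IT.PF.sets_lim refl]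
    unfolding Pth_def by blast
  note [measurable] = cm
  have inc: "incseq (\<lambda>k. cost_upto k \<omega>)" for \<omega>
    unfolding cost_upto_def by (rule incseq_SucI) simp
  have "ennexp (pathcost c pol \<omega>) = (SUP k. ennexp (cost_upto k \<omega>))" for \<omega>
    unfolding pathcost_eq suminf_eq_SUP using ennexp_SUP[OF inc] unfolding cost_upto_def .
  then have "Vcrit S qt c pol x = (\<integral>\<^sup>+ \<omega>. (SUP k. ennexp (cost_upto k \<omega>)) \<partial>Pth S qt pol x)"
    unfolding Vcrit_def by simp
  also have "\<dots> = (SUP k. \<integral>\<^sup>+ \<omega>. ennexp (cost_upto k \<omega>) \<partial>Pth S qt pol x)"
  proof (rule nn_integral_monotone_convergence_SUP)
    show "incseq (\<lambda>k \<omega>. ennexp (cost_upto k \<omega>))"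
      unfolding incseq_def le_fun_def by (intro allI impI ennexp_mono incseqD[OF inc])
  qed measurable
  finally show ?thesis unfolding nn_integral_Pth_cost .
qed

end

section \<open>One transition compared with the one-jump problem\<close>

lemma next_value_Some:
  assumes h: "h \<in> space (hist k)" and hz: "snd (h k) = Some z" "z \<in> S"
    and W: "(\<lambda>y. W (Some y)) \<in> borel_measurable BS" "W None = 1"
  shows "next_value k h W = (\<integral>\<^sup>+ t. indicator {0<..} t * (ennexp_neg (cumul (mix q k h z) (ennreal t)) *
      (ennexp (cumul (mix c k h z) (ennreal t)) * (\<integral>\<^sup>+ a. \<integral>\<^sup>+ y. W (Some y) \<partial>qt z a \<partial>pol k h t))) \<partial>lborel)
    + ennexp_neg (cumul (mix q k h z) \<top>) * ennexp (cumul (mix c k h z) \<top>)"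
proof -
  have "next_value k h W = jint k h z (\<lambda>p. ennexp (cumul (mix c k h z) (fst p)) * W (snd p))"
    unfolding next_value_def stage_def using hz by simp
  then show ?thesis unfolding jint_def fst_conv snd_conv mix_inner_cmult[OF h hz(2) W(1)] W(2) by simp
qed

text \<open>The hypothesis \<open>le\<close> is affine in the rate, the cost and the integral of W,
  so averaging it over the randomised action at time t yields the same inequality for the mixed
  quantities; that is the hypothesis \<open>Gv\<close> of the one-jump bound.\<close>

lemma next_value_lower:
  assumes h: "h \<in> space (hist k)" and hz: "snd (h k) = Some z" "z \<in> S"
    and W: "(\<lambda>y. W (Some y)) \<in> borel_measurable BS" "W None = 1" "\<And>y. y \<in> S \<Longrightarrow> 1 \<le> W (Some y)"
    and v: "1 \<le> v" and \<delta>: "0 < \<delta>"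
    and le: "\<And>a. a \<in> A \<Longrightarrow> ennreal (v * q z a + \<delta>) \<le> (\<integral>\<^sup>+ y. W (Some y) \<partial>qt z a) + ennreal (v * c z a)"
  shows "ennreal v \<le> next_value k h W"
proof -
  obtain K where K: "\<And>a. a \<in> A \<Longrightarrow> q z a \<le> K" "\<And>a. a \<in> A \<Longrightarrow> c z a \<le> K" using rate_bound[OF hz(2)] by blast
  obtain fq where fq: "fq \<in> borel_measurable borel" "\<And>s. 0 \<le> fq s" "\<And>s. fq s \<le> K" "mix q k h z = (\<lambda>s. ennreal (fq s))"
    using mix_real[OF q_measurable h hz(2) _ K(1)] by auto
  obtain fc where fc: "fc \<in> borel_measurable borel" "\<And>s. 0 \<le> fc s" "\<And>s. fc s \<le> K" "mix c k h z = (\<lambda>s. ennreal (fc s))"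
    using mix_real[OF c_measurable h hz(2) c_nonneg[OF hz(2)] K(2)] by auto
  define G where "G t = (\<integral>\<^sup>+ a. \<integral>\<^sup>+ y. W (Some y) \<partial>qt z a \<partial>pol k h t)" for t
  note am = nn_integral_qt_action_measurable[OF W(1) hz(2)]
  have qm: "(\<lambda>a. ennreal (q z a)) \<in> borel_measurable (pol k h t)" and cm: "(\<lambda>a. ennreal (c z a)) \<in> borel_measurable (pol k h t)" for t
    unfolding measurable_pol_cong[OF h] using q_action_measurable[OF hz(2)] c_action_measurable[OF hz(2)] by measurable
  have gm: "(\<lambda>a. \<integral>\<^sup>+ y. W (Some y) \<partial>qt z a) \<in> borel_measurable (pol k h t)" for t
    unfolding measurable_pol_cong[OF h] by (rule am)
  have Gm: "G \<in> borel_measurable borel"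
  proof -
    have "(\<lambda>p. (case snd p of None \<Rightarrow> 1 | Some y \<Rightarrow> W (Some y))) \<in> borel_measurable (Mst S)"
      unfolding Mst_def
      by (rule measurable_compose[OF measurable_snd]) (rule measurable_from_Sinf, use W in auto)
    from jump_inner_measurable[OF h hz(2) this] show ?thesis unfolding G_def by simp
  qed
  have Gq: "ennreal (fq t) \<le> G t" for t
  proof -
    have "ennreal (fq t) = mix q k h z t" using fq(4) by simp
    also have "\<dots> \<le> G t"
      unfolding mix_def G_def
    proof (rule nn_integral_mono)
      fix a assume "a \<in> space (pol k h t)"
      then have a: "a \<in> A" by (simp add: space_pol[OF h])
      have "ennreal (q z a) = (\<integral>\<^sup>+ y. 1 \<partial>qt z a)" using emeasure_qt[OF hz(2) a] space_qt[OF hz(2) a] by simp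
      also have "\<dots> \<le> (\<integral>\<^sup>+ y. W (Some y) \<partial>qt z a)"
        using W(3) by (intro nn_integral_mono) (simp add: space_qt[OF hz(2) a])
      finally show "ennreal (q z a) \<le> (\<integral>\<^sup>+ y. W (Some y) \<partial>qt z a)" .
    qed
    finally show ?thesis .
  qed
  have Gv: "ennreal (v * fq t + \<delta>) \<le> G t + ennreal (v * fc t)" for t
  proof -
    interpret prob_space "pol k h t" using pol_space[OF h] by blast
    have "ennreal (v * fq t + \<delta>) = ennreal v * mix q k h z t + ennreal \<delta>"
      using fq v \<delta> by (simp add: ennreal_mult)
    also have "\<dots> = (\<integral>\<^sup>+ a. ennreal v * ennreal (q z a) + ennreal \<delta> \<partial>pol k h t)"
      unfolding mix_def using qm by (simp add: nn_integral_add nn_integral_cmult emeasure_space_1)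
    also have "\<dots> \<le> (\<integral>\<^sup>+ a. (\<integral>\<^sup>+ y. W (Some y) \<partial>qt z a) + ennreal v * ennreal (c z a) \<partial>pol k h t)"
    proof (rule nn_integral_mono)
      fix a assume "a \<in> space (pol k h t)"
      then have a: "a \<in> A" by (simp add: space_pol[OF h])
      then show "ennreal v * ennreal (q z a) + ennreal \<delta> \<le> (\<integral>\<^sup>+ y. W (Some y) \<partial>qt z a) + ennreal v * ennreal (c z a)"
        using le[OF a] v \<delta> c_nonneg[OF hz(2) a] by (simp add: ennreal_mult)
    qed
    also have "\<dots> = G t + ennreal v * mix c k h z t"
      unfolding mix_def G_def using cm gm by (simp add: nn_integral_add nn_integral_cmult)
    also have "ennreal v * mix c k h z t = ennreal (v * fc t)" using fc v by (simp add: ennreal_mult)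
    finally show ?thesis .
  qed
  show ?thesis
    unfolding next_value_Some[OF h hz W(1,2)] G_def[symmetric] fq(4) fc(4)
    by (rule one_jump_lower_bound[OF fq(1) fc(1) Gm fq(2,3) fc(2,3) v \<delta> Gq Gv])
qed

text \<open>A point mass that does not vary in time turns the mixed rate and cost into constants,
  the setting of \<open>one_jump_upper_bound\<close>.\<close>

lemma next_value_upper:
  assumes h: "h \<in> space (hist k)" and hz: "snd (h k) = Some z" "z \<in> S"
    and W: "(\<lambda>y. W (Some y)) \<in> borel_measurable BS" "W None = 1" "\<And>y. y \<in> S \<Longrightarrow> 1 \<le> W (Some y)"
    and v: "1 \<le> v" and a: "a \<in> A" and pol: "\<And>s. pol k h s = return BA a"
    and le: "(\<integral>\<^sup>+ y. W (Some y) \<partial>qt z a) + ennreal (v * c z a) \<le> ennreal (v * q z a)"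
  shows "next_value k h W \<le> ennreal v"
proof -
  have mixq: "mix q k h z = (\<lambda>_. ennreal (q z a))"
    unfolding mix_def pol using q_action_measurable[OF hz(2)] a by (auto simp: nn_integral_return)
  have mixc: "mix c k h z = (\<lambda>_. ennreal (c z a))"
    unfolding mix_def pol using c_action_measurable[OF hz(2)] a by (auto simp: nn_integral_return)
  have G: "(\<integral>\<^sup>+ a. \<integral>\<^sup>+ y. W (Some y) \<partial>qt z a \<partial>pol k h t) = (\<integral>\<^sup>+ y. W (Some y) \<partial>qt z a)" for t
    unfolding pol using nn_integral_qt_action_measurable[OF W(1) hz(2)] a by (simp add: nn_integral_return)
  have "ennreal (q z a) = (\<integral>\<^sup>+ y. 1 \<partial>qt z a)" using emeasure_qt[OF hz(2) a] space_qt[OF hz(2) a] by simp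
  also have "\<dots> \<le> (\<integral>\<^sup>+ y. W (Some y) \<partial>qt z a)"
    using W(3) by (intro nn_integral_mono) (simp add: space_qt[OF hz(2) a])
  finally have gq: "ennreal (q z a) \<le> (\<integral>\<^sup>+ y. W (Some y) \<partial>qt z a)" .
  show ?thesis
    unfolding next_value_Some[OF h hz W(1,2)] G mixq mixc
    by (rule one_jump_upper_bound[OF q_nonneg c_nonneg[OF hz(2) a] v gq le])
qed

lemma next_value_ge_1:
  assumes h: "h \<in> space (hist k)" and W: "W \<in> borel_measurable (Sinf S)" "\<And>s. s \<in> space (Sinf S) \<Longrightarrow> 1 \<le> W s"
  shows "1 \<le> next_value k h W"
  using h
proof (cases rule: hist_state_cases)
  case 1
  then show ?thesis unfolding next_value_def using W(2)[of None] by (simp add: space_Sinf)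
next
  case (2 z)
  have "stage k h \<in> borel_measurable (Mst S)"
    using measurable_Pair2[OF stage_measurable h] by simp
  moreover have "(\<lambda>p. W (snd p)) \<in> borel_measurable (Mst S)" unfolding Mst_def using W by measurable
  ultimately have m: "(\<lambda>p. ennexp (stage k h p) * W (snd p)) \<in> borel_measurable (Mst S)" by measurable
  interpret prob_space "jump S qt pol k h z" by (rule prob_space_jump[OF h 2(2)])
  have "1 = (\<integral>\<^sup>+ p. 1 * 1 \<partial>jump S qt pol k h z)" by (simp add: emeasure_space_1)
  also have "\<dots> \<le> (\<integral>\<^sup>+ p. ennexp (stage k h p) * W (snd p) \<partial>jump S qt pol k h z)"
  proof (intro nn_integral_mono mult_mono ennexp_ge_1 W(2))
    fix p assume "p \<in> space (jump S qt pol k h z)"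
    then have "p \<in> space (Mst S)" using sets_eq_imp_space_eq[OF sets_jump[OF h 2(2)]] by simp
    then show "snd p \<in> space (Sinf S)" unfolding Mst_def space_pair_measure by auto
  qed auto
  also have "\<dots> = next_value k h W"
    unfolding next_value_def using 2 by (simp add: nn_integral_jump[OF h 2(2) m])
  finally show ?thesis .
qed

lemma next_value_None: "snd (h k) = None \<Longrightarrow> next_value k h W = W None"
  unfolding next_value_def by simp

end

section \<open>The optimality operator\<close>

text \<open>The projection and selection theorems live on whole Polish spaces, the model on Borel
  subsets; this passes from the trace product to the ambient one.\<close>

lemma measurable_pair_restrict_borel:
  fixes S :: "'s::second_countable_topology set" and A :: "'b::second_countable_topology set"
  assumes S: "S \<in> sets borel" and A: "A \<in> sets borel"
    and B: "B \<in> sets (restrict_space borel S \<Otimes>\<^sub>M restrict_space borel A)"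
  shows "B \<in> sets (borel :: ('s \<times> 'b) measure)"
proof -
  have SA: "S \<times> A \<in> sets (borel :: ('s \<times> 'b) measure)"
    unfolding borel_prod[symmetric] using S A by auto
  have "(\<lambda>p. p) \<in> restrict_space (borel \<Otimes>\<^sub>M borel) (S \<times> A) \<rightarrow>\<^sub>M restrict_space borel S \<Otimes>\<^sub>M restrict_space borel A"
    unfolding measurable_pair_iff comp_def
    by (intro conjI measurable_restrict_space3 measurable_fst measurable_snd) auto
  from measurable_sets[OF this B]
  have "B \<inter> (S \<times> A) \<in> sets (restrict_space (borel :: ('s \<times> 'b) measure) (S \<times> A))"
    by (simp add: space_restrict_space borel_prod space_pair_measure)
  moreover have "B \<subseteq> S \<times> A"
    using sets.sets_into_space[OF B] by (simp add: space_pair_measure space_restrict_space)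
  ultimately show ?thesis using SA by (simp add: sets_restrict_space_iff Int_absorb2)
qed

context ctmdp_model
begin

definition g :: "('s \<Rightarrow> ennreal) \<Rightarrow> 's \<Rightarrow> 'b \<Rightarrow> ennreal" where
  "g V x a = (\<integral>\<^sup>+ y. V y \<partial>qt x a)"

text \<open>The optimality inequality at level v, without subtraction, so that an infinite integral
  makes the action infeasible. The slack d is 0 for the exact condition and positive for actions
  that only approach the infimum.\<close>

definition feas :: "('s \<Rightarrow> ennreal) \<Rightarrow> 's \<Rightarrow> real \<Rightarrow> real \<Rightarrow> 'b set" where
  "feas V x v d = {a\<in>A. g V x a + ennreal (v * c x a) \<le> ennreal (v * q x a + d)}"

text \<open>\<open>L V x\<close> is the optimal value at \<open>x\<close> when \<open>V\<close> is collected at the first jump; it is attained by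
  constant controls, and a constant \<open>a\<close> with value at most \<open>v\<close> is exactly one in \<open>feas V x v 0\<close>.\<close>

definition L :: "('s \<Rightarrow> ennreal) \<Rightarrow> 's \<Rightarrow> ennreal" where
  "L V x = (INF v\<in>{v. 1 \<le> v \<and> feas V x v 0 \<noteq> {}}. ennreal v)"

lemma g_mono: "x \<in> S \<Longrightarrow> a \<in> A \<Longrightarrow> (\<And>y. y \<in> S \<Longrightarrow> V y \<le> V' y) \<Longrightarrow> g V x a \<le> g V' x a"
  unfolding g_def by (intro nn_integral_mono) (simp add: space_qt)

lemma g_ge_q:
  assumes "x \<in> S" "a \<in> A" "\<And>y. y \<in> S \<Longrightarrow> 1 \<le> V y"
  shows "ennreal (q x a) \<le> g V x a"
proof -
  have "ennreal (q x a) = g (\<lambda>_. 1) x a" unfolding g_def using emeasure_qt[OF assms(1,2)] space_qt[OF assms(1,2)] by simp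
  also have "\<dots> \<le> g V x a" by (rule g_mono[OF assms])
  finally show ?thesis .
qed

lemma feasD:
  assumes a: "a \<in> feas V x v d" and "x \<in> S" "0 \<le> v" "0 \<le> d"
  obtains g' where "a \<in> A" "g V x a = ennreal g'" "0 \<le> g'" "g' + v * c x a \<le> v * q x a + d"
proof -
  have aA: "a \<in> A" and le: "g V x a + ennreal (v * c x a) \<le> ennreal (v * q x a + d)" using a unfolding feas_def by auto
  have "g V x a \<le> ennreal (v * q x a + d)" using le by (metis dual_order.trans le_iff_add)
  then obtain g' where g': "g V x a = ennreal g'" "0 \<le> g'" by (cases "g V x a") (auto simp: top_unique)
  have "0 \<le> v * c x a" using c_nonneg[OF assms(2) aA] assms by simp
  then have "ennreal (g' + v * c x a) \<le> ennreal (v * q x a + d)" using le g' by simp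
  moreover have "0 \<le> v * q x a + d" using assms by simp
  ultimately have "g' + v * c x a \<le> v * q x a + d" by (simp add: ennreal_le_iff)
  then show ?thesis using that aA g' by blast
qed

lemma feasI:
  assumes "a \<in> A" "g V x a = ennreal g'" "0 \<le> g'" "x \<in> S" "0 \<le> v" "g' + v * c x a \<le> v * q x a + d"
  shows "a \<in> feas V x v d"
proof -
  have "0 \<le> v * c x a" using c_nonneg assms by simp
  then show ?thesis unfolding feas_def using assms by (simp add: ennreal_leI flip: ennreal_plus)
qed

text \<open>Feasibility at v reads g <= v (q - c); as g >= 0 and v > 0 this forces q >= c, and then
  the right side increases with v. The feasible levels thus form an upper set.\<close>

lemma feas_mono:
  assumes "x \<in> S" "1 \<le> v" "v \<le> v'"
  shows "feas V x v 0 \<subseteq> feas V x v' 0"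
proof
  fix a assume "a \<in> feas V x v 0"
  then obtain g' where g': "a \<in> A" "g V x a = ennreal g'" "0 \<le> g'" "g' + v * c x a \<le> v * q x a + 0"
    using feasD[of a V x v 0] assms by (metis order_refl order_trans zero_le_one)
  have "0 \<le> v * (q x a - c x a)" using g' by (simp add: algebra_simps)
  then have "0 \<le> q x a - c x a" using assms by (simp add: zero_le_mult_iff)
  then have "v * (q x a - c x a) \<le> v' * (q x a - c x a)" using assms by (intro mult_right_mono) auto
  then show "a \<in> feas V x v' 0" using g' assms by (intro feasI[of _ _ _ g']) (auto simp: algebra_simps)
qed

lemma feas_antimono:
  assumes "x \<in> S" "\<And>y. y \<in> S \<Longrightarrow> V y \<le> V' y" "d \<le> d'"
  shows "feas V' x v d \<subseteq> feas V x v d'"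
proof
  fix a assume a: "a \<in> feas V' x v d"
  then have "a \<in> A" unfolding feas_def by blast
  then have "g V x a + ennreal (v * c x a) \<le> g V' x a + ennreal (v * c x a)"
    using assms by (intro add_right_mono g_mono) auto
  also have "\<dots> \<le> ennreal (v * q x a + d)" using a unfolding feas_def by blast
  also have "\<dots> \<le> ennreal (v * q x a + d')" using assms by (intro ennreal_leI) simp
  finally show "a \<in> feas V x v d'" unfolding feas_def using \<open>a \<in> A\<close> by blast
qed

lemma L_ge_1: "1 \<le> L V x"
  unfolding L_def by (rule INF_greatest) (simp add: ennreal_1[symmetric] del: ennreal_1)

lemma L_mono: "x \<in> S \<Longrightarrow> (\<And>y. y \<in> S \<Longrightarrow> V y \<le> V' y) \<Longrightarrow> L V x \<le> L V' x"
  unfolding L_def using feas_antimono[of x V V' 0 0] by (intro INF_superset_mono) blast+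

lemma feas_measurable:
  assumes V[measurable]: "V \<in> borel_measurable BS" and v: "v \<in> borel_measurable BS"
  shows "{(x, a) \<in> S \<times> A. a \<in> feas V x (v x) d} \<in> sets (BS \<Otimes>\<^sub>M BA)"
proof -
  note [measurable] = v
  have "(\<lambda>(w, y). V y) \<in> borel_measurable ((BS \<Otimes>\<^sub>M BA) \<Otimes>\<^sub>M BS)" by measurable
  then have [measurable]: "(\<lambda>p. g V (fst p) (snd p)) \<in> borel_measurable (BS \<Otimes>\<^sub>M BA)"
    unfolding g_def by (rule nn_integral_qt_measurable) measurable
  have [measurable]: "(\<lambda>p. q (fst p) (snd p)) \<in> borel_measurable (BS \<Otimes>\<^sub>M BA)" "(\<lambda>p. c (fst p) (snd p)) \<in> borel_measurable (BS \<Otimes>\<^sub>M BA)"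
    using q_measurable c_measurable by (simp_all add: split_beta')
  have "{p \<in> space (BS \<Otimes>\<^sub>M BA). g V (fst p) (snd p) + ennreal (v (fst p) * c (fst p) (snd p)) \<le> ennreal (v (fst p) * q (fst p) (snd p) + d)} \<in> sets (BS \<Otimes>\<^sub>M BA)"
    by measurable
  also have "{p \<in> space (BS \<Otimes>\<^sub>M BA). g V (fst p) (snd p) + ennreal (v (fst p) * c (fst p) (snd p)) \<le> ennreal (v (fst p) * q (fst p) (snd p) + d)}
      = {(x, a) \<in> S \<times> A. a \<in> feas V x (v x) d}"
    unfolding feas_def by (auto simp: space_pair_measure)
  finally show ?thesis .
qed

text \<open>Nothing is charged in the cemetery, so the multiplicative value there is 1.\<close>

definition lift :: "('s \<Rightarrow> ennreal) \<Rightarrow> 's option \<Rightarrow> ennreal" where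
  "lift V s = (case s of None \<Rightarrow> 1 | Some y \<Rightarrow> V y)"

lemma lift_simps[simp]: "lift V None = 1" "lift V (Some y) = V y"
  unfolding lift_def by simp_all

lemma lift_measurable: "V \<in> borel_measurable BS \<Longrightarrow> lift V \<in> borel_measurable (Sinf S)"
  by (rule measurable_from_Sinf) auto

definition opt_val :: "('s \<Rightarrow> ennreal) \<Rightarrow> 's \<Rightarrow> 'b \<Rightarrow> ereal" where
  "opt_val V x a = ereal (c x a * enn2real (V x)) + enn2ereal (\<integral>\<^sup>+ y. V y \<partial>qt x a) - ereal (q x a * enn2real (V x))"

text \<open>Translates the equation in extended reals into feasibility at the level
  \<open>enn2real (V x)\<close>; if the integral of V is infinite, both sides are false.\<close>

lemma opt_val_le_iff:
  assumes "x \<in> S" "a \<in> A" "0 \<le> d"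
  shows "opt_val V x a \<le> ereal d \<longleftrightarrow> a \<in> feas V x (enn2real (V x)) d"
proof (cases "g V x a")
  case (real g')
  have *: "0 \<le> enn2real (V x) * c x a" "0 \<le> enn2real (V x) * q x a" using c_nonneg[OF assms(1,2)] by auto
  have "opt_val V x a = ereal (c x a * enn2real (V x) + g' - q x a * enn2real (V x))"
    unfolding opt_val_def using real by (simp add: g_def enn2ereal_ennreal)
  moreover have "a \<in> feas V x (enn2real (V x)) d \<longleftrightarrow> g' + enn2real (V x) * c x a \<le> enn2real (V x) * q x a + d"
    unfolding feas_def using real * assms by (simp flip: ennreal_plus)
  ultimately show ?thesis by (auto simp: algebra_simps)
next
  case top
  then show ?thesis unfolding opt_val_def feas_def by (simp add: g_def top_unique)
qed

lemma opt_val_nonneg_iff: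
  assumes "x \<in> S" "a \<in> A"
  shows "0 \<le> opt_val V x a \<longleftrightarrow> ennreal (enn2real (V x) * q x a) \<le> g V x a + ennreal (enn2real (V x) * c x a)"
proof (cases "g V x a")
  case (real g')
  have *: "0 \<le> enn2real (V x) * c x a" "0 \<le> enn2real (V x) * q x a" using c_nonneg[OF assms(1,2)] by auto
  have "opt_val V x a = ereal (c x a * enn2real (V x) + g' - q x a * enn2real (V x))"
    unfolding opt_val_def using real by (simp add: g_def enn2ereal_ennreal)
  moreover have "ennreal (enn2real (V x) * q x a) \<le> g V x a + ennreal (enn2real (V x) * c x a) \<longleftrightarrow> enn2real (V x) * q x a \<le> g' + enn2real (V x) * c x a"
    using real * by (simp flip: ennreal_plus)
  ultimately show ?thesis by (auto simp: algebra_simps)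
next
  case top
  then show ?thesis unfolding opt_val_def by (simp add: g_def)
qed

lemma opt_eq_iff: "opt_eq S A qt c V \<longleftrightarrow> (\<forall>x\<in>S. V x < \<top> \<longrightarrow> (INF a\<in>A. opt_val V x a) = 0)"
  unfolding opt_eq_def opt_val_def ..

end

section \<open>Value iteration and the minimal solution\<close>

text \<open>The two parts of the theorem differ only in the class \<open>cls\<close> of sublevel sets: relatively closed
  sets in (a), measurable sets in (b).\<close>

locale ctmdp_regular = ctmdp_model S A qt c
  for S :: "'s::polish_space set" and A :: "'b::polish_space set"
    and qt :: "'s \<Rightarrow> 'b \<Rightarrow> 's measure" and c :: "'s \<Rightarrow> 'b \<Rightarrow> real" +
  fixes cls :: "'s set \<Rightarrow> bool"
  assumes compact_A: "compact A"
    and cls_S: "cls S" and cls_empty: "cls {}"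
    and cls_INT: "\<And>X :: nat \<Rightarrow> 's set. (\<And>n. cls (X n)) \<Longrightarrow> cls (\<Inter>n. X n)"
    and cls_measurable: "\<And>X. cls X \<Longrightarrow> X \<in> sets BS"
    and compact_feas: "\<And>V x v d. (\<And>u. cls {x\<in>S. V x \<le> u}) \<Longrightarrow> x \<in> S \<Longrightarrow> 1 \<le> v \<Longrightarrow> 0 \<le> d \<Longrightarrow> compact (feas V x v d)"
    and cls_feas: "\<And>V v. (\<And>u. cls {x\<in>S. V x \<le> u}) \<Longrightarrow> 1 \<le> v \<Longrightarrow> cls {x\<in>S. feas V x v 0 \<noteq> {}}"
begin

definition regular :: "('s \<Rightarrow> ennreal) \<Rightarrow> bool" where
  "regular V \<longleftrightarrow> (\<forall>u. cls {x\<in>S. V x \<le> u})"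

lemma regular_measurable: "regular V \<Longrightarrow> V \<in> borel_measurable BS"
  by (rule borel_measurableI_le) (auto simp: regular_def intro: cls_measurable)

lemma regular_compact_feas: "regular V \<Longrightarrow> x \<in> S \<Longrightarrow> 1 \<le> v \<Longrightarrow> 0 \<le> d \<Longrightarrow> compact (feas V x v d)"
  unfolding regular_def using compact_feas by blast

text \<open>The sets with slack 1/(n+1) are compact and decreasing; a common action satisfies the
  inequality with every slack, hence with none.\<close>

lemma feas_limit:
  assumes V: "regular V" and x: "x \<in> S" and v: "1 \<le> v" and ne: "\<And>n. feas V x v (inverse (real (Suc n))) \<noteq> {}"
  shows "feas V x v 0 \<noteq> {}"
proof -
  have "(\<Inter>n. feas V x v (inverse (real (Suc n)))) \<noteq> {}"
  proof (rule compact_decreasing_nonempty)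
    show "compact (feas V x v (inverse (real (Suc n))))" for n by (rule regular_compact_feas[OF V x v]) simp
    show "feas V x v (inverse (real (Suc n))) \<noteq> {}" for n by (rule ne)
    show "feas V x v (inverse (real (Suc n))) \<subseteq> feas V x v (inverse (real (Suc m)))" if "m \<le> n" for m n
      using that by (intro feas_antimono[OF x]) (auto simp: field_simps)
  qed
  then obtain a where a: "\<And>n. a \<in> feas V x v (inverse (real (Suc n)))" by blast
  obtain g' where g': "a \<in> A" "g V x a = ennreal g'" "0 \<le> g'"
    using feasD[OF a[of 0] x] v by (metis inverse_nonnegative_iff_nonnegative of_nat_0_le_iff order_trans zero_le_one)
  have "g' + v * c x a - v * q x a \<le> inverse (real (Suc n))" for n
  proof -
    have "0 \<le> v" "0 \<le> inverse (real (Suc n))" using v by auto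
    from feasD[OF a[of n] x this] obtain g'' where "g V x a = ennreal g''" "0 \<le> g''" "g'' + v * c x a \<le> v * q x a + inverse (real (Suc n))"
      by metis
    then show ?thesis using g' by simp
  qed
  then have "g' + v * c x a - v * q x a \<le> 0"
    using reals_Archimedean[of "g' + v * c x a - v * q x a"] by (meson not_le order.strict_trans2)
  then have "a \<in> feas V x v 0" using g' x v by (intro feasI[of _ _ _ g']) auto
  then show ?thesis by blast
qed

text \<open>Says that the infimum in \<open>L\<close> is attained, so that sublevel sets of
  \<open>L V\<close> are projections of feasible sets. The sets at levels v + 1/(n+1) are nonempty
  by monotonicity in the level, compact and decreasing, and a common action works for v
  itself.\<close>

lemma L_le_iff:
  assumes V: "regular V" and x: "x \<in> S" and v: "1 \<le> v"
  shows "L V x \<le> ennreal v \<longleftrightarrow> feas V x v 0 \<noteq> {}"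
proof
  assume "feas V x v 0 \<noteq> {}"
  then show "L V x \<le> ennreal v" unfolding L_def using v by (intro INF_lower) auto
next
  assume le: "L V x \<le> ennreal v"
  have ne: "feas V x (v + inverse (real (Suc n))) 0 \<noteq> {}" for n
  proof -
    have "0 < inverse (real (Suc n))" by simp
    then have "ennreal v < ennreal (v + inverse (real (Suc n)))" using v by (intro ennreal_lessI) linarith+
    then have "L V x < ennreal (v + inverse (real (Suc n)))" using le by (rule order_le_less_trans[rotated])
    then obtain u where u: "1 \<le> u" "feas V x u 0 \<noteq> {}" "ennreal u < ennreal (v + inverse (real (Suc n)))"
      unfolding L_def by (auto simp: INF_less_iff)
    have "u \<le> v + inverse (real (Suc n))" using u by (simp add: ennreal_less_iff)
    then show ?thesis using feas_mono[OF x u(1)] u(2) by blast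
  qed
  have "(\<Inter>n. feas V x (v + inverse (real (Suc n))) 0) \<noteq> {}"
  proof (rule compact_decreasing_nonempty)
    have v1: "1 \<le> v + inverse (real (Suc n))" for n
      using v by (smt (verit) inverse_nonnegative_iff_nonnegative of_nat_0_le_iff)
    show "compact (feas V x (v + inverse (real (Suc n))) 0)" for n by (rule regular_compact_feas[OF V x v1]) simp
    show "feas V x (v + inverse (real (Suc n))) 0 \<noteq> {}" for n by (rule ne)
    show "feas V x (v + inverse (real (Suc n))) 0 \<subseteq> feas V x (v + inverse (real (Suc m))) 0" if "m \<le> n" for m n
      using that by (intro feas_mono[OF x v1]) (auto simp: field_simps)
  qed
  then obtain a where a: "\<And>n. a \<in> feas V x (v + inverse (real (Suc n))) 0" by blast
  have v0: "0 \<le> v + inverse (real (Suc n))" for n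
    using v by (smt (verit) inverse_nonnegative_iff_nonnegative of_nat_0_le_iff)
  obtain g' where g': "a \<in> A" "g V x a = ennreal g'" "0 \<le> g'"
    using feasD[OF a[of 0] x v0] by (metis order_refl)
  \<comment> \<open>Raising the level by 1/(n+1) buys at most q/(n+1) in the inequality, which
    vanishes in the limit.\<close>
  have "g' + v * c x a - v * q x a \<le> q x a * inverse (real (Suc n))" for n
  proof -
    from feasD[OF a[of n] x v0 order_refl] obtain g'' where
      g'': "g V x a = ennreal g''" "0 \<le> g''" "g'' + (v + inverse (real (Suc n))) * c x a \<le> (v + inverse (real (Suc n))) * q x a + 0"
      by metis
    have "0 \<le> inverse (real (Suc n)) * c x a" using c_nonneg[OF x g'(1)] by simp
    then show ?thesis using g' g'' by (simp add: algebra_simps)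
  qed
  moreover have "(\<lambda>n. q x a * inverse (real (Suc n))) \<longlonglongrightarrow> q x a * 0"
    by (intro tendsto_mult tendsto_const LIMSEQ_inverse_real_of_nat)
  ultimately have "g' + v * c x a - v * q x a \<le> q x a * 0"
    by (intro LIMSEQ_le_const) auto
  then have "a \<in> feas V x v 0" using g' x v by (intro feasI[of _ _ _ g']) auto
  then show "feas V x v 0 \<noteq> {}" by blast
qed

lemma regular_L:
  assumes V: "regular V"
  shows "regular (L V)"
  unfolding regular_def
proof
  fix u :: ennreal
  show "cls {x\<in>S. L V x \<le> u}"
  proof (cases u)
    case (real v)
    show ?thesis
    proof (cases "1 \<le> v")
      case True
      then have "{x\<in>S. L V x \<le> u} = {x\<in>S. feas V x v 0 \<noteq> {}}" using L_le_iff[OF V _ True] real by auto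
      then show ?thesis using cls_feas[of V v] V True unfolding regular_def by simp
    next
      case False
      then have "u < 1" using real by (simp add: ennreal_1[symmetric] ennreal_lessI del: ennreal_1)
      then have "\<not> L V x \<le> u" for x using L_ge_1[of V x] by (meson leD order_trans)
      then have "{x\<in>S. L V x \<le> u} = {}" by blast
      then show ?thesis using cls_empty by metis
    qed
  qed (use cls_S in auto)
qed

text \<open>Value iteration; the constant 1 corresponds to charging nothing after the last jump that
  is counted.\<close>

primrec U :: "nat \<Rightarrow> 's \<Rightarrow> ennreal" where
  "U 0 = (\<lambda>_. 1)"
| "U (Suc n) = L (U n)"

definition Ulim :: "'s \<Rightarrow> ennreal" where
  "Ulim x = (SUP n. U n x)"

lemma regular_U: "regular (U n)"
proof (induction n)
  case 0
  have "{x\<in>S. (1::ennreal) \<le> u} = S \<or> {x\<in>S. (1::ennreal) \<le> u} = {}" for u by auto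
  then show ?case unfolding regular_def using cls_S cls_empty by (auto, metis)
qed (simp add: regular_L)

lemma U_ge_1: "1 \<le> U n x"
  by (cases n) (simp_all add: L_ge_1)

lemma U_Suc_mono: "x \<in> S \<Longrightarrow> U n x \<le> U (Suc n) x"
proof (induction n arbitrary: x)
  case 0
  then show ?case using L_ge_1 by simp
next
  case (Suc n)
  then show ?case using L_mono[of x "U n" "U (Suc n)"] by simp
qed

lemma U_mono: "x \<in> S \<Longrightarrow> incseq (\<lambda>n. U n x)"
  by (rule incseq_SucI) (rule U_Suc_mono)

lemma U_le_Ulim: "U n x \<le> Ulim x"
  unfolding Ulim_def by (rule SUP_upper) simp

lemma Ulim_ge_1: "1 \<le> Ulim x"
  using U_ge_1[of 0 x] U_le_Ulim[of 0 x] by simp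

lemma regular_Ulim: "regular Ulim"
  unfolding regular_def
proof
  fix u
  have "{x\<in>S. Ulim x \<le> u} = (\<Inter>n. {x\<in>S. U n x \<le> u})"
    unfolding Ulim_def by (auto simp: SUP_le_iff)
  then show "cls {x\<in>S. Ulim x \<le> u}"
    using cls_INT[of "\<lambda>n. {x\<in>S. U n x \<le> u}"] regular_U unfolding regular_def by simp
qed

lemma g_Ulim: "x \<in> S \<Longrightarrow> a \<in> A \<Longrightarrow> g Ulim x a = (SUP n. g (U n) x a)"
proof -
  assume xa: "x \<in> S" "a \<in> A"
  have "g Ulim x a = (\<integral>\<^sup>+ y. (SUP n. indicator S y * U n y) \<partial>qt x a)"
    unfolding g_def Ulim_def by (intro nn_integral_cong) (simp add: space_qt[OF xa])
  also have "\<dots> = (SUP n. \<integral>\<^sup>+ y. indicator S y * U n y \<partial>qt x a)"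
  proof (rule nn_integral_monotone_convergence_SUP)
    show "incseq (\<lambda>n y. indicator S y * U n y)"
      using incseqD[OF U_mono] by (auto simp: incseq_def le_fun_def indicator_def)
    have "S \<in> sets BS" by (metis sets.top space_BS)
    then show "(\<lambda>y. indicator S y * U n y) \<in> borel_measurable (qt x a)" for n
      unfolding measurable_qt_cong[OF xa] using regular_measurable[OF regular_U] by measurable
  qed
  also have "\<dots> = (SUP n. g (U n) x a)"
    unfolding g_def by (intro SUP_cong refl nn_integral_cong) (simp add: space_qt[OF xa])
  finally show ?thesis .
qed

text \<open>At the level v = \<open>Ulim x\<close> each \<open>U n\<close> admits an action, since
  \<open>U (Suc n)\<close> stays below v. These compact sets decrease in n, and monotone convergence
  shows that a common action is feasible for the limit.\<close>

lemma Ulim_feas: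
  assumes x: "x \<in> S" and fin: "Ulim x < \<top>"
  shows "feas Ulim x (enn2real (Ulim x)) 0 \<noteq> {}" "1 \<le> enn2real (Ulim x)" "ennreal (enn2real (Ulim x)) = Ulim x"
proof -
  define v where "v = enn2real (Ulim x)"
  show e: "ennreal (enn2real (Ulim x)) = Ulim x" using fin by (simp add: ennreal_enn2real)
  then have "ennreal 1 \<le> ennreal v" unfolding v_def using Ulim_ge_1 by simp
  then show v1: "1 \<le> enn2real (Ulim x)" unfolding v_def by (simp add: ennreal_le_iff2)
  have v: "1 \<le> v" using v1 unfolding v_def .
  have "(\<Inter>n. feas (U n) x v 0) \<noteq> {}"
  proof (rule compact_decreasing_nonempty)
    show "compact (feas (U n) x v 0)" for n by (rule regular_compact_feas[OF regular_U x v]) simp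
    show "feas (U n) x v 0 \<noteq> {}" for n
      using L_le_iff[OF regular_U x v, of n] U_le_Ulim[of "Suc n" x] e unfolding v_def by simp
    show "feas (U n) x v 0 \<subseteq> feas (U m) x v 0" if "m \<le> n" for m n
      by (rule feas_antimono[OF x]) (use incseqD[OF U_mono that] in auto)
  qed
  then obtain a where a: "\<And>n. a \<in> feas (U n) x v 0" by blast
  then have aA: "a \<in> A" unfolding feas_def by blast
  have "g Ulim x a + ennreal (v * c x a) = (SUP n. g (U n) x a + ennreal (v * c x a))"
    unfolding g_Ulim[OF x aA] by (rule ennreal_SUP_add_left[symmetric]) simp
  also have "\<dots> \<le> ennreal (v * q x a + 0)" using a unfolding feas_def by (intro SUP_least) blast
  finally show "feas Ulim x (enn2real (Ulim x)) 0 \<noteq> {}" using aA unfolding feas_def v_def by blast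
qed

text \<open>The action of \<open>Ulim_feas\<close> gives infimum <= 0. An action with negative value
  would be feasible for the limit at a level below \<open>Ulim x\<close>, hence for each
  \<open>U n\<close>, and would bound all iterates by that smaller level.\<close>

lemma opt_eq_Ulim: "opt_eq S A qt c Ulim"
  unfolding opt_eq_iff
proof (intro ballI impI antisym)
  fix x assume x: "x \<in> S" and fin: "Ulim x < \<top>"
  define v where "v = enn2real (Ulim x)"
  note U = Ulim_feas[OF x fin, folded v_def]
  from U(1) obtain a where a: "a \<in> feas Ulim x v 0" by blast
  then have aA: "a \<in> A" unfolding feas_def by blast
  then have "opt_val Ulim x a \<le> ereal 0" using opt_val_le_iff[OF x aA order_refl, of Ulim] a unfolding v_def by blast
  then show "(INF a\<in>A. opt_val Ulim x a) \<le> 0" using INF_lower2[OF aA] by (simp add: zero_ereal_def)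
  show "0 \<le> (INF a\<in>A. opt_val Ulim x a)"
  proof (rule INF_greatest)
    fix a assume aA: "a \<in> A"
    show "0 \<le> opt_val Ulim x a"
    proof (rule ccontr)
      assume "\<not> 0 \<le> opt_val Ulim x a"
      then have less: "g Ulim x a + ennreal (v * c x a) < ennreal (v * q x a)"
        unfolding opt_val_nonneg_iff[OF x aA] v_def by simp
      then have "a \<in> feas Ulim x v 0" unfolding feas_def using aA by simp
      then obtain g' where g': "g Ulim x a = ennreal g'" "0 \<le> g'"
        using feasD[OF _ x, of a Ulim v 0] U(2) by (metis order_refl order_trans zero_le_one)
      have cn: "0 \<le> v * c x a" using c_nonneg[OF x aA] U(2) by simp
      have "g' + v * c x a < v * q x a"
        using less g' cn by (simp add: ennreal_less_iff flip: ennreal_plus)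
      then have lt: "g' < v * (q x a - c x a)" by (simp add: algebra_simps)
      then have "0 < v * (q x a - c x a)" using g' by linarith
      then have pos: "0 < q x a - c x a" using U(2) by (simp add: zero_less_mult_iff)
      \<comment> \<open>The level at which the action is exactly balanced. It is at least 1 because
        g' >= q >= q - c, the integrand being at least 1.\<close>
      define v' where "v' = g' / (q x a - c x a)"
      have v'v: "v' < v" unfolding v'_def using lt pos by (simp add: divide_less_eq)
      have "q x a \<le> g'" using g_ge_q[OF x aA, of Ulim] Ulim_ge_1 g' by (simp add: ennreal_le_iff)
      then have v'1: "1 \<le> v'" unfolding v'_def using pos c_nonneg[OF x aA] by (simp add: le_divide_eq)
      have "g' = v' * (q x a - c x a)" unfolding v'_def using pos by simp
      then have "a \<in> feas Ulim x v' 0" using aA g' x v'1 by (intro feasI[of _ _ _ g']) (auto simp: algebra_simps)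
      then have "feas (U n) x v' 0 \<noteq> {}" for n using feas_antimono[OF x, of "U n" Ulim 0 0 v'] U_le_Ulim by blast
      then have "U (Suc n) x \<le> ennreal v'" for n using L_le_iff[OF regular_U x v'1] by simp
      then have "U n x \<le> ennreal v'" for n
        using U_Suc_mono[OF x, of n] order_trans by blast
      then have "Ulim x \<le> ennreal v'" unfolding Ulim_def by (rule SUP_least)
      then have "ennreal v \<le> ennreal v'" using U(3) by simp
      then show False using v'v v'1 by (simp add: ennreal_le_iff)
    qed
  qed
qed

text \<open>An infimum equal to 0 yields feasible actions with arbitrarily small slack, and
  \<open>feas_limit\<close> removes the slack.\<close>

lemma solution_ge_L:
  assumes V: "regular V" "\<And>x. x \<in> S \<Longrightarrow> 1 \<le> V x" "opt_eq S A qt c V" and x: "x \<in> S"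
  shows "L V x \<le> V x"
proof (cases "V x < \<top>")
  case True
  define v where "v = enn2real (V x)"
  have e: "ennreal v = V x" unfolding v_def using True by (simp add: ennreal_enn2real)
  then have "ennreal 1 \<le> ennreal v" using V(2)[OF x] by simp
  then have v: "1 \<le> v" by (simp add: ennreal_le_iff2)
  have inf: "(INF a\<in>A. opt_val V x a) = 0" using V(3) x True unfolding opt_eq_iff by blast
  have "feas V x v (inverse (real (Suc n))) \<noteq> {}" for n
  proof -
    have "(INF a\<in>A. opt_val V x a) < ereal (inverse (real (Suc n)))" unfolding inf by simp
    then obtain a where a: "a \<in> A" "opt_val V x a < ereal (inverse (real (Suc n)))" by (auto simp: INF_less_iff)
    then have "a \<in> feas V x v (inverse (real (Suc n)))"
      using opt_val_le_iff[OF x a(1), of "inverse (real (Suc n))" V] less_imp_le[OF a(2)] unfolding v_def by simp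
    then show ?thesis by blast
  qed
  then have "feas V x v 0 \<noteq> {}" by (rule feas_limit[OF V(1) x v])
  then show ?thesis using L_le_iff[OF V(1) x v] e by simp
next
  case False
  then show ?thesis by (simp add: not_less top_unique)
qed

lemma solution_ge_Ulim:
  assumes V: "regular V" "\<And>x. x \<in> S \<Longrightarrow> 1 \<le> V x" "opt_eq S A qt c V" and x: "x \<in> S"
  shows "Ulim x \<le> V x"
proof -
  have "U n x \<le> V x" if "x \<in> S" for n x
    using that
  proof (induction n arbitrary: x)
    case (Suc n)
    have "U (Suc n) x \<le> L V x" using L_mono[of x "U n" V] Suc by simp
    also have "\<dots> \<le> V x" by (rule solution_ge_L[OF V Suc.prems])
    finally show ?case .
  qed (use V in simp)
  then show ?thesis unfolding Ulim_def using x by (intro SUP_least) simp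
qed

text \<open>The contrapositive of \<open>feas_limit\<close>: some slack 1/(n+1) is still infeasible,
  and it is the margin \<open>\<delta>\<close> of the one-jump bound, uniform over actions.\<close>

lemma feas_empty_gap:
  assumes V: "regular V" and x: "x \<in> S" and v: "1 \<le> v" and empty: "feas V x v 0 = {}"
  shows "\<exists>\<delta>>0. \<forall>a\<in>A. ennreal (v * q x a + \<delta>) \<le> g V x a + ennreal (v * c x a)"
proof -
  obtain n where n: "feas V x v (inverse (real (Suc n))) = {}"
    using feas_limit[OF V x v] empty by blast
  then have "ennreal (v * q x a + inverse (real (Suc n))) \<le> g V x a + ennreal (v * c x a)" if "a \<in> A" for a
    using that unfolding feas_def by (auto simp: not_le less_imp_le)
  then show ?thesis by (intro exI[of _ "inverse (real (Suc n))"]) simp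
qed

text \<open>Each transition trades \<open>U (Suc m)\<close> at the current state for
  \<open>U m\<close> at the next one. From \<open>U n\<close> at time 0 the induction reaches
  \<open>U (n - k)\<close> after k jumps, and n jumps leave the terminal value 1, that is, the
  expected exponential cost up to jump n.\<close>

lemma Vcrit_ge_Ulim:
  assumes pol: "is_policy S A pol" and x: "x \<in> S"
  shows "Ulim x \<le> Vcrit S qt c pol x"
proof -
  interpret ctmdp_policy S A qt c pol by unfold_locales (rule pol)
  have step: "lift (U (Suc m)) (snd (h k)) \<le> next_value k h (lift (U m))" if h: "h \<in> space (hist k)" for h k m
    using h
  proof (cases rule: hist_state_cases)
    case 1
    then show ?thesis by (simp add: next_value_None)
  next
    case (2 z)
    have Wm: "(\<lambda>y. lift (U m) (Some y)) \<in> borel_measurable BS" using regular_measurable[OF regular_U] by simp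
    have "L (U m) z \<le> next_value k h (lift (U m))"
    \<comment> \<open>A finite level below \<open>L (U m) z\<close> is infeasible and so has a
      margin; the value \<open>L (U m) z\<close> itself may be infinite. Levels below 1 are covered
      by \<open>next_value_ge_1\<close>.\<close>
    proof (rule dense_le)
      fix u assume u: "u < L (U m) z"
      show "u \<le> next_value k h (lift (U m))"
      proof (cases "1 \<le> u")
        case True
        have "u < \<top>" using u by (meson order_less_le_trans top_greatest)
        then obtain v where v: "u = ennreal v" "0 \<le> v" by (cases u) auto
        have v1: "1 \<le> v" using True v by (simp add: ennreal_1[symmetric] del: ennreal_1)
        have "feas (U m) z v 0 = {}" using L_le_iff[OF regular_U 2(2) v1, of m] u v by auto
        then obtain \<delta> where \<delta>: "0 < \<delta>" "\<forall>a\<in>A. ennreal (v * q z a + \<delta>) \<le> g (U m) z a + ennreal (v * c z a)"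
          using feas_empty_gap[OF regular_U 2(2) v1] by blast
        show ?thesis unfolding v(1)
          by (rule next_value_lower[OF h 2 Wm _ _ v1 \<delta>(1)]) (use \<delta>(2) U_ge_1 in \<open>auto simp: g_def\<close>)
      next
        case False
        then have "u \<le> 1" by simp
        also have "1 \<le> next_value k h (lift (U m))"
          by (rule next_value_ge_1[OF h lift_measurable[OF regular_measurable[OF regular_U]]])
            (auto simp: lift_def U_ge_1 split: option.split)
        finally show ?thesis .
      qed
    qed
    then show ?thesis using 2 by simp
  qed
  have lm: "lift (U m) \<in> borel_measurable (Sinf S)" for m by (rule lift_measurable[OF regular_measurable[OF regular_U]])
  have "U n x \<le> Ek x k (lift (U (n - k)))" if "k \<le> n" for n k
    using that
  proof (induction k)
    case 0
    then show ?case using Ek_0[OF x lm] by simp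
  next
    case (Suc k)
    then have "U n x \<le> Ek x k (lift (U (Suc (n - Suc k))))" by (simp add: Suc_diff_Suc)
    also have "\<dots> \<le> Ek x (Suc k) (lift (U (n - Suc k)))" by (rule Ek_Suc_ge[OF x lm step])
    finally show ?case .
  qed
  from this[OF order_refl] have "U n x \<le> Ek x n (\<lambda>_. 1)" for n
    by (simp add: lift_def[abs_def] option.case_eq_if)
  also have "Ek x n (\<lambda>_. 1) \<le> Vcrit S qt c pol x" for n
    unfolding Vcrit_eq_SUP[OF x] by (rule SUP_upper) simp
  finally show ?thesis unfolding Ulim_def by (intro SUP_least)
qed

text \<open>Where \<open>Ulim\<close> is finite, the feasible actions form a Borel graph with
  nonempty compact sections, to which measurable selection applies. Where it is infinite a fixed
  action suffices, as the bound to be met is trivial there.\<close>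

lemma selector_exists:
  "\<exists>f. f \<in> BS \<rightarrow>\<^sub>M BA \<and> (\<forall>x\<in>S. Ulim x < \<top> \<longrightarrow> f x \<in> feas Ulim x (enn2real (Ulim x)) 0)"
proof -
  have Um[measurable]: "Ulim \<in> borel_measurable BS" by (rule regular_measurable[OF regular_Ulim])
  define D where "D = {x\<in>S. Ulim x < \<top>}"
  have "D \<in> sets BS" unfolding D_def using measurable_sets[OF Um, of "{..<\<top>}"] by (simp add: vimage_def Int_def conj_commute)
  then have D: "D \<in> sets borel" using S_borel by (simp add: sets_restrict_space_iff)
  define B where "B = {(x, a) \<in> S \<times> A. a \<in> feas Ulim x (enn2real (Ulim x)) 0} \<inter> D \<times> UNIV"
  have "{(x, a) \<in> S \<times> A. a \<in> feas Ulim x (enn2real (Ulim x)) 0} \<in> sets borel"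
    by (rule measurable_pair_restrict_borel[OF S_borel A_borel feas_measurable]) measurable
  moreover have "D \<times> UNIV \<in> sets (borel :: ('s \<times> 'b) measure)" unfolding borel_prod[symmetric] using D by auto
  ultimately have B: "B \<in> sets borel" unfolding B_def by (rule sets.Int)
  have sec: "{a. (x, a) \<in> B} = (if x \<in> D then feas Ulim x (enn2real (Ulim x)) 0 else {})" for x
    unfolding B_def D_def feas_def by auto
  have csec: "compact {a. (x, a) \<in> B}" for x
    unfolding sec using regular_compact_feas[OF regular_Ulim] Ulim_feas(2) by (auto simp: D_def)
  have BK: "B \<subseteq> UNIV \<times> A" unfolding B_def by auto
  have fstB: "fst ` B = D"
  proof (intro equalityI subsetI)
    fix x assume x: "x \<in> D"
    then have "{a. (x, a) \<in> B} \<noteq> {}" unfolding sec using Ulim_feas(1)[of x] by (simp add: D_def)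
    then show "x \<in> fst ` B" by force
  qed (auto simp: B_def)
  obtain f where f: "f \<in> borel_measurable (restrict_space borel D)" "\<And>x. x \<in> D \<Longrightarrow> (x, f x) \<in> B"
    using measurable_selection_compact_sections[OF B csec compact_A BK] unfolding fstB by blast
  obtain a0 where a0: "a0 \<in> A" using A_ne by blast
  define F where "F x = (if x \<in> D then f x else a0)" for x
  have "F \<in> borel_measurable borel"
    unfolding F_def using f(1) D by (subst measurable_restrict_space_iff[symmetric]) auto
  then have "F \<in> borel_measurable BS" by (rule measurable_restrict_space1)
  moreover have "F x \<in> A" for x unfolding F_def using f(2) BK a0 by auto
  ultimately have "F \<in> BS \<rightarrow>\<^sub>M BA" by (intro measurable_restrict_space2) auto
  moreover have "F x \<in> feas Ulim x (enn2real (Ulim x)) 0" if "x \<in> S" "Ulim x < \<top>" for x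
  proof -
    have "x \<in> D" using that unfolding D_def by blast
    then show ?thesis using f(2)[of x] unfolding F_def B_def by auto
  qed
  ultimately show ?thesis by blast
qed

text \<open>Under the selected actions one transition does not increase the expectation of
  \<open>lift Ulim\<close>, so \<open>Ek x k (lift Ulim)\<close> never exceeds its initial value
  \<open>Ulim x\<close>. Since \<open>Ulim\<close> >= 1, it dominates the expected exponential cost
  up to jump k.\<close>

lemma policy_le_Ulim: "\<exists>pol. is_policy S A pol \<and> (\<forall>x\<in>S. Vcrit S qt c pol x \<le> Ulim x)"
proof -
  obtain f where f: "f \<in> BS \<rightarrow>\<^sub>M BA" "\<And>x. x \<in> S \<Longrightarrow> Ulim x < \<top> \<Longrightarrow> f x \<in> feas Ulim x (enn2real (Ulim x)) 0"
    using selector_exists by blast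
  obtain a0 where a0: "a0 \<in> A" using A_ne by blast
  define F where "F s = (case s of None \<Rightarrow> a0 | Some z \<Rightarrow> f z)" for s
  have F: "F \<in> Sinf S \<rightarrow>\<^sub>M BA" by (rule measurable_from_Sinf) (use f a0 in \<open>auto simp: F_def\<close>)
  define pol :: "('s, 'b) policy" where "pol n h s = return BA (F (snd (h n)))" for n h s
  have pol: "is_policy S A pol"
    unfolding is_policy_def
  proof
    fix n
    have "(\<lambda>p. snd (fst p n)) \<in> hist n \<Otimes>\<^sub>M (borel :: real measure) \<rightarrow>\<^sub>M Sinf S"
    proof -
      have 1: "(\<lambda>p. fst p n) \<in> hist n \<Otimes>\<^sub>M (borel :: real measure) \<rightarrow>\<^sub>M Mst S" by measurable
      have 2: "snd \<in> Mst S \<rightarrow>\<^sub>M Sinf S" unfolding Mst_def by measurable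
      show ?thesis by (rule measurable_compose[OF 1 2])
    qed
    from measurable_compose[OF measurable_compose[OF this F] measurable_return_prob_space]
    show "(\<lambda>(h, s). pol n h s) \<in> hist n \<Otimes>\<^sub>M (borel :: real measure) \<rightarrow>\<^sub>M prob_algebra BA"
      unfolding pol_def by (simp add: split_beta')
  qed
  interpret ctmdp_policy S A qt c pol by unfold_locales (rule pol)
  have lm: "lift Ulim \<in> borel_measurable (Sinf S)" by (rule lift_measurable[OF regular_measurable[OF regular_Ulim]])
  have step: "next_value k h (lift Ulim) \<le> lift Ulim (snd (h k))" if h: "h \<in> space (hist k)" for h k
    using h
  proof (cases rule: hist_state_cases)
    case 1
    then show ?thesis by (simp add: next_value_None)
  next
    case (2 z)
    show ?thesis
    proof (cases "Ulim z < \<top>")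
      case True
      note fz = f(2)[OF 2(2) True]
      then have a: "f z \<in> A" unfolding feas_def by blast
      have "next_value k h (lift Ulim) \<le> ennreal (enn2real (Ulim z))"
      proof (rule next_value_upper[OF h 2 _ _ _ Ulim_feas(2)[OF 2(2) True] a])
        show "(\<lambda>y. lift Ulim (Some y)) \<in> borel_measurable BS" using regular_measurable[OF regular_Ulim] by simp
        show "pol k h s = return BA (f z)" for s unfolding pol_def F_def using 2 by simp
        show "(\<integral>\<^sup>+ y. lift Ulim (Some y) \<partial>qt z (f z)) + ennreal (enn2real (Ulim z) * c z (f z)) \<le> ennreal (enn2real (Ulim z) * q z (f z))"
          using fz unfolding feas_def g_def by simp
      qed (simp_all add: Ulim_ge_1)
      then show ?thesis using 2 Ulim_feas(3)[OF 2(2) True] by simp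
    next
      case False
      then show ?thesis using 2 by (simp add: not_less top_unique)
    qed
  qed
  have "Vcrit S qt c pol x \<le> Ulim x" if x: "x \<in> S" for x
  proof -
    have "Ek x k (lift Ulim) \<le> Ulim x" for k
    proof (induction k)
      case 0
      then show ?case using Ek_0[OF x lm] by simp
    next
      case (Suc k)
      have "Ek x (Suc k) (lift Ulim) \<le> Ek x k (lift Ulim)" by (rule Ek_Suc_le[OF x lm step])
      then show ?case using Suc by (rule order_trans)
    qed
    moreover have "Ek x k (\<lambda>_. 1) \<le> Ek x k (lift Ulim)" for k
      by (rule Ek_mono[OF x]) (auto simp: lift_def Ulim_ge_1 split: option.split)
    ultimately show ?thesis unfolding Vcrit_eq_SUP[OF x] by (meson SUP_least order_trans)
  qed
  then show ?thesis using pol by blast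
qed

lemma Vstar_eq_Ulim: "x \<in> S \<Longrightarrow> Vstar S A qt c x = Ulim x"
proof (rule antisym)
  assume x: "x \<in> S"
  obtain pol where "is_policy S A pol" "Vcrit S qt c pol x \<le> Ulim x" using policy_le_Ulim x by blast
  then show "Vstar S A qt c x \<le> Ulim x" unfolding Vstar_def by (intro INF_lower2[of pol]) auto
  show "Ulim x \<le> Vstar S A qt c x" unfolding Vstar_def using Vcrit_ge_Ulim x by (intro INF_greatest) auto
qed

text \<open>\<open>Vstar\<close> and \<open>Ulim\<close> are identified on S only; the jump measures
  live on S, so the equation sees nothing else.\<close>

lemma opt_eq_cong:
  assumes "\<And>x. x \<in> S \<Longrightarrow> V x = V' x"
  shows "opt_eq S A qt c V \<longleftrightarrow> opt_eq S A qt c V'"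
proof -
  have "(\<integral>\<^sup>+ y. V y \<partial>qt x a) = (\<integral>\<^sup>+ y. V' y \<partial>qt x a)" if "x \<in> S" "a \<in> A" for x a
    by (rule nn_integral_cong) (use assms in \<open>simp add: space_qt[OF that]\<close>)
  then show ?thesis unfolding opt_eq_def using assms by simp
qed

lemma Vstar_minimal_solution:
  shows "\<forall>x\<in>S. 1 \<le> Vstar S A qt c x" "regular (Vstar S A qt c)" "opt_eq S A qt c (Vstar S A qt c)"
    "\<And>V. \<forall>x\<in>S. 1 \<le> V x \<Longrightarrow> regular V \<Longrightarrow> opt_eq S A qt c V \<Longrightarrow> \<forall>x\<in>S. Vstar S A qt c x \<le> V x"
proof -
  show "\<forall>x\<in>S. 1 \<le> Vstar S A qt c x" using Vstar_eq_Ulim Ulim_ge_1 by simp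
  have "{x\<in>S. Vstar S A qt c x \<le> u} = {x\<in>S. Ulim x \<le> u}" for u using Vstar_eq_Ulim by auto
  then show "regular (Vstar S A qt c)" using regular_Ulim unfolding regular_def by simp
  show "opt_eq S A qt c (Vstar S A qt c)" using opt_eq_cong[OF Vstar_eq_Ulim] opt_eq_Ulim by simp
  fix V assume "\<forall>x\<in>S. 1 \<le> V x" "regular V" "opt_eq S A qt c V"
  then show "\<forall>x\<in>S. Vstar S A qt c x \<le> V x" using solution_ge_Ulim Vstar_eq_Ulim by simp
qed

end

section \<open>Semicontinuity and the main theorem\<close>

lemma openin_eventually:
  assumes "U \<subseteq> D" "\<And>p. p \<in> U \<Longrightarrow> eventually (\<lambda>y. y \<in> U) (at p within D)"
  shows "openin (top_of_set D) U"
  unfolding openin_subopen[of _ U]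
proof
  fix p assume p: "p \<in> U"
  obtain T where T: "open T" "p \<in> T" "\<And>y. y \<in> T \<Longrightarrow> y \<noteq> p \<Longrightarrow> y \<in> D \<Longrightarrow> y \<in> U"
    using assms(2)[OF p] unfolding eventually_at_topological by blast
  have "D \<inter> T \<subseteq> U" using T(3) p by blast
  then show "\<exists>T. openin (top_of_set D) T \<and> p \<in> T \<and> T \<subseteq> U"
    using T(1,2) p assms(1) by (intro exI[of _ "D \<inter> T"]) auto
qed

lemma eventually_openin:
  assumes "openin (top_of_set D) U" "p \<in> U"
  shows "eventually (\<lambda>y. y \<in> U) (at p within D)"
proof -
  obtain T where "open T" "U = D \<inter> T" using assms(1) openin_open by blast
  then show ?thesis using assms(2) unfolding eventually_at_topological by blast
qed

text \<open>Puts lower semicontinuity into the form required of \<open>regular\<close>: membership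
  of all sublevel sets in one class.\<close>

lemma lsc_on_iff_closedin:
  fixes f :: "'a::topological_space \<Rightarrow> 'c::linorder"
  shows "lsc_on S f \<longleftrightarrow> (\<forall>u. closedin (top_of_set S) {x\<in>S. f x \<le> u})"
proof -
  have "S - {x\<in>S. f x \<le> u} = {x\<in>S. u < f x}" for u by auto
  then have *: "closedin (top_of_set S) {x\<in>S. f x \<le> u} \<longleftrightarrow> openin (top_of_set S) {x\<in>S. u < f x}" for u
    unfolding closedin_def by auto
  have "openin (top_of_set S) {x\<in>S. u < f x}" if "lsc_on S f" for u
  proof (rule openin_eventually)
    fix p assume p: "p \<in> {x\<in>S. u < f x}"
    then have "eventually (\<lambda>y. u < f y) (at p within S)" using that unfolding lsc_on_def by blast
    moreover have "eventually (\<lambda>y. y \<in> S) (at p within S)" by (auto simp: eventually_at_topological)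
    ultimately show "eventually (\<lambda>y. y \<in> {x\<in>S. u < f x}) (at p within S)"
      by eventually_elim simp
  qed auto
  moreover have "lsc_on S f" if "\<And>u. openin (top_of_set S) {x\<in>S. u < f x}"
    unfolding lsc_on_def
  proof (intro ballI allI impI)
    fix x t assume "x \<in> S" "t < f x"
    then show "eventually (\<lambda>y. t < f y) (at x within S)"
      using eventually_openin[OF that[of t], of x] by (auto elim: eventually_mono)
  qed
  ultimately show ?thesis unfolding * by blast
qed

lemma closedin_lsc_le_continuous:
  fixes f h :: "'a::topological_space \<Rightarrow> real"
  assumes f: "lsc_on D f" and h: "continuous_on D h"
  shows "closedin (top_of_set D) {p\<in>D. f p \<le> h p}"
proof -
  have "openin (top_of_set D) {p\<in>D. h p < f p}"
  proof (rule openin_eventually)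
    fix p assume "p \<in> {p\<in>D. h p < f p}"
    then have p: "p \<in> D" "h p < f p" by auto
    obtain t where t: "h p < t" "t < f p" using dense[OF p(2)] by blast
    have "eventually (\<lambda>y. t < f y) (at p within D)" using f p t unfolding lsc_on_def by blast
    moreover have "eventually (\<lambda>y. h y < t) (at p within D)"
      using h p t unfolding continuous_on_def by (blast intro: order_tendstoD)
    moreover have "eventually (\<lambda>y. y \<in> D) (at p within D)" by (auto simp: eventually_at_topological)
    ultimately show "eventually (\<lambda>y. y \<in> {p\<in>D. h p < f p}) (at p within D)"
      by eventually_elim simp
  qed auto
  moreover have "D - {p\<in>D. f p \<le> h p} = {p\<in>D. h p < f p}" by auto
  ultimately show ?thesis unfolding closedin_def by auto
qed

text \<open>Lipschitz regularisation: \<open>f\<^sub>k y = inf\<^sub>z (min (V z) k + k dist y z)\<close> increases to \<open>V\<close>.\<close>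

lemma lsc_eq_SUP_continuous:
  fixes V :: "'s::metric_space \<Rightarrow> ennreal"
  assumes V: "lsc_on S V"
  shows "\<exists>f :: nat \<Rightarrow> 's \<Rightarrow> real. (\<forall>k. continuous_on S (f k)) \<and> (\<forall>k. \<forall>y\<in>S. 0 \<le> f k y \<and> f k y \<le> real k)
    \<and> (\<forall>y\<in>S. incseq (\<lambda>k. f k y)) \<and> (\<forall>y\<in>S. V y = (SUP k. ennreal (f k y)))"
proof -
  define m where "m k z = enn2real (min (V z) (ennreal (real k)))" for k z
  have mle: "m k z \<le> real k" "0 \<le> m k z" for k z
    unfolding m_def by (auto intro: enn2real_leI)
  have me: "ennreal (m k z) = min (V z) (ennreal (real k))" for k z
    unfolding m_def by (simp add: min_less_iff_disj)
  have mmono: "m k z \<le> m l z" if "k \<le> l" for k l z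
    unfolding m_def using that by (intro enn2real_mono) (auto simp: min_le_iff_disj min_less_iff_disj)
  define f where "f k y = (INF z\<in>S. m k z + real k * dist y z)" for k y
  have low: "f k y \<le> m k z + real k * dist y z" if "z \<in> S" for k y z
    unfolding f_def by (rule cINF_lower[OF _ that]) (use mle in \<open>auto intro!: bdd_belowI[of _ 0]\<close>)
  have great: "r \<le> f k y" if "\<And>z. z \<in> S \<Longrightarrow> r \<le> m k z + real k * dist y z" "S \<noteq> {}" for r k y
    unfolding f_def using that by (intro cINF_greatest) auto
  have lip: "f k y \<le> f k y' + real k * dist y y'" if "S \<noteq> {}" for k y y'
  proof -
    have "f k y - real k * dist y y' \<le> f k y'"
    proof (rule great[OF _ that])
      fix z assume z: "z \<in> S"
      have "real k * dist y z \<le> real k * (dist y y' + dist y' z)"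
        by (intro mult_left_mono dist_triangle) simp
      then show "f k y - real k * dist y y' \<le> m k z + real k * dist y' z"
        using low[OF z, of k y] by (simp add: algebra_simps)
    qed
    then show ?thesis by simp
  qed
  have "continuous_on S (f k)" for k
  proof (cases "S = {}")
    case False
    have "(real k)-lipschitz_on S (f k)"
    proof (rule lipschitz_onI)
      fix x y assume "x \<in> S" "y \<in> S"
      show "dist (f k x) (f k y) \<le> real k * dist x y"
        using lip[OF False, of k x y] lip[OF False, of k y x] by (simp add: dist_real_def dist_commute abs_le_iff)
    qed simp
    then show ?thesis by (rule lipschitz_on_continuous_on)
  qed simp
  moreover have "0 \<le> f k y \<and> f k y \<le> real k" if y: "y \<in> S" for k y
  proof
    show "0 \<le> f k y" using y mle by (intro great) auto
    show "f k y \<le> real k" using low[OF y, of k y] mle(1)[of k y] by simp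
  qed
  moreover have "incseq (\<lambda>k. f k y)" if y: "y \<in> S" for y
    unfolding incseq_def
  proof (intro allI impI great)
    fix k l :: nat and z assume "k \<le> l" "z \<in> S"
    have "f k y \<le> m k z + real k * dist y z" by (rule low[OF \<open>z \<in> S\<close>])
    also have "\<dots> \<le> m l z + real l * dist y z"
      using mmono[OF \<open>k \<le> l\<close>] \<open>k \<le> l\<close> by (intro add_mono mult_right_mono) auto
    finally show "f k y \<le> m l z + real l * dist y z" .
  qed (use y in auto)
  moreover have "V y = (SUP k. ennreal (f k y))" if y: "y \<in> S" for y
  proof (rule antisym)
    show "(SUP k. ennreal (f k y)) \<le> V y"
    proof (rule SUP_least)
      fix k
      have "ennreal (f k y) \<le> ennreal (m k y)" using low[OF y, of k y] by (intro ennreal_leI) simp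
      also have "\<dots> \<le> V y" unfolding me by simp
      finally show "ennreal (f k y) \<le> V y" .
    qed
    show "V y \<le> (SUP k. ennreal (f k y))"
    proof (rule dense_le)
      fix t assume t: "t < V y"
      then have "t < \<top>" by (meson order_less_le_trans top_greatest)
      then obtain r where r: "t = ennreal r" "0 \<le> r" by (cases t) auto
      have "eventually (\<lambda>z. t < V z) (at y within S)" using V y t unfolding lsc_on_def by blast
      then obtain \<delta> where \<delta>: "0 < \<delta>" "\<And>z. z \<in> S \<Longrightarrow> z \<noteq> y \<Longrightarrow> dist z y < \<delta> \<Longrightarrow> t < V z"
        unfolding eventually_at by blast
      \<comment> \<open>Near y, where V exceeds t = r, the bound k >= r keeps the truncation above
        r; at distance at least \<open>\<delta>\<close>, the bound k >= r / \<open>\<delta>\<close>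
        makes the penalty alone reach r.\<close>
      obtain k :: nat where k: "max r (r / \<delta>) \<le> real k" using real_arch_simple by blast
      have "r \<le> f k y"
      proof (rule great)
        fix z assume z: "z \<in> S"
        show "r \<le> m k z + real k * dist y z"
        proof (cases "dist z y < \<delta>")
          case True
          then have "t < V z" using \<delta>(2)[OF z] t by (cases "z = y") auto
          then have "ennreal r \<le> ennreal (m k z)" unfolding me using r k by (simp add: ennreal_leI)
          then have "r \<le> m k z" using mle by (simp add: ennreal_le_iff)
          then show ?thesis by (simp add: add_increasing2)
        next
          case False
          have "r \<le> real k * \<delta>" using k \<delta>(1) by (simp add: divide_le_eq)
          also have "\<dots> \<le> real k * dist y z" using False by (intro mult_left_mono) (auto simp: dist_commute)
          finally show ?thesis using mle(2)[of k z] by simp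
        qed
      qed (use y in auto)
      then have "t \<le> ennreal (f k y)" unfolding r by (rule ennreal_leI)
      also have "\<dots> \<le> (SUP k. ennreal (f k y))" by (rule SUP_upper) simp
      finally show "t \<le> (SUP k. ennreal (f k y))" .
    qed
  qed
  ultimately show ?thesis by blast
qed

section \<open>The two regularity classes\<close>

context ctmdp_model
begin

lemma finite_measure_qt: "x \<in> S \<Longrightarrow> a \<in> A \<Longrightarrow> finite_measure (qt x a)"
  by (rule finite_measureI) (simp add: space_qt emeasure_qt)

text \<open>The continuity assumptions concern integrals of bounded functions, while V may be
  unbounded or infinite. Approximation from below by bounded functions and monotone convergence
  replace the one inequality by countably many real ones.\<close>

lemma feas_iff_approx:
  fixes f :: "nat \<Rightarrow> 's \<Rightarrow> real"
  assumes f: "\<And>k. f k \<in> borel_measurable BS" "\<And>k y. y \<in> S \<Longrightarrow> 0 \<le> f k y" "\<And>k y. y \<in> S \<Longrightarrow> f k y \<le> real k"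
    "\<And>y. y \<in> S \<Longrightarrow> incseq (\<lambda>k. f k y)" "\<And>y. y \<in> S \<Longrightarrow> V y = (SUP k. ennreal (f k y))"
    and x: "x \<in> S" and v: "0 \<le> v" and d: "0 \<le> d"
  shows "a \<in> feas V x v d \<longleftrightarrow> a \<in> A \<and> (\<forall>k. (\<integral>y. f k y \<partial>qt x a) + v * c x a \<le> v * q x a + d)"
proof (cases "a \<in> A")
  case a: True
  interpret finite_measure "qt x a" by (rule finite_measure_qt[OF x a])
  have fm: "f k \<in> borel_measurable (qt x a)" for k unfolding measurable_qt_cong[OF x a] by (rule f(1))
  note [measurable] = fm
  have int: "(\<integral>\<^sup>+ y. ennreal (f k y) \<partial>qt x a) = ennreal (\<integral>y. f k y \<partial>qt x a)" for k
  proof (rule nn_integral_eq_integral)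
    show "integrable (qt x a) (f k)"
      by (rule integrable_const_bound[where B="real k"]) (use f(2,3) in \<open>auto intro!: AE_I2 simp: space_qt[OF x a]\<close>)
    show "AE y in qt x a. 0 \<le> f k y" using f(2) by (intro AE_I2) (simp add: space_qt[OF x a])
  qed
  have nn: "0 \<le> (\<integral>y. f k y \<partial>qt x a)" for k
    using f(2) by (intro integral_nonneg_AE AE_I2) (simp add: space_qt[OF x a])
  have "g V x a = (\<integral>\<^sup>+ y. (SUP k. ennreal (f k y)) \<partial>qt x a)"
    unfolding g_def using f(5) by (intro nn_integral_cong) (simp add: space_qt[OF x a])
  also have "\<dots> = (SUP k. \<integral>\<^sup>+ y. ennreal (f k y) \<partial>qt x a)"
  proof (rule nn_integral_monotone_convergence_SUP_AE)
    show "AE y in qt x a. ennreal (f k y) \<le> ennreal (f (Suc k) y)" for k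
      using f(4) by (intro AE_I2 ennreal_leI) (auto simp: space_qt[OF x a] incseq_def)
  qed measurable
  finally have "g V x a + ennreal (v * c x a) = (SUP k. ennreal (\<integral>y. f k y \<partial>qt x a) + ennreal (v * c x a))"
    unfolding int by (simp add: ennreal_SUP_add_left)
  also have "\<dots> = (SUP k. ennreal ((\<integral>y. f k y \<partial>qt x a) + v * c x a))"
    using nn c_nonneg[OF x a] v by simp
  finally have eq: "g V x a + ennreal (v * c x a) = (SUP k. ennreal ((\<integral>y. f k y \<partial>qt x a) + v * c x a))" .
  have rhs: "0 \<le> v * q x a + d" using v d by simp
  show ?thesis unfolding feas_def mem_Collect_eq eq SUP_le_iff ennreal_le_iff[OF rhs] using a by simp
qed (simp add: feas_def)

text \<open>Each condition is solved for the cost, leaving a lower semicontinuous left side and a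
  right side built from continuous integrals; a set of this form is closed.\<close>

lemma feas_eq_INT:
  assumes "\<And>a. a \<in> feas V x v d \<longleftrightarrow> a \<in> A \<and> (\<forall>k::nat. I k a + v * c x a \<le> v * q x a + d)" "0 < v"
  shows "feas V x v d = (\<Inter>k. {a\<in>A. c x a \<le> (v * q x a + d - I k a) / v})"
  using assms by (auto simp: field_simps)

lemma q_eq_integral: "x \<in> S \<Longrightarrow> a \<in> A \<Longrightarrow> (\<integral>y. 1 \<partial>qt x a) = q x a"
  by (simp add: qrate_def space_qt)

text \<open>Truncations min V k are the bounded approximants, which makes the feasible set closed in
  a for each fixed x. Jointly it is only a Borel set, and its projection is Borel because its
  sections are compact.\<close>

lemma ctmdp_regular_measurable:
  assumes cont: "\<And>f :: 's \<Rightarrow> real. f \<in> borel_measurable BS \<Longrightarrow> bounded (f ` S) \<Longrightarrow> \<forall>x\<in>S. continuous_on A (\<lambda>a. \<integral>y. f y \<partial>qt x a)"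
    and lsc: "\<And>x. x \<in> S \<Longrightarrow> lsc_on A (c x)" and A: "compact A"
  shows "ctmdp_regular S A qt c (\<lambda>X. X \<in> sets BS)"
proof unfold_locales
  show "compact A" by (rule A)
  show "S \<in> sets BS" by (metis sets.top space_BS)
  have cfeas: "compact (feas V x v d)" if V: "V \<in> borel_measurable BS" and x: "x \<in> S" and v: "1 \<le> v" and d: "0 \<le> d" for V x v d
  proof -
    note [measurable] = V
    define f where "f k y = enn2real (min (V y) (ennreal (real k)))" for k y
    have fe: "ennreal (f k y) = min (V y) (ennreal (real k))" for k y
      unfolding f_def by (simp add: min_less_iff_disj)
    have fm: "f k \<in> borel_measurable BS" for k unfolding f_def by measurable
    have f0: "0 \<le> f k y" "f k y \<le> real k" for k y unfolding f_def by (auto intro: enn2real_leI)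
    have finc: "incseq (\<lambda>k. f k y)" for y
      unfolding f_def incseq_def by (intro allI impI enn2real_mono) (auto simp: min_le_iff_disj min_less_iff_disj)
    have fS: "V y = (SUP k. ennreal (f k y))" for y
    proof (rule antisym)
      show "V y \<le> (SUP k. ennreal (f k y))"
      proof (rule dense_le)
        fix t assume t: "t < V y"
        then have "t < \<top>" by (meson order_less_le_trans top_greatest)
        then obtain r where r: "t = ennreal r" "0 \<le> r" by (cases t) auto
        obtain k :: nat where k: "r \<le> real k" using real_arch_simple by blast
        have "t \<le> ennreal (f k y)" unfolding fe r using t k r by (simp add: ennreal_leI)
        also have "\<dots> \<le> (SUP k. ennreal (f k y))" by (rule SUP_upper) simp
        finally show "t \<le> (SUP k. ennreal (f k y))" .
      qed
    qed (auto intro!: SUP_least simp: fe)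
    have v0: "0 \<le> v" "0 < v" using v by auto
    have bf: "bounded (f k ` S)" for k using f0 by (intro boundedI[of _ "real k"]) auto
    have contI: "continuous_on A (\<lambda>a. \<integral>y. f k y \<partial>qt x a)" for k using cont[OF fm bf] x by blast
    have b1: "bounded ((\<lambda>_. 1::real) ` S)" by (rule bounded_subset[of "{1}"]) auto
    have m1: "(\<lambda>_. 1::real) \<in> borel_measurable BS" by simp
    \<comment> \<open>The jump rate is the integral of the test function 1.\<close>
    have contq: "continuous_on A (q x)"
      using cont[OF m1 b1] x q_eq_integral[OF x] by (metis (mono_tags, lifting) continuous_on_cong)
    have "closedin (top_of_set A) {a\<in>A. c x a \<le> (v * q x a + d - (\<integral>y. f k y \<partial>qt x a)) / v}" for k
      using v0 by (intro closedin_lsc_le_continuous lsc x continuous_intros contq contI) auto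
    then have "closedin (top_of_set A) (feas V x v d)"
      unfolding feas_eq_INT[OF feas_iff_approx[OF fm f0 finc fS x v0(1) d] v0(2)] by (intro closedin_Inter) auto
    then show ?thesis by (rule closedin_compact[OF A])
  qed
  have Vm: "V \<in> borel_measurable BS" if "\<And>u. {x\<in>S. V x \<le> u} \<in> sets BS" for V :: "'s \<Rightarrow> ennreal"
    using that by (intro borel_measurableI_le) simp
  show "compact (feas V x v d)" if "\<And>u. {x\<in>S. V x \<le> u} \<in> sets BS" "x \<in> S" "1 \<le> v" "0 \<le> d" for V x v d
    using cfeas Vm that by blast
  show "{x\<in>S. feas V x v 0 \<noteq> {}} \<in> sets BS" if V: "\<And>u. {x\<in>S. V x \<le> u} \<in> sets BS" and v: "1 \<le> v" for V v
  proof -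
    define B where "B = {(x, a) \<in> S \<times> A. a \<in> feas V x v 0}"
    have B: "B \<in> sets borel" unfolding B_def
      by (rule measurable_pair_restrict_borel[OF S_borel A_borel feas_measurable[OF Vm[OF V]]]) auto
    have "{a. (x, a) \<in> B} = (if x \<in> S then feas V x v 0 else {})" for x unfolding B_def feas_def by auto
    then have "compact {a. (x, a) \<in> B}" for x using cfeas[OF Vm[OF V] _ v] by simp
    then have "fst ` B \<in> sets borel"
      by (rule borel_projection_compact_sections[OF B _ A]) (auto simp: B_def)
    moreover have "fst ` B = {x\<in>S. feas V x v 0 \<noteq> {}}" unfolding B_def feas_def by force
    ultimately show ?thesis using S_borel by (auto simp: sets_restrict_space_iff)
  qed
qed (auto intro!: sets.countable_INT)

text \<open>A lower semicontinuous V has bounded continuous approximants from below, so the feasible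
  set is closed jointly in (x, a). Projection along the compact A is a closed map, which keeps the
  sublevel sets of \<open>L V\<close> relatively closed.\<close>

lemma ctmdp_regular_lsc:
  assumes cont: "\<And>f :: 's \<Rightarrow> real. continuous_on S f \<Longrightarrow> bounded (f ` S) \<Longrightarrow> continuous_on (S \<times> A) (\<lambda>(x, a). \<integral>y. f y \<partial>qt x a)"
    and lsc: "lsc_on (S \<times> A) (\<lambda>(x, a). c x a)" and A: "compact A"
  shows "ctmdp_regular S A qt c (closedin (top_of_set S))"
proof unfold_locales
  show "compact A" by (rule A)
  show "closedin (top_of_set S) S" "closedin (top_of_set S) {}" by auto
  show "closedin (top_of_set S) (\<Inter>n. X n)" if "\<And>n. closedin (top_of_set S) (X n)" for X :: "nat \<Rightarrow> 's set"
    using that by (intro closedin_Inter) auto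
  show "X \<in> sets BS" if "closedin (top_of_set S) X" for X
    using that S_borel unfolding closedin_closed by (auto simp: sets_restrict_space_iff)
  have closed: "closedin (top_of_set (S \<times> A)) {(x, a) \<in> S \<times> A. a \<in> feas V x v d}"
    if V: "\<And>u. closedin (top_of_set S) {x\<in>S. V x \<le> u}" and v: "1 \<le> v" and d: "0 \<le> d" for V v d
  proof -
    have "lsc_on S V" unfolding lsc_on_iff_closedin using V by blast
    then obtain f :: "nat \<Rightarrow> 's \<Rightarrow> real" where f: "\<And>k. continuous_on S (f k)"
      "\<And>k y. y \<in> S \<Longrightarrow> 0 \<le> f k y" "\<And>k y. y \<in> S \<Longrightarrow> f k y \<le> real k"
      "\<And>y. y \<in> S \<Longrightarrow> incseq (\<lambda>k. f k y)" "\<And>y. y \<in> S \<Longrightarrow> V y = (SUP k. ennreal (f k y))"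
      using lsc_eq_SUP_continuous[of S V] by metis
    have fm: "f k \<in> borel_measurable BS" for k
      using borel_measurable_continuous_on_restrict[OF f(1)] .
    have v0: "0 \<le> v" "0 < v" using v by auto
    have bf: "bounded (f k ` S)" for k using f(2,3) by (intro boundedI[of _ "real k"]) auto
    have contI: "continuous_on (S \<times> A) (\<lambda>(x, a). \<integral>y. f k y \<partial>qt x a)" for k by (rule cont[OF f(1) bf])
    have b1: "bounded ((\<lambda>_. 1::real) ` S)" by (rule bounded_subset[of "{1}"]) auto
    have "continuous_on (S \<times> A) (\<lambda>(x, a). \<integral>y. (1::real) \<partial>qt x a)" by (rule cont[OF continuous_on_const b1])
    moreover have "(\<lambda>(x, a). \<integral>y. (1::real) \<partial>qt x a) p = (\<lambda>(x, a). q x a) p" if "p \<in> S \<times> A" for p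
      using that q_eq_integral by auto
    ultimately have contq: "continuous_on (S \<times> A) (\<lambda>(x, a). q x a)"
      using continuous_on_cong[OF refl] by (metis (no_types, lifting))
    have "{(x, a) \<in> S \<times> A. a \<in> feas V x v d}
        = (\<Inter>k. {p \<in> S \<times> A. (\<lambda>(x, a). c x a) p \<le> (v * (\<lambda>(x, a). q x a) p + d - (\<lambda>(x, a). \<integral>y. f k y \<partial>qt x a) p) / v})"
      (is "?L = ?R")
    proof -
      have "(x, a) \<in> ?L \<longleftrightarrow> (x, a) \<in> ?R" for x a
      proof (cases "x \<in> S")
        case True
        then show ?thesis
          using feas_eq_INT[OF feas_iff_approx[OF fm f(2,3,4,5) True v0(1) d] v0(2)] by auto
      qed auto
      then show ?thesis by auto
    qed
    moreover have "closedin (top_of_set (S \<times> A)) {p \<in> S \<times> A. (\<lambda>(x, a). c x a) p \<le> (v * (\<lambda>(x, a). q x a) p + d - (\<lambda>(x, a). \<integral>y. f k y \<partial>qt x a) p) / v}" for k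
      using v0 by (intro closedin_lsc_le_continuous[OF lsc] continuous_intros contq contI) auto
    ultimately show ?thesis by (simp only:) (intro closedin_Inter, auto)
  qed
  show "compact (feas V x v d)" if V: "\<And>u. closedin (top_of_set S) {x\<in>S. V x \<le> u}" and x: "x \<in> S" and "1 \<le> v" "0 \<le> d" for V x v d
  proof -
    have "closedin (top_of_set A) (A \<inter> (\<lambda>a. (x, a)) -` {(x, a) \<in> S \<times> A. a \<in> feas V x v d})"
      by (rule continuous_closedin_preimage_gen[OF _ _ closed[OF V that(3,4)]]) (use x in \<open>auto intro!: continuous_intros\<close>)
    moreover have "A \<inter> (\<lambda>a. (x, a)) -` {(x, a) \<in> S \<times> A. a \<in> feas V x v d} = feas V x v d"
      using x unfolding feas_def by auto
    ultimately show ?thesis using closedin_compact[OF A] by simp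
  qed
  show "closedin (top_of_set S) {x\<in>S. feas V x v 0 \<noteq> {}}" if V: "\<And>u. closedin (top_of_set S) {x\<in>S. V x \<le> u}" and v: "1 \<le> v" for V v
  proof -
    have "closed_map (prod_topology (top_of_set S) (top_of_set A)) (top_of_set S) fst"
      by (rule Abstract_Topological_Spaces.closed_map_fst) (simp add: compact_space_subtopology A)
    moreover have "closedin (prod_topology (top_of_set S) (top_of_set A)) {(x, a) \<in> S \<times> A. a \<in> feas V x v 0}"
      using closed[OF V v order_refl] by (simp add: subtopology_Times)
    ultimately have "closedin (top_of_set S) (fst ` {(x, a) \<in> S \<times> A. a \<in> feas V x v 0})"
      unfolding closed_map_def by blast
    moreover have "fst ` {(x, a) \<in> S \<times> A. a \<in> feas V x v 0} = {x\<in>S. feas V x v 0 \<noteq> {}}" unfolding feas_def by force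
    ultimately show ?thesis by simp
  qed
qed

end

theorem theorem5p3:
  fixes S :: "'s::polish_space set" and A :: "'b::polish_space set"
    and qt :: "'s \<Rightarrow> 'b \<Rightarrow> 's measure" and c :: "'s \<Rightarrow> 'b \<Rightarrow> real"
  assumes model: "ctmdp S A qt c"
    and cbar: "\<forall>x\<in>S. bdd_above ((\<lambda>a. c x a) ` A)"
  shows
    "((\<exists>w :: 's \<Rightarrow> real. continuous_on S w \<and> w \<in> borel_measurable (restrict_space borel S) \<and>
          (\<forall>x\<in>S. 1 \<le> w x \<and> 1 + (SUP a\<in>A. c x a) + (SUP a\<in>A. qrate S qt x a) \<le> w x))
      \<and> (\<forall>f :: 's \<Rightarrow> real. continuous_on S f \<and> bounded (f ` S) \<longrightarrow>
            continuous_on (S \<times> A) (\<lambda>(x, a). \<integral> y. f y \<partial>qt x a))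
      \<and> lsc_on (S \<times> A) (\<lambda>(x, a). c x a)
      \<and> compact A
      \<longrightarrow>
        (\<forall>x\<in>S. 1 \<le> Vstar S A qt c x) \<and> lsc_on S (Vstar S A qt c) \<and> opt_eq S A qt c (Vstar S A qt c)
        \<and> (\<forall>V. (\<forall>x\<in>S. 1 \<le> V x) \<and> lsc_on S V \<and> opt_eq S A qt c V \<longrightarrow>
                (\<forall>x\<in>S. Vstar S A qt c x \<le> V x)))
     \<and>
     ((\<forall>f :: 's \<Rightarrow> real. f \<in> borel_measurable (restrict_space borel S) \<and> bounded (f ` S) \<longrightarrow>
            (\<forall>x\<in>S. continuous_on A (\<lambda>a. \<integral> y. f y \<partial>qt x a)))
      \<and> (\<forall>x\<in>S. lsc_on A (\<lambda>a. c x a))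
      \<and> compact A
      \<longrightarrow>
        (\<forall>x\<in>S. 1 \<le> Vstar S A qt c x)
        \<and> Vstar S A qt c \<in> borel_measurable (restrict_space borel S)
        \<and> opt_eq S A qt c (Vstar S A qt c)
        \<and> (\<forall>V. (\<forall>x\<in>S. 1 \<le> V x) \<and> V \<in> borel_measurable (restrict_space borel S) \<and> opt_eq S A qt c V \<longrightarrow>
                (\<forall>x\<in>S. Vstar S A qt c x \<le> V x)))"
proof -
  interpret ctmdp_model S A qt c using model cbar by unfold_locales auto
  have lsc_case: "(\<forall>x\<in>S. 1 \<le> Vstar S A qt c x) \<and> lsc_on S (Vstar S A qt c) \<and> opt_eq S A qt c (Vstar S A qt c)
        \<and> (\<forall>V. (\<forall>x\<in>S. 1 \<le> V x) \<and> lsc_on S V \<and> opt_eq S A qt c V \<longrightarrow> (\<forall>x\<in>S. Vstar S A qt c x \<le> V x))"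
    if "\<And>f :: 's \<Rightarrow> real. continuous_on S f \<Longrightarrow> bounded (f ` S) \<Longrightarrow> continuous_on (S \<times> A) (\<lambda>(x, a). \<integral>y. f y \<partial>qt x a)"
      "lsc_on (S \<times> A) (\<lambda>(x, a). c x a)" "compact A"
  proof -
    interpret ctmdp_regular S A qt c "closedin (top_of_set S)" by (rule ctmdp_regular_lsc[OF that])
    have "regular V \<longleftrightarrow> lsc_on S V" for V unfolding regular_def lsc_on_iff_closedin ..
    then show ?thesis using Vstar_minimal_solution by simp
  qed
  have measurable_case: "(\<forall>x\<in>S. 1 \<le> Vstar S A qt c x) \<and> Vstar S A qt c \<in> borel_measurable (restrict_space borel S)
        \<and> opt_eq S A qt c (Vstar S A qt c)
        \<and> (\<forall>V. (\<forall>x\<in>S. 1 \<le> V x) \<and> V \<in> borel_measurable (restrict_space borel S) \<and> opt_eq S A qt c V \<longrightarrow> (\<forall>x\<in>S. Vstar S A qt c x \<le> V x))"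
    if "\<And>f :: 's \<Rightarrow> real. f \<in> borel_measurable BS \<Longrightarrow> bounded (f ` S) \<Longrightarrow> \<forall>x\<in>S. continuous_on A (\<lambda>a. \<integral>y. f y \<partial>qt x a)"
      "\<And>x. x \<in> S \<Longrightarrow> lsc_on A (c x)" "compact A"
  proof -
    interpret ctmdp_regular S A qt c "\<lambda>X. X \<in> sets BS" by (rule ctmdp_regular_measurable[OF that])
    have "regular V \<longleftrightarrow> V \<in> borel_measurable BS" for V
    proof
      assume V: "V \<in> borel_measurable BS"
      show "regular V" unfolding regular_def
      proof
        fix u
        show "{x\<in>S. V x \<le> u} \<in> sets BS"
          using measurable_sets[OF V, of "{..u}"] by (simp add: vimage_def Int_def conj_commute)
      qed
    qed (rule regular_measurable)
    then show ?thesis using Vstar_minimal_solution by simp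
  qed
  show ?thesis
    by (rule conjI; rule impI; elim conjE) (rule lsc_case measurable_case; blast)+
qed

end
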